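(* Up to equivalence there are exactly three prime compressed $3$-dimensional flow polytopes, $\nabla_{\mathrm{I.a}}^{(3)}$, $\nabla_{\mathrm{II.c}}^{(3)}$, $\nabla_{\mathrm{I.b}}^{(3)}$. For each such $\nabla$, a tight pair $(Q,\theta)$ with $\nabla\cong\nabla(Q,\theta)$, a system of linear inequalities defining $\nabla$ as a subset of $\mathbb{R}^3$ (namely $L\ge0$, where $L$ ranges over the degree $1$ polynomials in $x,y,z$ attached below to the arrows of $Q$), and the list of the lattice points $v_0,v_1,\dots$ of $\nabla\subset\mathbb{R}^3$ are as follows. (1) $\nabla_{\mathrm{I.a}}^{(3)}$: $Q$ has vertices $p,q$ with $\theta(p)=-1$, $\theta(q)=1$, and four arrows $p\to q$ with attached polynomials $x,\ y,\ z,\ 1-x-y-z$. Lattice points: $v_0=(0,0,0)$, $v_1=(1,0,0)$, $v_2=(0,1,0)$, $v_3=(0,0,1)$. (2) $\nabla_{\mathrm{II.c}}^{(3)}$: $Q$ has vertices $p,q,r$ with $\theta(p)=-1$, $\theta(q)=0$, $\theta(r)=1$; one arrow $p\to r$ with polynomial $y$; two arrows $p\to q$ with polynomials $z$ and $1-y-z$; two arrows $q\to r$ with polynomials $x$ and $1-x-y$. Lattice points: $v_0=(0,0,0)$, $v_1=(0,0,1)$, $v_2=(1,0,0)$, $v_3=(1,0,1)$, $v_4=(0,1,0)$. (3) $\nabla_{\mathrm{I.b}}^{(3)}$: $Q$ has two sources $p,q$ with $\theta(p)=\theta(q)=-2$ and four sinks $s_1,s_2,s_3,s_4$ with $\theta(s_i)=1$,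 and exactly one arrow $p\to s_i$ and one arrow $q\to s_i$ for each $i$; the polynomials on $p\to s_1,\dots,p\to s_4$ are $x,\ y,\ 1-z,\ 1-x-y+z$, and those on $q\to s_1,\dots,q\to s_4$ are $1-x,\ 1-y,\ z,\ x+y-z$. Lattice points: $v_0=(0,0,0)$, $v_1=(1,0,0)$, $v_2=(1,0,1)$, $v_3=(0,1,0)$, $v_4=(0,1,1)$, $v_5=(1,1,1)$.
   Context: A lattice polytope is the convex hull of finitely many points of $\mathbb{Z}^d$ in $\mathbb{R}^d$. Lattice polytopes $\nabla\subset\mathbb{R}^d$ and $\nabla'\subset\mathbb{R}^{d'}$ are equivalent ($\nabla\cong\nabla'$) if there is an affine linear isomorphism $\mathrm{AffSpan}(\nabla)\to\mathrm{AffSpan}(\nabla')$ mapping $\mathrm{AffSpan}(\nabla)\cap\mathbb{Z}^d$ onto $\mathrm{AffSpan}(\nabla')\cap\mathbb{Z}^{d'}$ and $\nabla$ onto $\nabla'$. A positive dimensional lattice polytope is prime if it is not equivalent to a product of strictly smaller dimensional lattice polytopes. A lattice polytope is compressed if it has width $1$ with respect to each of its facets, i.e. for each facet it lies between the hyperplane (in the affine span) spanned by that facet and one of the two neighbouring parallel lattice hyperplanes. A quiver $Q$ is a finite directed graph with vertex set $Q_0$ and arrow set $Q_1$; multiple arrows are allowed, loops are not; $a^-$ and $a^+$ denote the tail and the head of $a\in Q_1$. For a weight $\theta\in\mathbb{Z}^{Q_0}$ put $\mathcal{A}(Q,\theta)=\{x\in\mathbb{R}^{Q_1}\mid \forall v\in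 Q_0:\ \sum_{a^+=v}x(a)-\sum_{a^-=v}x(a)=\theta(v)\}$, $\nabla(Q,\theta)=\{x\in\mathcal{A}(Q,\theta)\mid \forall a\in Q_1:\ x(a)\ge0\}$, and for $\underline{\ell},\underline{u}\in\mathbb{N}_0^{Q_1}$ put $\nabla(Q,\theta,\underline{\ell},\underline{u})=\{x\in\mathcal{A}(Q,\theta)\mid \forall a\in Q_1:\ \underline{\ell}(a)\le x(a)\le\underline{u}(a)\}$. A flow polytope is a lattice polytope equivalent to some $\nabla(Q,\theta,\underline{\ell},\underline{u})$; equivalently, to some $\nabla(Q,\theta)$ with $Q$ acyclic. For $Q$ acyclic, the pair $(Q,\theta)$ is tight if no arrow $a\in Q_1$ satisfies (R) or (C): (R) ($a$ is removable for $\theta$) $\nabla(Q,\theta)\subseteq\{x\mid x(a)=0\}$; (C) ($a$ is contractible for $\theta$) $\{x\in\mathcal{A}(Q,\theta)\mid x(a)\ge0\}\supseteq\{x\in\mathcal{A}(Q,\theta)\mid\forall b\in Q_1\setminus\{a\}:\ x(b)\ge0\}$. *)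

theory Defs
  imports "HOL-Analysis.Analysis" "HOL-Analysis.Finite_Function_Topology" "Graph_Theory.Digraph"
begin

section \<open>Lattice polytopes\<close>

text \<open>
  The space $\mathbb{R}^I$ for a finite set $I$ of indices is the set of all \<open>x :: 'i \<Rightarrow>\<^sub>0 real\<close>
  with \<open>Poly_Mapping.keys x \<subseteq> I\<close>; in particular $\mathbb{R}^d$ is the set of all
  \<open>x :: nat \<Rightarrow>\<^sub>0 real\<close> with \<open>Poly_Mapping.keys x \<subseteq> {..<d}\<close>. In this way polytopes living in
  spaces of different dimensions have the same type. A finite set of points always lies in some
  $\mathbb{R}^I$, and all notions below only depend on the affine span of a polytope together
  with its integer points, so the ambient index set $I$ need not be recorded.
\<close>

definition int_points :: "('i \<Rightarrow>\<^sub>0 real) set" where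
  "int_points = {x. \<forall>i. Poly_Mapping.lookup x i \<in> \<int>}"

definition lattice_polytope :: "('i \<Rightarrow>\<^sub>0 real) set \<Rightarrow> bool" where
  "lattice_polytope P \<longleftrightarrow> (\<exists>S. finite S \<and> S \<subseteq> int_points \<and> P = convex hull S)"

text \<open>Same convention as \<open>aff_dim\<close>, which is only available on Euclidean spaces.\<close>

definition polytope_dim :: "('i \<Rightarrow>\<^sub>0 real) set \<Rightarrow> int" where
  "polytope_dim P = (if P = {} then - 1 else int (dim {x - y | x y. x \<in> P \<and> y \<in> P}))"

definition affine_map_on ::
    "('i \<Rightarrow>\<^sub>0 real) set \<Rightarrow> (('i \<Rightarrow>\<^sub>0 real) \<Rightarrow> ('j \<Rightarrow>\<^sub>0 real)) \<Rightarrow> bool" where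
  "affine_map_on A f \<longleftrightarrow> (\<forall>x\<in>A. \<forall>y\<in>A. \<forall>s t. s + t = 1 \<longrightarrow>
     f (s *\<^sub>R x + t *\<^sub>R y) = s *\<^sub>R f x + t *\<^sub>R f y)"

definition polytope_equiv ::
    "('i \<Rightarrow>\<^sub>0 real) set \<Rightarrow> ('j \<Rightarrow>\<^sub>0 real) set \<Rightarrow> bool" (infix "\<cong>\<^sub>p" 50) where
  "P \<cong>\<^sub>p P' \<longleftrightarrow> (\<exists>f. affine_map_on (affine hull P) f \<and>
     bij_betw f (affine hull P) (affine hull P') \<and>
     f ` (affine hull P \<inter> int_points) = affine hull P' \<inter> int_points \<and>
     f ` P = P')"

text \<open>The Cartesian product, inside $\mathbb{R}^{I + J} = \mathbb{R}^I \times \mathbb{R}^J$.\<close>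

definition polytope_prod ::
    "('i \<Rightarrow>\<^sub>0 real) set \<Rightarrow> ('j \<Rightarrow>\<^sub>0 real) set \<Rightarrow> ('i + 'j \<Rightarrow>\<^sub>0 real) set" where
  "polytope_prod P P' = {z. \<exists>x\<in>P. \<exists>y\<in>P'.
     (\<forall>i. Poly_Mapping.lookup z (Inl i) = Poly_Mapping.lookup x i) \<and>
     (\<forall>j. Poly_Mapping.lookup z (Inr j) = Poly_Mapping.lookup y j)}"

definition prime_polytope :: "('i \<Rightarrow>\<^sub>0 real) set \<Rightarrow> bool" where
  "prime_polytope P \<longleftrightarrow> lattice_polytope P \<and> polytope_dim P > 0 \<and>
     \<not> (\<exists>(P1 :: (nat \<Rightarrow>\<^sub>0 real) set) (P2 :: (nat \<Rightarrow>\<^sub>0 real) set).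
          lattice_polytope P1 \<and> lattice_polytope P2 \<and>
          polytope_dim P1 < polytope_dim P \<and> polytope_dim P2 < polytope_dim P \<and>
          P \<cong>\<^sub>p polytope_prod P1 P2)"

definition facet :: "('i \<Rightarrow>\<^sub>0 real) set \<Rightarrow> ('i \<Rightarrow>\<^sub>0 real) set \<Rightarrow> bool" where
  "facet P F \<longleftrightarrow> F face_of P \<and> F \<noteq> {} \<and> polytope_dim F = polytope_dim P - 1"

text \<open>
  In the following two definitions \<open>H\<close> is a hyperplane in the affine span of \<open>P\<close>. The part of
  the affine span between two parallel hyperplanes \<open>H\<close> and \<open>H'\<close> is \<open>convex hull (H \<union> H')\<close>.
\<close>

definition parallel_lattice_hyperplane ::
    "('i \<Rightarrow>\<^sub>0 real) set \<Rightarrow> ('i \<Rightarrow>\<^sub>0 real) set \<Rightarrow> ('i \<Rightarrow>\<^sub>0 real) set \<Rightarrow> bool" where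
  "parallel_lattice_hyperplane P H H' \<longleftrightarrow>
     (\<exists>w. H' = (\<lambda>x. w + x) ` H) \<and> H' \<subseteq> affine hull P \<and> affine hull (H' \<inter> int_points) = H'"

definition neighbouring_lattice_hyperplane ::
    "('i \<Rightarrow>\<^sub>0 real) set \<Rightarrow> ('i \<Rightarrow>\<^sub>0 real) set \<Rightarrow> ('i \<Rightarrow>\<^sub>0 real) set \<Rightarrow> bool" where
  "neighbouring_lattice_hyperplane P H H' \<longleftrightarrow>
     parallel_lattice_hyperplane P H H' \<and> H' \<noteq> H \<and>
     \<not> (\<exists>H''. parallel_lattice_hyperplane P H H'' \<and> H'' \<noteq> H \<and> H'' \<noteq> H' \<and>
           H'' \<subseteq> convex hull (H \<union> H'))"

definition compressed :: "('i \<Rightarrow>\<^sub>0 real) set \<Rightarrow> bool" where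
  "compressed P \<longleftrightarrow> lattice_polytope P \<and>
     (\<forall>F. facet P F \<longrightarrow>
        (\<exists>H'. neighbouring_lattice_hyperplane P (affine hull F) H' \<and>
              P \<subseteq> convex hull (affine hull F \<union> H')))"

section \<open>Quivers and flow polytopes\<close>

definition quiver :: "('v, 'a) pre_digraph \<Rightarrow> bool" where
  "quiver Q \<longleftrightarrow> fin_digraph Q \<and> loopfree_digraph Q"

definition acyclic_quiver :: "('v, 'a) pre_digraph \<Rightarrow> bool" where
  "acyclic_quiver Q \<longleftrightarrow> quiver Q \<and> acyclic (arcs_ends Q)"

definition flow_space ::
    "('v, 'a) pre_digraph \<Rightarrow> ('v \<Rightarrow> int) \<Rightarrow> ('a \<Rightarrow>\<^sub>0 real) set" where
  "flow_space Q \<theta> = {x. Poly_Mapping.keys x \<subseteq> arcs Q \<and>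
     (\<forall>v\<in>verts Q. (\<Sum>a\<in>in_arcs Q v. Poly_Mapping.lookup x a)
                  - (\<Sum>a\<in>out_arcs Q v. Poly_Mapping.lookup x a) = of_int (\<theta> v))}"

definition quiver_polytope ::
    "('v, 'a) pre_digraph \<Rightarrow> ('v \<Rightarrow> int) \<Rightarrow> ('a \<Rightarrow>\<^sub>0 real) set" where
  "quiver_polytope Q \<theta> =
     {x \<in> flow_space Q \<theta>. \<forall>a\<in>arcs Q. 0 \<le> Poly_Mapping.lookup x a}"

definition bounded_quiver_polytope ::
    "('v, 'a) pre_digraph \<Rightarrow> ('v \<Rightarrow> int) \<Rightarrow> ('a \<Rightarrow> nat) \<Rightarrow> ('a \<Rightarrow> nat) \<Rightarrow> ('a \<Rightarrow>\<^sub>0 real) set"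
  where
  "bounded_quiver_polytope Q \<theta> l u =
     {x \<in> flow_space Q \<theta>. \<forall>a\<in>arcs Q.
        of_nat (l a) \<le> Poly_Mapping.lookup x a \<and> Poly_Mapping.lookup x a \<le> of_nat (u a)}"

text \<open>Every quiver is isomorphic to one whose vertices and arrows are natural numbers.\<close>

definition flow_polytope :: "('i \<Rightarrow>\<^sub>0 real) set \<Rightarrow> bool" where
  "flow_polytope P \<longleftrightarrow> lattice_polytope P \<and>
     (\<exists>(Q :: (nat, nat) pre_digraph) \<theta> l u. quiver Q \<and> P \<cong>\<^sub>p bounded_quiver_polytope Q \<theta> l u)"

definition removable :: "('v, 'a) pre_digraph \<Rightarrow> ('v \<Rightarrow> int) \<Rightarrow> 'a \<Rightarrow> bool" where
  "removable Q \<theta> a \<longleftrightarrow> quiver_polytope Q \<theta> \<subseteq> {x. Poly_Mapping.lookup x a = 0}"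

definition contractible :: "('v, 'a) pre_digraph \<Rightarrow> ('v \<Rightarrow> int) \<Rightarrow> 'a \<Rightarrow> bool" where
  "contractible Q \<theta> a \<longleftrightarrow>
     {x \<in> flow_space Q \<theta>. \<forall>b\<in>arcs Q - {a}. 0 \<le> Poly_Mapping.lookup x b}
       \<subseteq> {x \<in> flow_space Q \<theta>. 0 \<le> Poly_Mapping.lookup x a}"

definition tight :: "('v, 'a) pre_digraph \<Rightarrow> ('v \<Rightarrow> int) \<Rightarrow> bool" where
  "tight Q \<theta> \<longleftrightarrow> acyclic_quiver Q \<and> (\<forall>a\<in>arcs Q. \<not> removable Q \<theta> a \<and> \<not> contractible Q \<theta> a)"

section \<open>The three polytopes\<close>

definition pt3 :: "real \<Rightarrow> real \<Rightarrow> real \<Rightarrow> (nat \<Rightarrow>\<^sub>0 real)" where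
  "pt3 x y z = Poly_Mapping.nth [x, y, z]"

text \<open>
  The subset of $\mathbb{R}^3$ defined by \<open>L a \<ge> 0\<close>, where \<open>L a\<close> is the polynomial in \<open>x, y, z\<close>
  attached to the arrow \<open>a\<close>.
\<close>

definition polytope_of_arrow_polys ::
    "('v, 'a) pre_digraph \<Rightarrow> ('a \<Rightarrow> real \<Rightarrow> real \<Rightarrow> real \<Rightarrow> real) \<Rightarrow> (nat \<Rightarrow>\<^sub>0 real) set" where
  "polytope_of_arrow_polys Q L = {pt3 x y z | x y z. \<forall>a\<in>arcs Q. 0 \<le> L a x y z}"

text \<open>Vertices: \<open>p = 0\<close>, \<open>q = 1\<close>.\<close>

definition Q_Ia :: "(nat, nat) pre_digraph" where
  "Q_Ia = \<lparr>verts = {0, 1}, arcs = {..<4}, tail = (\<lambda>_. 0), head = (\<lambda>_. 1)\<rparr>"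

definition \<theta>_Ia :: "nat \<Rightarrow> int" where
  "\<theta>_Ia v = [-1, 1] ! v"

definition poly_Ia :: "nat \<Rightarrow> real \<Rightarrow> real \<Rightarrow> real \<Rightarrow> real" where
  "poly_Ia a x y z = [x, y, z, 1 - x - y - z] ! a"

definition nabla_Ia :: "(nat \<Rightarrow>\<^sub>0 real) set" where
  "nabla_Ia = polytope_of_arrow_polys Q_Ia poly_Ia"

text \<open>Vertices: \<open>p = 0\<close>, \<open>q = 1\<close>, \<open>r = 2\<close>.\<close>

definition Q_IIc :: "(nat, nat) pre_digraph" where
  "Q_IIc = \<lparr>verts = {0, 1, 2}, arcs = {..<5},
            tail = (\<lambda>a. [0, 0, 0, 1, 1] ! a),
            head = (\<lambda>a. [2, 1, 1, 2, 2] ! a)\<rparr>"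

definition \<theta>_IIc :: "nat \<Rightarrow> int" where
  "\<theta>_IIc v = [-1, 0, 1] ! v"

definition poly_IIc :: "nat \<Rightarrow> real \<Rightarrow> real \<Rightarrow> real \<Rightarrow> real" where
  "poly_IIc a x y z = [y, z, 1 - y - z, x, 1 - x - y] ! a"

definition nabla_IIc :: "(nat \<Rightarrow>\<^sub>0 real) set" where
  "nabla_IIc = polytope_of_arrow_polys Q_IIc poly_IIc"

text \<open>Vertices: \<open>p = 0\<close>, \<open>q = 1\<close>, and $s_i = i + 1$ for $i = 1, \dots, 4$.\<close>

definition Q_Ib :: "(nat, nat) pre_digraph" where
  "Q_Ib = \<lparr>verts = {0, 1, 2, 3, 4, 5}, arcs = {..<8},
           tail = (\<lambda>a. [0, 0, 0, 0, 1, 1, 1, 1] ! a),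
           head = (\<lambda>a. [2, 3, 4, 5, 2, 3, 4, 5] ! a)\<rparr>"

definition \<theta>_Ib :: "nat \<Rightarrow> int" where
  "\<theta>_Ib v = [-2, -2, 1, 1, 1, 1] ! v"

definition poly_Ib :: "nat \<Rightarrow> real \<Rightarrow> real \<Rightarrow> real \<Rightarrow> real" where
  "poly_Ib a x y z =
     [x, y, 1 - z, 1 - x - y + z, 1 - x, 1 - y, z, x + y - z] ! a"

definition nabla_Ib :: "(nat \<Rightarrow>\<^sub>0 real) set" where
  "nabla_Ib = polytope_of_arrow_polys Q_Ib poly_Ib"

definition prime_compressed_flow_3polytope :: "('i \<Rightarrow>\<^sub>0 real) set \<Rightarrow> bool" where
  "prime_compressed_flow_3polytope P \<longleftrightarrow>
     flow_polytope P \<and> prime_polytope P \<and> compressed P \<and> polytope_dim P = 3"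

end

theory Submission
  imports Defs
begin

text \<open>
  The classification rests on the facets of a compressed three-dimensional lattice polytope \<open>P\<close>: they
  allow one to place \<open>P\<close> into the unit cube.

  Let \<open>F\<close> be a facet of \<open>P\<close>. Being compressed gives an affine functional that vanishes on \<open>F\<close>, has
  values in $[0,1]$ on \<open>P\<close> and is integral on all lattice points of the affine span
  (\<open>facet_width_functional\<close>). Take a facet \<open>F\<^sub>1\<close>, an edge of
  \<open>F\<^sub>1\<close> and an end point of this edge, a second facet \<open>F\<^sub>2\<close> through the edge, and a third facet \<open>F\<^sub>3\<close> through the
  end point that does not contain the edge. On four suitable vertices of \<open>P\<close> the functionals of the
  three facets form a triangular matrix with ones on the diagonal. So together they identify the lattice
  of the affine span with $\mathbb{Z}^3$, and they map \<open>P\<close> into the unit cube. Hence, in these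
  coordinates, \<open>P\<close> is the convex hull of a set \<open>S\<close> of vertices of the cube (\<open>compressed_unit_cube_chart\<close>).

  Only one kind of facet of such a convex hull can have width greater than \<open>1\<close>: the triangle spanned by
  the three neighbours of a cube vertex outside \<open>S\<close>, which has width \<open>2\<close> if \<open>S\<close> contains the antipode of
  that vertex (\<open>no_truncated_corner\<close>). If \<open>S\<close> contains no rectangle, that is, neither the vertices of a
  face of the cube nor those of a diagonal section through two opposite edges, then this condition
  forces \<open>S\<close> to consist of the vertices of a unimodular simplex. If \<open>S\<close> contains a rectangle, a symmetry of the cube moves it to one of two positions, and the
  remaining vertices give a square pyramid, an octahedron, a triangular prism or the cube. The last two
  are products, hence not prime.

  Conversely, each of the three polytopes is given by inequalities whose normal vectors have coefficients
  in $\{-1,0,1\}$ and whose functionals are at most \<open>1\<close> on the polytope; this yields compressedness, and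
  the values of the functionals on the arrows yield the isomorphism with the quiver polytope. A product
  of lower-dimensional polytopes that has dimension \<open>3\<close> contains at least six lattice points, and if
  it contains exactly six, they form a segment times a triangle, which is not centrally symmetric. So
  the simplex, the pyramid and the (centrally symmetric) octahedron are prime. Their numbers of
  lattice points are \<open>4\<close>, \<open>5\<close> and \<open>6\<close>, so they are pairwise inequivalent.
\<close>

section \<open>Affine embeddings and lattice charts\<close>

type_synonym real3 = "real \<times> real \<times> real"

text \<open>
  The ambient spaces of the polytopes have infinite dimension in general, whereas the theory of facets and polytopes
  applies to Euclidean spaces. Every polytope is therefore studied through a parametrization of its
  affine span by a Euclidean space.
\<close>

definition affine_embedding :: "('e::euclidean_space \<Rightarrow> 'b::real_normed_vector) \<Rightarrow> bool" where
  "affine_embedding g \<longleftrightarrow> (\<exists>p h. linear h \<and> inj h \<and> g = (\<lambda>v. p + h v))"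

lemma affine_embeddingE:
  assumes "affine_embedding g"
  obtains p h where "linear h" "inj h" "\<And>v. g v = p + h v" "g = (+) p \<circ> h"
  using assms unfolding affine_embedding_def by (metis comp_def ext)

lemma affine_embedding_inj: "affine_embedding g \<Longrightarrow> inj g"
  unfolding affine_embedding_def inj_def by auto

lemma affine_embedding_comb:
  assumes "affine_embedding g" "s + t = 1"
  shows "g (s *\<^sub>R v + t *\<^sub>R w) = s *\<^sub>R g v + t *\<^sub>R g w"
proof -
  obtain p h where h: "linear h" "\<And>v. g v = p + h v"
    by (rule affine_embeddingE[OF assms(1)]) blast
  have "p = s *\<^sub>R p + t *\<^sub>R p"
    using assms(2) by (metis scaleR_add_left scaleR_one)
  then show ?thesis
    by (simp add: h linear_add linear_scale scaleR_add_right)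
qed

lemma affine_embedding_image_convex_hull:
  assumes "affine_embedding g"
  shows "g ` (convex hull S) = convex hull (g ` S)"
proof -
  obtain p h where h: "linear h" and g: "g = (+) p \<circ> h"
    by (rule affine_embeddingE[OF assms]) blast
  show ?thesis
    unfolding g image_comp[symmetric] convex_hull_linear_image[OF h] convex_hull_translation ..
qed

lemma affine_embedding_image_affine_hull:
  assumes "affine_embedding g"
  shows "g ` (affine hull S) = affine hull (g ` S)"
proof -
  obtain p h where h: "linear h" and g: "g = (+) p \<circ> h"
    by (rule affine_embeddingE[OF assms]) blast
  have "bounded_linear h" using h by (simp add: linear_conv_bounded_linear)
  from affine_hull_linear_image[OF this] show ?thesis
    unfolding g image_comp[symmetric] affine_hull_translation by simp
qed

lemma affine_embedding_face_of:
  assumes "affine_embedding g"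
  shows "g ` T face_of g ` S \<longleftrightarrow> T face_of S"
proof -
  obtain p h where h: "linear h" "inj h" and g: "g = (+) p \<circ> h"
    by (rule affine_embeddingE[OF assms]) blast
  show ?thesis
    unfolding g image_comp[symmetric] face_of_translation_eq face_of_linear_image[OF h] ..
qed

lemma affine_embedding_comp:
  assumes "affine_embedding g" "affine_embedding u"
  shows "affine_embedding (g \<circ> u)"
proof -
  obtain p h where h: "linear h" "inj h" "\<And>v. g v = p + h v"
    by (rule affine_embeddingE[OF assms(1)]) blast
  obtain q k where k: "linear k" "inj k" "\<And>v. u v = q + k v"
    by (rule affine_embeddingE[OF assms(2)]) blast
  have "g \<circ> u = (\<lambda>v. (p + h q) + (h \<circ> k) v)"
    by (auto simp: h k linear_add)
  then show ?thesis
    unfolding affine_embedding_def using h k linear_compose inj_compose by blast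
qed

lemma dim_injective_linear_image:
  fixes h :: "'e::euclidean_space \<Rightarrow> 'b::real_normed_vector"
  assumes "linear h" "inj h"
  shows "dim (h ` V) = dim V"
proof -
  obtain B where B: "B \<subseteq> V" "independent B" "V \<subseteq> span B" "card B = dim V"
    using basis_exists by blast
  have ind: "independent (h ` B)"
    using linear_independent_injective_image[OF assms(1) B(2)] assms(2)
    by (simp add: inj_on_subset)
  have "span (h ` V) = span (h ` B)"
    unfolding linear_span_image[OF assms(1)]
    using B(1,3) span_mono span_minimal subspace_span by (metis subset_antisym)
  then have "dim (h ` V) = card (h ` B)"
    using ind by (rule dim_eq_card[OF sym])
  also have "\<dots> = card B"
    using assms(2) by (simp add: card_image inj_on_subset)
  finally show ?thesis using B by simp
qed

lemma dim_differences:
  assumes "p \<in> P"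
  shows "dim {x - y | x y. x \<in> P \<and> y \<in> P} = dim ((\<lambda>x. x - p) ` P)"
proof -
  have "span {x - y | x y. x \<in> P \<and> y \<in> P} = span ((\<lambda>x. x - p) ` P)" (is "span ?D = span ?E")
  proof (rule span_eq[THEN iffD2], intro conjI subsetI)
    fix d assume "d \<in> ?D"
    then obtain x y where xy: "x \<in> P" "y \<in> P" "d = (x - p) - (y - p)" by auto
    show "d \<in> span ?E"
      unfolding xy(3) by (intro span_diff span_base) (use xy in auto)
  next
    fix d assume "d \<in> ?E"
    then show "d \<in> span ?D" using assms by (intro span_base) auto
  qed
  then have "dim (span {x - y | x y. x \<in> P \<and> y \<in> P}) = dim (span ((\<lambda>x. x - p) ` P))"
    by (rule arg_cong)
  then show ?thesis unfolding dim_span .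
qed

lemma polytope_dim_image:
  fixes g :: "'e::euclidean_space \<Rightarrow> ('i \<Rightarrow>\<^sub>0 real)"
  assumes "affine_embedding g"
  shows "polytope_dim (g ` C) = aff_dim C"
proof (cases "C = {}")
  case True
  then show ?thesis by (simp add: polytope_dim_def)
next
  case False
  then obtain c where c: "c \<in> C" by blast
  obtain p h where h: "linear h" "inj h" "\<And>v. g v = p + h v"
    by (rule affine_embeddingE[OF assms]) blast
  have "polytope_dim (g ` C) = int (dim ((\<lambda>x. x - g c) ` g ` C))"
    using False dim_differences[of "g c" "g ` C"] c unfolding polytope_dim_def by (simp only: image_is_empty imageI if_False)
  also have "(\<lambda>x. x - g c) ` g ` C = h ` ((\<lambda>x. x - c) ` C)"
    by (simp add: image_image h linear_diff[OF h(1)])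
  also have "dim \<dots> = dim ((\<lambda>x. x - c) ` C)"
    by (rule dim_injective_linear_image[OF h(1,2)])
  also have "int \<dots> = aff_dim C"
    by (rule aff_dim_eq_dim_subtract[OF hull_inc[OF c], symmetric])
  finally show ?thesis .
qed

text \<open>
  The parametrization uses an arbitrary basis of the directions of \<open>P\<close>; it need not respect the lattice.
\<close>

lemma obtain_affine_chart:
  fixes P :: "('i \<Rightarrow>\<^sub>0 real) set"
  assumes "polytope_dim P = 3"
  obtains g :: "real3 \<Rightarrow> ('i \<Rightarrow>\<^sub>0 real)" where "affine_embedding g" "affine hull P = range g"
proof -
  have ne: "P \<noteq> {}"
    using assms unfolding polytope_dim_def by auto
  have d: "dim {x - y | x y. x \<in> P \<and> y \<in> P} = 3"
    using assms unfolding polytope_dim_def if_not_P[OF ne] of_nat_eq_numeral_iff .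
  obtain p where p: "p \<in> P" using ne by blast
  obtain B where B: "B \<subseteq> (\<lambda>x. x - p) ` P" "independent B" "(\<lambda>x. x - p) ` P \<subseteq> span B" "card B = 3"
    using basis_exists[of "(\<lambda>x. x - p) ` P"] d dim_differences[OF p] by metis
  then obtain b c e where bce: "B = {b, c, e}" "b \<noteq> c" "b \<noteq> e" "c \<noteq> e"
    by (metis card_3_iff)
  define h :: "real3 \<Rightarrow> ('i \<Rightarrow>\<^sub>0 real)" where "h = (\<lambda>(x, y, z). x *\<^sub>R b + y *\<^sub>R c + z *\<^sub>R e)"
  have lin: "linear h"
    by (rule linearI) (auto simp: h_def algebra_simps)
  have "v = 0" if "h v = 0" for v
  proof -
    obtain x y z where v: "v = (x, y, z)" by (cases v)
    define u where "u w = (if w = b then x else if w = c then y else z)" for w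
    have "(\<Sum>w\<in>B. u w *\<^sub>R w) = 0"
      using that bce(2-4) by (simp add: v h_def u_def add.assoc bce(1))
    then have "\<forall>w\<in>B. u w = 0"
      using B(2) bce(1) by (metis independentD finite.emptyI finite.insertI order_refl)
    then have "u b = 0" "u c = 0" "u e = 0" by (simp_all add: bce(1))
    then show ?thesis using bce(2-4) by (simp add: u_def v zero_prod_def split: if_splits)
  qed
  then have "inj h" using lin linear_injective_0 by blast
  have "range h = span B"
  proof (intro subset_antisym subsetI)
    fix w assume "w \<in> range h"
    then obtain x y z where "w = x *\<^sub>R b + y *\<^sub>R c + z *\<^sub>R e" by (auto simp: h_def)
    moreover have "b \<in> span B" "c \<in> span B" "e \<in> span B"
      by (simp_all add: bce(1) span_base)
    ultimately show "w \<in> span B"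
      by (simp add: span_add span_scale)
  next
    fix w assume "w \<in> span B"
    then obtain x y z where "w - x *\<^sub>R b - y *\<^sub>R c - z *\<^sub>R e = 0"
      unfolding bce(1) span_insert span_empty by blast
    then have "w = h (x, y, z)"
      by (simp add: h_def algebra_simps)
    then show "w \<in> range h" by blast
  qed
  moreover have "affine hull P = (+) p ` span B"
  proof -
    have "span ((\<lambda>x. x - p) ` P) = span B"
      using B by (meson span_eq span_superset order_trans)
    moreover have "affine hull P = (+) p ` span ((\<lambda>x. x - p) ` (P - {p}))"
      using affine_hull_span2[OF p] by simp
    moreover have "span ((\<lambda>x. x - p) ` (P - {p})) = span (insert 0 ((\<lambda>x. x - p) ` (P - {p})))"
      by (simp add: span_insert_0)
    moreover have "insert 0 ((\<lambda>x. x - p) ` (P - {p})) = (\<lambda>x. x - p) ` P"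
      using p by auto
    ultimately show ?thesis by simp
  qed
  ultimately have "affine hull P = range (\<lambda>v. p + h v)" by (metis image_image)
  then show ?thesis
    using that[of "\<lambda>v. p + h v"] lin \<open>inj h\<close> unfolding affine_embedding_def by blast
qed

definition int3 :: "real3 set" where "int3 = \<int> \<times> \<int> \<times> \<int>"

lemma int3_iff [simp]: "(x, y, z) \<in> int3 \<longleftrightarrow> x \<in> \<int> \<and> y \<in> \<int> \<and> z \<in> \<int>"
  by (simp add: int3_def)

text \<open>
  Such a chart is the choice of a lattice point and a lattice basis in the affine span of a
  three-dimensional polytope.
\<close>

definition lattice_chart :: "(real3 \<Rightarrow> ('i \<Rightarrow>\<^sub>0 real)) \<Rightarrow> bool" where
  "lattice_chart g \<longleftrightarrow> affine_embedding g \<and> (\<forall>v. g v \<in> int_points \<longleftrightarrow> v \<in> int3)"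

lemma lattice_chartD:
  assumes "lattice_chart g"
  shows "affine_embedding g" "inj g" "g v \<in> int_points \<longleftrightarrow> v \<in> int3"
  using assms affine_embedding_inj unfolding lattice_chart_def by blast+

lemma affine_hull_chart_image:
  assumes "affine_embedding g" "affine hull C = UNIV"
  shows "affine hull (g ` C) = range g"
  using affine_embedding_image_affine_hull[OF assms(1), of C] assms(2) by simp

text \<open>
  The isomorphism is the change of charts; explicit equivalences between polytopes are constructed in this
  way below.
\<close>

lemma lattice_chart_equiv:
  assumes g: "lattice_chart g" and k: "lattice_chart k" and C: "affine hull C = UNIV"
  shows "g ` C \<cong>\<^sub>p k ` C"
proof -
  note gD = lattice_chartD[OF g] and kD = lattice_chartD[OF k]
  define f where "f = k \<circ> inv g"
  have f: "f (g v) = k v" for v using gD(2) by (simp add: f_def)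
  have ag: "affine hull (g ` C) = range g" and ak: "affine hull (k ` C) = range k"
    using affine_hull_chart_image gD(1) kD(1) C by blast+
  have "affine_map_on (range g) f"
    unfolding affine_map_on_def
    by (auto simp flip: affine_embedding_comb[OF gD(1)] affine_embedding_comb[OF kD(1)] simp: f)
  moreover have "bij_betw f (range g) (range k)"
    unfolding bij_betw_def inj_on_def using kD(2) by (auto simp: f inj_eq image_image)
  moreover have "f ` (range g \<inter> int_points) = range k \<inter> int_points"
  proof -
    have "range g \<inter> int_points = g ` int3" "range k \<inter> int_points = k ` int3"
      using gD(3) kD(3) by auto
    then show ?thesis by (simp add: image_image f)
  qed
  moreover have "f ` g ` C = k ` C" by (simp add: image_image f)
  ultimately show ?thesis unfolding polytope_equiv_def ag ak by blast
qed

definition unimodular :: "(real3 \<Rightarrow> real3) \<Rightarrow> bool" where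
  "unimodular u \<longleftrightarrow> affine_embedding u \<and> (\<forall>v. u v \<in> int3 \<longleftrightarrow> v \<in> int3)"

lemma lattice_chart_comp:
  "lattice_chart g \<Longrightarrow> unimodular u \<Longrightarrow> lattice_chart (g \<circ> u)"
  unfolding lattice_chart_def unimodular_def using affine_embedding_comp
  by (metis comp_apply)

lemma lattice_polytope_chart_image:
  fixes g :: "'e::euclidean_space \<Rightarrow> ('i \<Rightarrow>\<^sub>0 real)"
  assumes "affine_embedding g" "finite S" "g ` S \<subseteq> int_points"
  shows "lattice_polytope (g ` (convex hull S))"
  unfolding lattice_polytope_def affine_embedding_image_convex_hull[OF assms(1)]
  using assms by blast

lemma lookup_scaleR [simp]:
  fixes x :: "'i \<Rightarrow>\<^sub>0 real"
  shows "Poly_Mapping.lookup (r *\<^sub>R x) i = r * Poly_Mapping.lookup x i"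
proof -
  have "finite {i. r * Poly_Mapping.lookup x i \<noteq> 0}"
    by (rule finite_subset[OF _ finite_lookup[of x]]) auto
  then show ?thesis
    unfolding scaleR_poly_mapping_def by (simp add: Abs_poly_mapping_inverse)
qed

lemma int_points_add: "x \<in> int_points \<Longrightarrow> y \<in> int_points \<Longrightarrow> x + y \<in> int_points"
  by (simp add: int_points_def lookup_add)

lemma int_points_diff: "x \<in> int_points \<Longrightarrow> y \<in> int_points \<Longrightarrow> x - y \<in> int_points"
  by (simp add: int_points_def lookup_minus)

lemma int_points_scale: "x \<in> int_points \<Longrightarrow> r \<in> \<int> \<Longrightarrow> r *\<^sub>R x \<in> int_points"
  by (simp add: int_points_def)

lemma int_points_translate:
  assumes "d \<in> int_points"
  shows "(+) d ` A \<inter> int_points = (+) d ` (A \<inter> int_points)"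
  using int_points_add[OF assms] int_points_diff[OF _ assms] by force

definition pt3_chart :: "real3 \<Rightarrow> (nat \<Rightarrow>\<^sub>0 real)" where
  "pt3_chart = (\<lambda>(x, y, z). pt3 x y z)"

definition vertices_Ia :: "real3 set" where
  "vertices_Ia = {(0, 0, 0), (1, 0, 0), (0, 1, 0), (0, 0, 1)}"

definition vertices_IIc :: "real3 set" where
  "vertices_IIc = {(0, 0, 0), (0, 0, 1), (1, 0, 0), (1, 0, 1), (0, 1, 0)}"

definition vertices_Ib :: "real3 set" where
  "vertices_Ib = {(0, 0, 0), (1, 0, 0), (1, 0, 1), (0, 1, 0), (0, 1, 1), (1, 1, 1)}"

lemma lookup_pt3:
  "Poly_Mapping.lookup (pt3 x y z) i = (if i = 0 then x else if i = 1 then y else if i = 2 then z else 0)"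
  by (simp add: pt3_def nth_default_def nth.rep_eq nth_Cons split: nat.splits)

lemma affine_embeddingI:
  assumes "linear h" "inj h" "\<And>v. g v = p + h v"
  shows "affine_embedding g"
proof -
  have "g = (\<lambda>v. p + h v)" using assms(3) by (rule ext)
  then show ?thesis using assms(1,2) unfolding affine_embedding_def by blast
qed

lemma lattice_chart_pt3: "lattice_chart pt3_chart"
proof -
  have "linear pt3_chart"
    by (rule linearI; rule poly_mapping_eqI)
      (simp_all add: pt3_chart_def case_prod_unfold lookup_pt3 lookup_add)
  moreover have "inj pt3_chart"
  proof (rule injI)
    fix v w assume "pt3_chart v = pt3_chart w"
    then have "Poly_Mapping.lookup (pt3_chart v) i = Poly_Mapping.lookup (pt3_chart w) i" for i by simp
    from this[of 0] this[of 1] this[of 2] show "v = w"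
      by (cases v; cases w) (simp add: pt3_chart_def lookup_pt3)
  qed
  ultimately have "affine_embedding pt3_chart" by (rule affine_embeddingI[where p = 0]) simp
  moreover have "pt3_chart v \<in> int_points \<longleftrightarrow> v \<in> int3" for v
  proof (cases v)
    case (fields x y z)
    have "(\<forall>i. Poly_Mapping.lookup (pt3 x y z) i \<in> \<int>) \<longleftrightarrow> x \<in> \<int> \<and> y \<in> \<int> \<and> z \<in> \<int>" (is "?L \<longleftrightarrow> ?R")
    proof
      assume ?L
      from spec[OF this, of 0] spec[OF this, of 1] spec[OF this, of 2] show ?R
        by (simp add: lookup_pt3)
    qed (simp add: lookup_pt3)
    then show ?thesis by (simp add: fields pt3_chart_def int_points_def)
  qed
  ultimately show ?thesis unfolding lattice_chart_def by blast
qed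

text \<open>
  The affine part is checked through the linear map that remains after subtracting the value at the origin;
  injectivity follows from the left inverse \<open>w\<close>.
\<close>

lemma unimodularI:
  assumes "linear (\<lambda>v. u v - u 0)" "\<And>v. w (u v) = v"
    and "\<And>v. v \<in> int3 \<Longrightarrow> u v \<in> int3" "\<And>v. v \<in> int3 \<Longrightarrow> w v \<in> int3"
  shows "unimodular u"
proof -
  have "inj (\<lambda>v. u v - u 0)"
    by (rule injI) (metis assms(2) diff_add_cancel)
  then have "affine_embedding u"
    by (rule affine_embeddingI[OF assms(1), where p = "u 0"]) simp
  then show ?thesis unfolding unimodular_def using assms(2-4) by metis
qed

lemma unimodular_surj:
  assumes "unimodular u" shows "surj u"
proof -
  obtain p h where h: "linear h" "inj h" "\<And>v. u v = p + h v"
    using assms unfolding unimodular_def by (meson affine_embeddingE)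
  have "surj h" using h(1,2) by (rule linear_inj_imp_surj)
  then show ?thesis unfolding surj_def h(3) by (metis surjD add.commute diff_add_cancel)
qed

section \<open>Invariants of lattice equivalence\<close>

lemma polytope_equiv_bij_int_points:
  assumes "P \<cong>\<^sub>p P'"
  obtains f where "affine_map_on (affine hull P) f" "bij_betw f (affine hull P) (affine hull P')"
    "f ` P = P'" "bij_betw f (P \<inter> int_points) (P' \<inter> int_points)"
proof -
  obtain f where f: "affine_map_on (affine hull P) f" "bij_betw f (affine hull P) (affine hull P')"
    "f ` (affine hull P \<inter> int_points) = affine hull P' \<inter> int_points" "f ` P = P'"
    using assms unfolding polytope_equiv_def by blast
  have sub: "P \<subseteq> affine hull P" "P' \<subseteq> affine hull P'" by (simp_all add: hull_subset)
  have inj: "inj_on f (affine hull P)" using f(2) by (simp add: bij_betw_def)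
  have "f ` (P \<inter> int_points) = f ` (P \<inter> (affine hull P \<inter> int_points))"
    using sub(1) by (metis Int_absorb2 Int_assoc)
  also have "\<dots> = f ` P \<inter> f ` (affine hull P \<inter> int_points)"
    by (rule inj_on_image_Int[OF inj sub(1)]) blast
  also have "\<dots> = P' \<inter> int_points" unfolding f(3,4) using sub(2) by blast
  finally have "bij_betw f (P \<inter> int_points) (P' \<inter> int_points)"
    using inj sub(1) unfolding bij_betw_def by (meson inj_on_subset inf_le1 order_trans)
  then show ?thesis using that f by blast
qed

lemma polytope_equiv_card_int_points:
  assumes "P \<cong>\<^sub>p P'"
  shows "card (P \<inter> int_points) = card (P' \<inter> int_points)"
proof -
  obtain f where "bij_betw f (P \<inter> int_points) (P' \<inter> int_points)"
    using assms polytope_equiv_bij_int_points by blast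
  then show ?thesis by (rule bij_betw_same_card)
qed

text \<open>
  The map is only given on the affine hull of \<open>P\<close>. A linear map is built from its values on a basis of the
  directions of \<open>P\<close>; the directions on which both agree form a subspace.
\<close>

lemma affine_map_on_linear:
  fixes f :: "('i \<Rightarrow>\<^sub>0 real) \<Rightarrow> ('j \<Rightarrow>\<^sub>0 real)"
  assumes f: "affine_map_on (affine hull P) f" and p: "p \<in> P"
  obtains h where "linear h" "\<And>x. x \<in> P \<Longrightarrow> f x - f p = h (x - p)"
proof -
  let ?D = "(\<lambda>x. x - p) ` P"
  obtain B where B: "B \<subseteq> ?D" "independent B" "?D \<subseteq> span B"
    using maximal_independent_subset by metis
  define G where "G d = f (p + d) - f p" for d
  obtain h where h: "linear h" "\<forall>d\<in>B. h d = G d"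
    using linear_independent_extend[OF B(2)] by blast
  have aff: "affine (affine hull P)" by simp
  have pA: "p \<in> affine hull P" using p by (rule hull_inc)
  have comb: "f (s *\<^sub>R x + t *\<^sub>R y) = s *\<^sub>R f x + t *\<^sub>R f y"
    if "x \<in> affine hull P" "y \<in> affine hull P" "s + t = 1" for x y s t
    using f that unfolding affine_map_on_def by blast
  have memA: "s *\<^sub>R x + t *\<^sub>R y \<in> affine hull P"
    if "x \<in> affine hull P" "y \<in> affine hull P" "s + t = 1" for x y s t
    using aff that unfolding affine_def by blast
  let ?W = "{d. p + d \<in> affine hull P \<and> G d = h d}"
  have "subspace ?W"
  proof (rule subspaceI)
    show "0 \<in> ?W" using pA h(1) by (simp add: G_def linear_0)
    have scale: "c *\<^sub>R d \<in> ?W" if "d \<in> ?W" for c d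
    proof -
      have eq: "p + c *\<^sub>R d = (1 - c) *\<^sub>R p + c *\<^sub>R (p + d)" by (simp add: algebra_simps)
      have m: "p + c *\<^sub>R d \<in> affine hull P" unfolding eq using memA pA that by simp
      have "f (p + c *\<^sub>R d) = (1 - c) *\<^sub>R f p + c *\<^sub>R f (p + d)"
        unfolding eq using comb pA that by simp
      then have "G (c *\<^sub>R d) = c *\<^sub>R G d" by (simp add: G_def algebra_simps)
      then show ?thesis using m that by (simp add: linear_scale[OF h(1)])
    qed
    show "c *\<^sub>R d \<in> ?W" if "d \<in> ?W" for c d using scale that .
    show "d + e \<in> ?W" if "d \<in> ?W" "e \<in> ?W" for d e
    proof -
      have 2: "2 *\<^sub>R d \<in> ?W" "2 *\<^sub>R e \<in> ?W" using scale that by blast+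
      have eq: "p + (d + e) = (1/2) *\<^sub>R (p + 2 *\<^sub>R d) + (1/2) *\<^sub>R (p + 2 *\<^sub>R e)"
        by (simp add: scaleR_add_right flip: scaleR_left.add)
      have m: "p + (d + e) \<in> affine hull P" unfolding eq using memA 2 by simp
      have "f (p + (d + e)) = (1/2) *\<^sub>R f (p + 2 *\<^sub>R d) + (1/2) *\<^sub>R f (p + 2 *\<^sub>R e)"
        unfolding eq using comb 2 by simp
      then have "G (d + e) = (1/2) *\<^sub>R G (2 *\<^sub>R d) + (1/2) *\<^sub>R G (2 *\<^sub>R e)"
        by (simp add: G_def algebra_simps flip: scaleR_left.add)
      also have "\<dots> = h (d + e)"
        using 2 by (simp add: linear_scale[OF h(1)] linear_add[OF h(1)])
      finally show ?thesis using m by simp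
    qed
  qed
  moreover have "B \<subseteq> ?W"
  proof
    fix d assume "d \<in> B"
    moreover then have "p + d \<in> P" using B(1) by auto
    ultimately show "d \<in> ?W" using h(2) by (simp add: hull_inc)
  qed
  ultimately have "span B \<subseteq> ?W" by (rule span_minimal[rotated])
  then have "G (x - p) = h (x - p)" if "x \<in> P" for x using B(3) that by blast
  then show ?thesis using that[OF h(1)] by (simp add: G_def)
qed

lemma dim_linear_image_le:
  fixes h :: "'a::real_vector \<Rightarrow> 'b::real_vector"
  assumes "linear h" "finite B" "V \<subseteq> span B"
  shows "dim (h ` V) \<le> dim V"
proof -
  obtain C where C: "C \<subseteq> V" "independent C" "V \<subseteq> span C" "card C = dim V"
    using basis_exists by blast
  have "finite C" using independent_span_bound[OF assms(2) C(2)] C(1) assms(3) by blast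
  have "h ` V \<subseteq> span (h ` C)"
    using C(3) linear_span_image[OF assms(1), of C] by blast
  then have "dim (h ` V) \<le> card (h ` C)"
    using \<open>finite C\<close> by (intro dim_le_card) auto
  also have "\<dots> \<le> card C" using \<open>finite C\<close> by (rule card_image_le)
  finally show ?thesis using C(4) by simp
qed

lemma convex_hull_differences_span:
  assumes "p \<in> S"
  shows "(\<lambda>x. x - p) ` (convex hull S) \<subseteq> span ((\<lambda>x. x - p) ` (S - {p}))"
proof -
  have "affine hull S = (\<lambda>x. p + x) ` span ((\<lambda>x. - p + x) ` (S - {p}))"
    using affine_hull_span2[OF assms] .
  then show ?thesis
    using convex_hull_subset_affine_hull[of S] by (auto simp: subset_iff)
qed

text \<open>
  Differences to one of the points of \<open>S\<close> span all directions of \<open>P\<close>.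
\<close>

lemma polytope_dim_le_card:
  assumes "finite S" "P = convex hull S"
  shows "polytope_dim P \<le> int (card S) - 1"
proof (cases "S = {}")
  case True
  then show ?thesis using assms by (simp add: polytope_dim_def)
next
  case False
  then obtain p where p: "p \<in> S" by blast
  then have pP: "p \<in> P" using assms(2) by (simp add: hull_inc)
  have "dim ((\<lambda>x. x - p) ` P) \<le> card ((\<lambda>x. x - p) ` (S - {p}))"
    using convex_hull_differences_span[OF p] assms by (intro dim_le_card) auto
  also have "\<dots> \<le> card (S - {p})" using assms(1) by (intro card_image_le) simp
  also have "\<dots> = card S - 1" using p assms(1) by simp
  finally have le: "dim ((\<lambda>x. x - p) ` P) \<le> card S - 1" .
  have "card S > 0" using False assms(1) by (simp add: card_gt_0_iff)
  moreover have "polytope_dim P = int (dim ((\<lambda>x. x - p) ` P))"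
    using pP dim_differences[OF pP] unfolding polytope_dim_def by (metis empty_iff)
  ultimately show ?thesis using le by linarith
qed

lemma polytope_dim_eq_dim:
  assumes "p \<in> P"
  shows "polytope_dim P = int (dim ((\<lambda>x. x - p) ` P))"
  using assms dim_differences[OF assms] unfolding polytope_dim_def by (metis empty_iff)

lemma polytope_equiv_sym:
  assumes "P \<cong>\<^sub>p P'"
  shows "P' \<cong>\<^sub>p P"
proof -
  obtain f where f: "affine_map_on (affine hull P) f" "bij_betw f (affine hull P) (affine hull P')"
    "f ` (affine hull P \<inter> int_points) = affine hull P' \<inter> int_points" "f ` P = P'"
    using assms unfolding polytope_equiv_def by blast
  define k where "k = the_inv_into (affine hull P) f"
  have inj: "inj_on f (affine hull P)" and im: "f ` (affine hull P) = affine hull P'"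
    using f(2) by (simp_all add: bij_betw_def)
  have kf: "k (f x) = x" if "x \<in> affine hull P" for x
    using the_inv_into_f_f[OF inj that] by (simp add: k_def)
  have kimage: "k ` f ` X = X" if "X \<subseteq> affine hull P" for X
    using kf that by (force simp: image_image)
  have "affine_map_on (affine hull P') k"
    unfolding affine_map_on_def im[symmetric]
  proof (intro ballI allI impI, elim imageE)
    fix y y' s t x x' assume st: "s + t = (1::real)" and x: "x \<in> affine hull P" "x' \<in> affine hull P"
      and y: "y = f x" "y' = f x'"
    have "s *\<^sub>R x + t *\<^sub>R x' \<in> affine hull P"
      using x st affine_affine_hull[of P] unfolding affine_def by blast
    moreover have "f (s *\<^sub>R x + t *\<^sub>R x') = s *\<^sub>R y + t *\<^sub>R y'"
      using f(1) x st y unfolding affine_map_on_def by blast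
    ultimately show "k (s *\<^sub>R y + t *\<^sub>R y') = s *\<^sub>R k y + t *\<^sub>R k y'"
      using kf x y by metis
  qed
  moreover have "bij_betw k (affine hull P') (affine hull P)"
    unfolding k_def by (rule bij_betw_the_inv_into[OF f(2)])
  moreover have "k ` (affine hull P' \<inter> int_points) = affine hull P \<inter> int_points"
    unfolding f(3)[symmetric] by (rule kimage) blast
  moreover have "k ` P' = P"
    unfolding f(4)[symmetric] by (rule kimage[OF hull_subset])
  ultimately show ?thesis unfolding polytope_equiv_def by blast
qed

text \<open>
  A linear map does not raise a finite dimension; the set \<open>B\<close> certifies that the dimension of \<open>P\<close> is
  finite, as an infinite one would count as \<open>0\<close>.
\<close>

lemma polytope_equiv_dim_le:
  assumes eq: "P \<cong>\<^sub>p P'" and p: "p \<in> P" and fin: "finite B" "(\<lambda>x. x - p) ` P \<subseteq> span B"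
  shows "polytope_dim P' \<le> polytope_dim P"
proof -
  obtain f where f: "affine_map_on (affine hull P) f" "f ` P = P'"
    using polytope_equiv_bij_int_points[OF eq] by blast
  obtain h where h: "linear h" "\<And>x. x \<in> P \<Longrightarrow> f x - f p = h (x - p)"
    using affine_map_on_linear[OF f(1) p] by blast
  have "(\<lambda>x. x - f p) ` P' = h ` ((\<lambda>x. x - p) ` P)"
    unfolding f(2)[symmetric] image_image using h(2) by (rule image_cong[OF refl])
  moreover have fp: "f p \<in> P'" using p f(2) by blast
  ultimately show ?thesis
    using dim_linear_image_le[OF h(1) fin]
    unfolding polytope_dim_eq_dim[OF p] polytope_dim_eq_dim[OF fp] by simp
qed

section \<open>Products of lattice polytopes\<close>

lift_definition pm_pair :: "('i \<Rightarrow>\<^sub>0 real) \<Rightarrow> ('j \<Rightarrow>\<^sub>0 real) \<Rightarrow> ('i + 'j \<Rightarrow>\<^sub>0 real)"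
  is "\<lambda>x y. case_sum x y"
proof -
  fix x :: "'i \<Rightarrow> real" and y :: "'j \<Rightarrow> real"
  assume fin: "finite {i. x i \<noteq> 0}" "finite {j. y j \<noteq> 0}"
  have "{k. case_sum x y k \<noteq> 0} \<subseteq> Inl ` {i. x i \<noteq> 0} \<union> Inr ` {j. y j \<noteq> 0}"
  proof
    fix k assume "k \<in> {k. case_sum x y k \<noteq> 0}"
    then show "k \<in> Inl ` {i. x i \<noteq> 0} \<union> Inr ` {j. y j \<noteq> 0}" by (cases k) auto
  qed
  then show "finite {k. case_sum x y k \<noteq> 0}" by (rule finite_subset) (use fin in simp)
qed

lemma lookup_pm_pair [simp]:
  "Poly_Mapping.lookup (pm_pair x y) (Inl i) = Poly_Mapping.lookup x i"
  "Poly_Mapping.lookup (pm_pair x y) (Inr j) = Poly_Mapping.lookup y j"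
  by (simp_all add: pm_pair.rep_eq)

lemma pm_pair_eqI:
  fixes z w :: "'i + 'j \<Rightarrow>\<^sub>0 real"
  assumes "\<And>i. Poly_Mapping.lookup z (Inl i) = Poly_Mapping.lookup w (Inl i)"
    "\<And>j. Poly_Mapping.lookup z (Inr j) = Poly_Mapping.lookup w (Inr j)"
  shows "z = w"
  by (rule poly_mapping_eqI) (metis assms sum.exhaust)

lemma pm_pair_inject: "pm_pair x y = pm_pair x' y' \<longleftrightarrow> x = x' \<and> y = y'"
proof
  assume eq: "pm_pair x y = pm_pair x' y'"
  show "x = x' \<and> y = y'"
    by (intro conjI poly_mapping_eqI) (metis eq lookup_pm_pair(1), metis eq lookup_pm_pair(2))
qed simp

lemma pm_pair_add: "pm_pair x y + pm_pair x' y' = pm_pair (x + x') (y + y')"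
  by (rule pm_pair_eqI) (simp_all add: lookup_add)

lemma pm_pair_scale: "r *\<^sub>R pm_pair x y = pm_pair (r *\<^sub>R x) (r *\<^sub>R y)"
  by (rule pm_pair_eqI) simp_all

lemma linear_pm_pair_left: "linear (\<lambda>x. pm_pair x 0)"
  by (rule linearI) (simp_all add: pm_pair_add pm_pair_scale)

lemma linear_pm_pair_right: "linear (\<lambda>y. pm_pair 0 y)"
  by (rule linearI) (simp_all add: pm_pair_add pm_pair_scale)

lemma polytope_prod_eq: "polytope_prod P1 P2 = (\<lambda>(x, y). pm_pair x y) ` (P1 \<times> P2)"
proof (intro subset_antisym subsetI)
  fix z assume "z \<in> polytope_prod P1 P2"
  then obtain x y where xy: "x \<in> P1" "y \<in> P2" "\<forall>i. Poly_Mapping.lookup z (Inl i) = Poly_Mapping.lookup x i"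
    "\<forall>j. Poly_Mapping.lookup z (Inr j) = Poly_Mapping.lookup y j"
    unfolding polytope_prod_def by blast
  then have "z = pm_pair x y" by (intro pm_pair_eqI) simp_all
  then show "z \<in> (\<lambda>(x, y). pm_pair x y) ` (P1 \<times> P2)" using xy(1,2) by blast
next
  fix z assume "z \<in> (\<lambda>(x, y). pm_pair x y) ` (P1 \<times> P2)"
  then show "z \<in> polytope_prod P1 P2" unfolding polytope_prod_def by auto
qed

lemma pm_pair_int_points: "pm_pair x y \<in> int_points \<longleftrightarrow> x \<in> int_points \<and> y \<in> int_points"
proof
  assume "pm_pair x y \<in> int_points"
  then show "x \<in> int_points \<and> y \<in> int_points"
    unfolding int_points_def mem_Collect_eq by (metis lookup_pm_pair)
next
  assume "x \<in> int_points \<and> y \<in> int_points"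
  then show "pm_pair x y \<in> int_points"
    unfolding int_points_def mem_Collect_eq by (metis lookup_pm_pair sum.exhaust)
qed

lemma finite_spanning_differences:
  assumes "finite S" "P = convex hull S" "P \<noteq> {}"
  obtains p B where "p \<in> P" "finite B" "(\<lambda>x. x - p) ` P \<subseteq> span B" "polytope_dim P = int (card B)"
proof -
  obtain p where p: "p \<in> S" using assms by (metis convex_hull_empty ex_in_conv)
  have pP: "p \<in> P" using p assms(2) by (simp add: hull_inc)
  let ?D = "(\<lambda>x. x - p) ` P"
  obtain B where B: "B \<subseteq> ?D" "independent B" "?D \<subseteq> span B" "card B = dim ?D"
    using basis_exists by blast
  have "B \<subseteq> span ((\<lambda>x. x - p) ` (S - {p}))"
    using B(1) convex_hull_differences_span[OF p] assms(2) by blast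
  then have "finite B"
    using independent_span_bound[OF finite_imageI[OF finite_Diff[OF assms(1)]] B(2)] by blast
  then show ?thesis using that[of p B] pP B polytope_dim_eq_dim[OF pP] by simp
qed

text \<open>
  The dimension of a product is at most the sum of the dimensions: bases of the directions of the factors
  span the directions of the product. The spanning set is returned as well, since it certifies that the
  product has finite dimension.
\<close>

lemma polytope_prod_spanning:
  fixes P1 :: "('i \<Rightarrow>\<^sub>0 real) set" and P2 :: "('j \<Rightarrow>\<^sub>0 real) set"
  assumes "finite S1" "P1 = convex hull S1" "finite S2" "P2 = convex hull S2"
    and ne: "polytope_prod P1 P2 \<noteq> {}"
  obtains z B where "z \<in> polytope_prod P1 P2" "finite B"
    "(\<lambda>x. x - z) ` polytope_prod P1 P2 \<subseteq> span B" "int (card B) \<le> polytope_dim P1 + polytope_dim P2"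
proof -
  have "P1 \<noteq> {}" "P2 \<noteq> {}" using ne unfolding polytope_prod_eq by auto
  obtain p B1 where 1: "p \<in> P1" "finite B1" "(\<lambda>x. x - p) ` P1 \<subseteq> span B1" "polytope_dim P1 = int (card B1)"
    using finite_spanning_differences[OF assms(1,2) \<open>P1 \<noteq> {}\<close>] by blast
  obtain q B2 where 2: "q \<in> P2" "finite B2" "(\<lambda>x. x - q) ` P2 \<subseteq> span B2" "polytope_dim P2 = int (card B2)"
    using finite_spanning_differences[OF assms(3,4) \<open>P2 \<noteq> {}\<close>] by blast
  define l :: "('i \<Rightarrow>\<^sub>0 real) \<Rightarrow> ('i + 'j \<Rightarrow>\<^sub>0 real)" where "l = (\<lambda>x. pm_pair x 0)"
  define r :: "('j \<Rightarrow>\<^sub>0 real) \<Rightarrow> ('i + 'j \<Rightarrow>\<^sub>0 real)" where "r = (\<lambda>y. pm_pair 0 y)"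
  have lin: "linear l" "linear r"
    unfolding l_def r_def by (rule linear_pm_pair_left, rule linear_pm_pair_right)
  let ?B = "l ` B1 \<union> r ` B2"
  have "w - pm_pair p q \<in> span ?B" if w: "w \<in> polytope_prod P1 P2" for w
  proof -
    obtain x y where xy: "x \<in> P1" "y \<in> P2" "w = pm_pair x y"
      using w unfolding polytope_prod_eq by auto
    have "w = l (x - p) + r (y - q) + pm_pair p q"
      by (simp add: xy(3) l_def r_def pm_pair_add)
    then have eq: "w - pm_pair p q = l (x - p) + r (y - q)" by simp
    have "l (x - p) \<in> span (l ` B1)" "r (y - q) \<in> span (r ` B2)"
      unfolding linear_span_image[OF lin(1)] linear_span_image[OF lin(2)]
      using 1(3) 2(3) xy(1,2) by blast+
    moreover have "span (l ` B1) \<subseteq> span ?B" "span (r ` B2) \<subseteq> span ?B"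
      by (simp_all add: span_mono)
    ultimately show ?thesis
      unfolding eq by (intro span_add) blast+
  qed
  then have "(\<lambda>x. x - pm_pair p q) ` polytope_prod P1 P2 \<subseteq> span ?B" by blast
  moreover have "card ?B \<le> card B1 + card B2"
    using card_Un_le[of "l ` B1" "r ` B2"] card_image_le[OF 1(2), of l] card_image_le[OF 2(2), of r]
    by linarith
  moreover have "pm_pair p q \<in> polytope_prod P1 P2"
    unfolding polytope_prod_eq using 1(1) 2(1) by blast
  ultimately show ?thesis using that[of "pm_pair p q" ?B] 1 2 by auto
qed

text \<open>
  Pairs of vertices of the factors are distinct lattice points of the product, so their number is bounded by the
  number of lattice points of \<open>P\<close>.
\<close>

lemma not_prime_factors:
  assumes lat: "lattice_polytope P" and dimP: "polytope_dim P = 3" and np: "\<not> prime_polytope P"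
    and fin: "finite (P \<inter> int_points)"
  obtains S1 S2 :: "(nat \<Rightarrow>\<^sub>0 real) set" where "finite S1" "finite S2"
    "P \<cong>\<^sub>p polytope_prod (convex hull S1) (convex hull S2)"
    "polytope_dim (convex hull S1) \<le> 2" "polytope_dim (convex hull S2) \<le> 2"
    "3 \<le> polytope_dim (convex hull S1) + polytope_dim (convex hull S2)"
    "(\<lambda>(x, y). pm_pair x y) ` (S1 \<times> S2) \<subseteq> polytope_prod (convex hull S1) (convex hull S2) \<inter> int_points"
    "card S1 * card S2 \<le> card (P \<inter> int_points)"
proof -
  obtain P1 P2 :: "(nat \<Rightarrow>\<^sub>0 real) set" where
    L: "lattice_polytope P1" "lattice_polytope P2" and d: "polytope_dim P1 < 3" "polytope_dim P2 < 3"
    and eq: "P \<cong>\<^sub>p polytope_prod P1 P2"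
    using np lat dimP unfolding prime_polytope_def by auto
  obtain S1 where S1: "finite S1" "S1 \<subseteq> int_points" "P1 = convex hull S1"
    using L(1) unfolding lattice_polytope_def by blast
  obtain S2 where S2: "finite S2" "S2 \<subseteq> int_points" "P2 = convex hull S2"
    using L(2) unfolding lattice_polytope_def by blast
  let ?Q = "polytope_prod P1 P2"
  have "P \<noteq> {}" using dimP by (auto simp: polytope_dim_def)
  then have "?Q \<noteq> {}" using polytope_equiv_bij_int_points[OF eq] by blast
  then obtain z B where B: "z \<in> ?Q" "finite B" "(\<lambda>x. x - z) ` ?Q \<subseteq> span B"
    "int (card B) \<le> polytope_dim P1 + polytope_dim P2"
    using polytope_prod_spanning[OF S1(1,3) S2(1,3)] by blast
  have "3 \<le> polytope_dim ?Q"
    using polytope_equiv_dim_le[OF polytope_equiv_sym[OF eq] B(1-3)] dimP by simp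
  also have "\<dots> \<le> int (card B)"
    using polytope_dim_eq_dim[OF B(1)] dim_le_card[OF B(3,2)] by simp
  finally have d3: "3 \<le> polytope_dim P1 + polytope_dim P2" using B(4) by linarith
  have sub: "(\<lambda>(x, y). pm_pair x y) ` (S1 \<times> S2) \<subseteq> ?Q \<inter> int_points"
    unfolding polytope_prod_eq using S1 S2 by (auto simp: pm_pair_int_points hull_inc)
  have "finite (?Q \<inter> int_points)"
    using polytope_equiv_bij_int_points[OF eq] fin bij_betw_finite by metis
  then have "card ((\<lambda>(x, y). pm_pair x y) ` (S1 \<times> S2)) \<le> card (P \<inter> int_points)"
    using sub polytope_equiv_card_int_points[OF eq] card_mono by metis
  moreover have "inj_on (\<lambda>(x, y). pm_pair x y) (S1 \<times> S2)"
    by (auto simp: inj_on_def pm_pair_inject)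
  ultimately have "card S1 * card S2 \<le> card (P \<inter> int_points)"
    by (simp add: card_image card_cartesian_product)
  then show ?thesis
    using that[of S1 S2] S1 S2 d d3 eq sub by simp
qed

text \<open>
  A factor of dimension \<open>k\<close> needs at least \<open>k + 1\<close> vertices, and two factors of dimension \<open>2\<close> would already
  give nine pairs of vertices.
\<close>

lemma product_card_bounds:
  fixes S1 S2 :: "(nat \<Rightarrow>\<^sub>0 real) set"
  assumes "finite S1" "finite S2"
    "polytope_dim (convex hull S1) \<le> 2" "polytope_dim (convex hull S2) \<le> 2"
    "3 \<le> polytope_dim (convex hull S1) + polytope_dim (convex hull S2)"
    "card S1 * card S2 \<le> 6"
  shows "(card S1 = 2 \<and> card S2 = 3 \<and> polytope_dim (convex hull S2) = 2) \<or>
    (card S1 = 3 \<and> card S2 = 2 \<and> polytope_dim (convex hull S1) = 2)"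
proof -
  have c: "polytope_dim (convex hull S1) + 1 \<le> int (card S1)" "polytope_dim (convex hull S2) + 1 \<le> int (card S2)"
    using polytope_dim_le_card[OF assms(1) refl] polytope_dim_le_card[OF assms(2) refl] by simp_all
  have ge: "2 \<le> card S1" "2 \<le> card S2" using c assms(3-5) by linarith+
  have "2 * card S2 \<le> card S1 * card S2" "2 * card S1 \<le> card S1 * card S2"
    using mult_le_mono1[OF ge(1), of "card S2"] mult_le_mono1[OF ge(2), of "card S1"] by (simp_all add: mult.commute)
  then have le: "card S1 \<le> 3" "card S2 \<le> 3" using assms(6) by linarith+
  have "card S1 = 2 \<or> card S1 = 3" "card S2 = 2 \<or> card S2 = 3" using ge le by linarith+
  then show ?thesis using assms c by auto
qed

lemma prime_if_at_most_5_int_points: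
  assumes "lattice_polytope P" "polytope_dim P = 3" "finite (P \<inter> int_points)" "card (P \<inter> int_points) \<le> 5"
  shows "prime_polytope P"
proof (rule ccontr)
  assume "\<not> prime_polytope P"
  from not_prime_factors[OF assms(1,2) this assms(3)]
  obtain S1 S2 :: "(nat \<Rightarrow>\<^sub>0 real) set" where S: "finite S1" "finite S2"
    "polytope_dim (convex hull S1) \<le> 2" "polytope_dim (convex hull S2) \<le> 2"
    "3 \<le> polytope_dim (convex hull S1) + polytope_dim (convex hull S2)"
    and c: "card S1 * card S2 \<le> card (P \<inter> int_points)" by metis
  have "card S1 * card S2 \<le> 6" using c assms(4) by linarith
  from product_card_bounds[OF S this] show False using c assms(4) by auto
qed

text \<open>
  A point reflection of a set of three points fixes one of them, which is then the midpoint of the other two.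
\<close>

lemma centrally_symmetric_triple_collinear:
  assumes "card S = 3" and sym: "\<And>y. y \<in> S \<Longrightarrow> \<exists>y'\<in>S. y + y' = m"
  shows "polytope_dim (convex hull S) \<le> 1"
proof -
  obtain a b c where abc: "S = {a, b, c}" "a \<noteq> b" "b \<noteq> c" "a \<noteq> c"
    using assms(1) by (metis card_3_iff)
  have mid: "polytope_dim (convex hull {a, b, c}) \<le> 1" if "b + c = a + a" for a b c :: "'a \<Rightarrow>\<^sub>0 real"
  proof -
    have a: "a \<in> convex hull {a, b, c}" by (simp add: hull_inc)
    have "c - a = - (b - a)" using that by (simp add: algebra_simps)
    then have "(\<lambda>x. x - a) ` ({a, b, c} - {a}) \<subseteq> span {b - a}"
      using span_neg[of "b - a" "{b - a}"] by (auto simp: span_base)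
    then have "span ((\<lambda>x. x - a) ` ({a, b, c} - {a})) \<subseteq> span {b - a}"
      by (simp add: span_minimal)
    then have "(\<lambda>x. x - a) ` (convex hull {a, b, c}) \<subseteq> span {b - a}"
      using convex_hull_differences_span[of a "{a, b, c}"] by blast
    then have "dim ((\<lambda>x. x - a) ` (convex hull {a, b, c})) \<le> card {b - a}"
      by (rule dim_le_card) simp
    then show ?thesis using polytope_dim_eq_dim[OF a] by simp
  qed
  have double: "x = y" if "x + x = y + y" for x y :: "'a \<Rightarrow>\<^sub>0 real"
    using that unfolding scaleR_2[symmetric] by simp
  have *: "a + a = m \<or> a + b = m \<or> a + c = m" "b + a = m \<or> b + b = m \<or> b + c = m"
    "c + a = m \<or> c + b = m \<or> c + c = m"
    using sym[of a] sym[of b] sym[of c] abc(1) by blast+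
  consider "b + c = a + a" | "a + c = b + b" | "a + b = c + c"
  proof -
    consider (a) "a + a = m" | (b) "a + b = m" | (c) "a + c = m" using *(1) by blast
    then show ?thesis
    proof cases
      case a
      then have "b + a \<noteq> m" "b + b \<noteq> m" using abc(2) double[of a b] by (auto simp: add.commute)
      then have "b + c = a + a" using *(2) a by simp
      then show ?thesis by (rule that(1))
    next
      case b
      then have "c + a \<noteq> m" "c + b \<noteq> m" using abc(3,4) by (auto simp: add.commute)
      then have "a + b = c + c" using *(3) b by simp
      then show ?thesis by (rule that(3))
    next
      case c
      then have "b + a \<noteq> m" "b + c \<noteq> m" using abc(2,3) by (auto simp: add.commute)
      then have "a + c = b + b" using *(2) c by simp
      then show ?thesis by (rule that(2))
    qed
  qed
  then show ?thesis
    using mid[of b c a] mid[of a c b] mid[of a b c] unfolding abc(1)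
    by cases (simp_all add: insert_commute)
qed

text \<open>
  The six lattice points would be the pairs of vertices of a segment and a triangle. An equivalence
  preserves central symmetry, and so do the projections to the factors; but a triangle is not centrally
  symmetric.
\<close>

lemma prime_if_6_symmetric_int_points:
  assumes lat: "lattice_polytope P" and dimP: "polytope_dim P = 3" and card: "card (P \<inter> int_points) = 6"
    and sym: "\<And>x. x \<in> P \<inter> int_points \<Longrightarrow> m - x \<in> P \<inter> int_points"
  shows "prime_polytope P"
proof (rule ccontr)
  assume "\<not> prime_polytope P"
  have "finite (P \<inter> int_points)" using card by (metis card.infinite zero_neq_numeral)
  from not_prime_factors[OF lat dimP \<open>\<not> prime_polytope P\<close> this]
  obtain S1 S2 :: "(nat \<Rightarrow>\<^sub>0 real) set" where S: "finite S1" "finite S2"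
    "polytope_dim (convex hull S1) \<le> 2" "polytope_dim (convex hull S2) \<le> 2"
    "3 \<le> polytope_dim (convex hull S1) + polytope_dim (convex hull S2)"
    and eq: "P \<cong>\<^sub>p polytope_prod (convex hull S1) (convex hull S2)"
    and sub: "(\<lambda>(x, y). pm_pair x y) ` (S1 \<times> S2)
        \<subseteq> polytope_prod (convex hull S1) (convex hull S2) \<inter> int_points"
    and c: "card S1 * card S2 \<le> card (P \<inter> int_points)" by metis
  let ?Q = "polytope_prod (convex hull S1) (convex hull S2)" and ?V = "(\<lambda>(x, y). pm_pair x y) ` (S1 \<times> S2)"
  have "card S1 * card S2 \<le> 6" using c card by simp
  note bounds = product_card_bounds[OF S this]
  have "card ?V = card S1 * card S2"
    by (subst card_image) (auto simp: inj_on_def pm_pair_inject card_cartesian_product)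
  then have cV: "card ?V = 6" using bounds by auto
  have cQ: "card (?Q \<inter> int_points) = 6" using polytope_equiv_card_int_points[OF eq] card by simp
  have "finite (?Q \<inter> int_points)" by (rule card_ge_0_finite) (simp add: cQ)
  from card_subset_eq[OF this sub] have V: "?V = ?Q \<inter> int_points"
    unfolding cV cQ by blast
  obtain f where f: "affine_map_on (affine hull P) f" "bij_betw f (P \<inter> int_points) (?Q \<inter> int_points)"
    by (rule polytope_equiv_bij_int_points[OF eq])
  define m' where "m' = 2 *\<^sub>R f ((1/2) *\<^sub>R m)"
  have symQ: "\<exists>w'\<in>?V. w + w' = m'" if w: "w \<in> ?V" for w
  proof -
    obtain x where x: "x \<in> P \<inter> int_points" "w = f x"
      using w f(2) unfolding V bij_betw_def by blast
    have x': "m - x \<in> P \<inter> int_points" using sym x(1) by blast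
    have "f ((1/2) *\<^sub>R x + (1/2) *\<^sub>R (m - x)) = (1/2) *\<^sub>R f x + (1/2) *\<^sub>R f (m - x)"
      using f(1) x(1) x' hull_inc[of _ P affine] unfolding affine_map_on_def by simp
    moreover have "(1/2) *\<^sub>R x + (1/2) *\<^sub>R (m - x) = (1/2) *\<^sub>R m"
      by (simp flip: scaleR_add_right)
    ultimately have "m' = f x + f (m - x)"
      unfolding m'_def by (simp flip: scaleR_add_right)
    moreover have "f (m - x) \<in> ?V" using x' f(2) unfolding V bij_betw_def by blast
    ultimately show ?thesis using x(2) by metis
  qed
  have ne: "S1 \<noteq> {}" "S2 \<noteq> {}" using bounds by auto
  then obtain s1 s2 where s: "s1 \<in> S1" "s2 \<in> S2" by blast
  have pr: "m' = pm_pair (s1 + x0) (s2 + y0)" if "pm_pair s1 s2 + pm_pair x0 y0 = m'" for x0 y0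
    using that by (simp add: pm_pair_add)
  have "pm_pair s1 s2 \<in> ?V" using s by auto
  from symQ[OF this] obtain m1 m2 where m: "m' = pm_pair m1 m2" using pr by auto
  have "\<exists>y'\<in>S2. y + y' = m2" if "y \<in> S2" for y
    using symQ[of "pm_pair s1 y"] s that unfolding m by (auto simp: pm_pair_add pm_pair_inject)
  then have 2: "card S2 = 3 \<Longrightarrow> polytope_dim (convex hull S2) \<le> 1"
    using centrally_symmetric_triple_collinear by blast
  have "\<exists>x'\<in>S1. x + x' = m1" if "x \<in> S1" for x
    using symQ[of "pm_pair x s2"] s that unfolding m by (auto simp: pm_pair_add pm_pair_inject)
  then have 1: "card S1 = 3 \<Longrightarrow> polytope_dim (convex hull S1) \<le> 1"
    using centrally_symmetric_triple_collinear by blast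
  show False using bounds 1 2 by auto
qed

text \<open>
  The chart \<open>k\<close> in the proof splits off the first coordinate; the factors have dimension at most \<open>1\<close>
  and \<open>2\<close> since they are images of subsets of a line and a plane.
\<close>

lemma convex_hull_Times_not_prime:
  fixes A :: "real set" and B :: "(real \<times> real) set"
  assumes g: "lattice_chart g" and P: "P = g ` (convex hull (A \<times> B))" and dimP: "polytope_dim P = 3"
    and A: "finite A" "A \<subseteq> \<int>" and B: "finite B" "B \<subseteq> \<int> \<times> \<int>"
  shows "\<not> prime_polytope P"
proof -
  define k1 :: "real \<Rightarrow> (nat \<Rightarrow>\<^sub>0 real)" where "k1 = Poly_Mapping.single 0"
  define k2 :: "real \<times> real \<Rightarrow> (nat \<Rightarrow>\<^sub>0 real)"
    where "k2 = (\<lambda>(y, z). Poly_Mapping.single 0 y + Poly_Mapping.single 1 z)"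
  define k where "k v = pm_pair (k1 (fst v)) (k2 (snd v))" for v
  have l1: "Poly_Mapping.lookup (k1 x) i = (if i = 0 then x else 0)" for x i
    by (simp add: k1_def lookup_single when_def)
  have l2: "Poly_Mapping.lookup (k2 (y, z)) i = (if i = 0 then y else if i = 1 then z else 0)" for y z i
    by (simp add: k2_def lookup_add lookup_single when_def)
  have lin1: "linear k1" by (rule linearI; rule poly_mapping_eqI) (simp_all add: l1 lookup_add)
  have lin2: "linear k2" by (rule linearI; rule poly_mapping_eqI) (auto simp: l2 lookup_add)
  have lin: "linear k"
    by (rule linearI) (simp_all add: k_def pm_pair_add pm_pair_scale linear_add[OF lin1]
        linear_add[OF lin2] linear_scale[OF lin1, unfolded real_scaleR_def] linear_scale[OF lin2])
  have inj1: "inj k1"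
  proof (rule injI)
    fix x x' assume "k1 x = k1 x'"
    then have "Poly_Mapping.lookup (k1 x) 0 = Poly_Mapping.lookup (k1 x') 0" by (simp only:)
    then show "x = x'" by (simp add: l1)
  qed
  have inj2: "inj k2"
  proof (rule injI)
    fix v w assume eq: "k2 v = k2 w"
    obtain y z y' z' where vw: "v = (y, z)" "w = (y', z')" by (metis surj_pair)
    have "Poly_Mapping.lookup (k2 v) i = Poly_Mapping.lookup (k2 w) i" for i by (simp only: eq)
    from this[of 0] this[of 1] show "v = w" by (simp add: vw l2)
  qed
  have "inj k"
    by (rule injI) (simp add: k_def pm_pair_inject inj_eq[OF inj1] inj_eq[OF inj2] prod_eq_iff)
  have e1: "affine_embedding k1" by (rule affine_embeddingI[OF lin1 inj1, where p = 0]) simp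
  have e2: "affine_embedding k2" by (rule affine_embeddingI[OF lin2 inj2, where p = 0]) simp
  have e: "affine_embedding k" by (rule affine_embeddingI[OF lin \<open>inj k\<close>, where p = 0]) simp
  have int1: "k1 x \<in> int_points \<longleftrightarrow> x \<in> \<int>" for x
    by (simp add: int_points_def l1)
  have int2: "k2 v \<in> int_points \<longleftrightarrow> v \<in> \<int> \<times> \<int>" for v
  proof (cases v)
    case (Pair y z)
    have "(\<forall>i. Poly_Mapping.lookup (k2 (y, z)) i \<in> \<int>) \<longleftrightarrow> y \<in> \<int> \<and> z \<in> \<int>" (is "?L \<longleftrightarrow> ?R")
    proof
      assume ?L
      from spec[OF this, of 0] spec[OF this, of 1] show ?R by (simp add: l2)
    qed (simp add: l2)
    then show ?thesis by (simp add: Pair int_points_def)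
  qed
  have chart: "lattice_chart k"
    using e unfolding lattice_chart_def k_def pm_pair_int_points int1 int2 int3_def mem_Times_iff by blast
  let ?P1 = "k1 ` (convex hull A)" and ?P2 = "k2 ` (convex hull B)"
  have "affine hull (convex hull (A \<times> B)) = UNIV"
    using dimP polytope_dim_image[OF lattice_chartD(1)[OF g], of "convex hull (A \<times> B)"] P
      aff_dim_eq_full[of "convex hull (A \<times> B)"] by simp
  then have "P \<cong>\<^sub>p k ` (convex hull (A \<times> B))"
    unfolding P by (rule lattice_chart_equiv[OF g chart])
  also have "k ` (convex hull (A \<times> B)) = polytope_prod ?P1 ?P2"
    unfolding convex_hull_Times polytope_prod_eq by (force simp: k_def)
  finally have "P \<cong>\<^sub>p polytope_prod ?P1 ?P2" .
  moreover have "lattice_polytope ?P1"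
    by (rule lattice_polytope_chart_image[OF e1 A(1)]) (use A(2) int1 in blast)
  moreover have "lattice_polytope ?P2"
    by (rule lattice_polytope_chart_image[OF e2 B(1)]) (use B(2) int2 in blast)
  moreover have "polytope_dim ?P1 < polytope_dim P"
    using aff_dim_le_DIM[of "convex hull A"] unfolding polytope_dim_image[OF e1] dimP by simp
  moreover have "polytope_dim ?P2 < polytope_dim P"
    using aff_dim_le_DIM[of "convex hull B"] unfolding polytope_dim_image[OF e2] dimP by simp
  ultimately show ?thesis unfolding prime_polytope_def by blast
qed

section \<open>Facets of compressed polytopes\<close>

lemma facet_image:
  fixes g :: "'e::euclidean_space \<Rightarrow> ('i \<Rightarrow>\<^sub>0 real)"
  assumes "affine_embedding g"
  shows "facet (g ` C) (g ` T) \<longleftrightarrow> T facet_of C"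
  unfolding facet_def facet_of_def affine_embedding_face_of[OF assms] polytope_dim_image[OF assms]
  by simp

lemma slab_convex: "convex {x :: 'a::real_inner. c \<le> n \<bullet> x \<and> n \<bullet> x \<le> d}"
proof -
  have "{x. c \<le> n \<bullet> x \<and> n \<bullet> x \<le> d} = {x. n \<bullet> x \<ge> c} \<inter> {x. n \<bullet> x \<le> d}" by auto
  then show ?thesis by (simp add: convex_Int convex_halfspace_ge convex_halfspace_le)
qed

lemma translate_hyperplane_image:
  fixes g :: "'e::euclidean_space \<Rightarrow> ('i \<Rightarrow>\<^sub>0 real)"
  assumes "linear h" "\<And>v. g v = p + h v"
  shows "(+) (h u) ` g ` {x. n \<bullet> x = c} = g ` {x. n \<bullet> x = c + n \<bullet> u}"
proof -
  have "(+) (h u) ` g ` {x. n \<bullet> x = c} = g ` (+) u ` {x. n \<bullet> x = c}"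
    by (simp add: image_image assms linear_add[OF assms(1)] algebra_simps)
  also have "(+) u ` {x. n \<bullet> x = c} = {x. n \<bullet> x = c + n \<bullet> u}"
  proof (intro subset_antisym subsetI)
    fix x assume "x \<in> {x. n \<bullet> x = c + n \<bullet> u}"
    then have "x = u + (x - u)" "n \<bullet> (x - u) = c" by (simp_all add: inner_diff_right)
    then show "x \<in> (+) u ` {x. n \<bullet> x = c}" by blast
  qed (auto simp: inner_add_right)
  finally show ?thesis .
qed

text \<open>
  The hyperplane of the facet is a level set of a linear functional, and the neighbouring lattice
  hyperplane is a parallel one, so the functional can be scaled such that the levels differ by \<open>1\<close>. If it took a
  non-integral value at some lattice point, then a lattice translate of the neighbouring hyperplane would
  lie strictly between the two, which contradicts the definition of neighbouring hyperplanes.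
\<close>

lemma facet_width_functional:
  fixes g :: "real3 \<Rightarrow> ('i \<Rightarrow>\<^sub>0 real)"
  assumes g: "affine_embedding g" and comp: "compressed (g ` C)"
    and C: "C = convex hull S" "finite S" "g ` S \<subseteq> int_points" and full: "aff_dim C = 3"
    and T: "T facet_of C"
  obtains n c where "affine hull T = {v. n \<bullet> v = c}" "n \<noteq> 0"
    "\<And>v. v \<in> C \<Longrightarrow> c \<le> n \<bullet> v \<and> n \<bullet> v \<le> c + 1"
    "\<And>v. g v \<in> int_points \<Longrightarrow> n \<bullet> v - c \<in> \<int>"
proof -
  obtain p h where h: "linear h" "inj h" "\<And>v. g v = p + h v"
    by (rule affine_embeddingE[OF g]) blast
  have injg: "inj g" by (rule affine_embedding_inj[OF g])
  have ahC: "affine hull C = UNIV"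
    using full aff_dim_eq_full[of C] by simp
  have ahP: "affine hull (g ` C) = range g"
    by (rule affine_hull_chart_image[OF g ahC])
  let ?H = "affine hull (g ` T)"
  have "facet (g ` C) (g ` T)" using facet_image[OF g] T by blast
  then obtain H' where nb: "neighbouring_lattice_hyperplane (g ` C) ?H H'"
    and slab: "g ` C \<subseteq> convex hull (?H \<union> H')"
    using comp unfolding compressed_def by blast
  obtain w where w: "H' = (+) w ` ?H" and H'r: "H' \<subseteq> range g"
    and H'l: "affine hull (H' \<inter> int_points) = H'" and H'ne: "H' \<noteq> ?H"
    using nb unfolding neighbouring_lattice_hyperplane_def parallel_lattice_hyperplane_def ahP
    by auto
  have "aff_dim T = 2" "T \<noteq> {}" "T face_of C" using T full by (simp_all add: facet_of_def)
  then obtain a b where ab: "a \<noteq> 0" "affine hull T = {x. a \<bullet> x = b}"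
    using aff_dim_eq_hyperplane[of T] by auto
  have H: "?H = g ` {x. a \<bullet> x = b}"
    using affine_embedding_image_affine_hull[OF g, of T] ab(2) by simp
  obtain S' where S': "S' \<subseteq> S" "T = convex hull S'"
    using face_of_convex_hull_subset[of S T] \<open>T face_of C\<close> C finite_imp_compact by metis
  then obtain e where e: "e \<in> S'" using \<open>T \<noteq> {}\<close> by auto
  have eT: "e \<in> T" and ge: "g e \<in> int_points"
    using e S' C(3) by (auto simp: hull_inc)
  have "w + g e \<in> range g"
    using w H'r eT by (metis hull_inc imageI subsetD)
  then obtain t1 where "w + g e = g t1" by blast
  then have "w = h (t1 - e)"
    by (simp add: h linear_diff[OF h(1)] algebra_simps)
  then obtain u where u: "w = h u" by blast
  note tr = translate_hyperplane_image[OF h(1,3)]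
  have au: "a \<bullet> u \<noteq> 0"
    using H'ne tr[of u a b] unfolding w H u by auto
  define n where "n = a /\<^sub>R (a \<bullet> u)"
  define c where "c = b / (a \<bullet> u)"
  have nu: "n \<bullet> u = 1" using au by (simp add: n_def)
  have aT: "affine hull T = {x. n \<bullet> x = c}"
    using au ab(2) by (auto simp: n_def c_def field_simps)
  have H: "?H = g ` {x. n \<bullet> x = c}"
    using affine_embedding_image_affine_hull[OF g, of T] aT by simp
  have H': "H' = g ` {x. n \<bullet> x = c + 1}"
    unfolding w H u tr nu ..
  have n0: "n \<noteq> 0" using nu by auto
  have "?H \<union> H' = g ` ({x. n \<bullet> x = c} \<union> {x. n \<bullet> x = c + 1})"
    unfolding H H' by blast
  then have hull_eq: "convex hull (?H \<union> H') = g ` (convex hull ({x. n \<bullet> x = c} \<union> {x. n \<bullet> x = c + 1}))"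
    using affine_embedding_image_convex_hull[OF g] by simp
  have bounds: "c \<le> n \<bullet> v \<and> n \<bullet> v \<le> c + 1" if "v \<in> C" for v
  proof -
    have "v \<in> convex hull ({x. n \<bullet> x = c} \<union> {x. n \<bullet> x = c + 1})"
      using slab that unfolding hull_eq inj_image_subset_iff[OF injg] by blast
    moreover have "convex hull ({x. n \<bullet> x = c} \<union> {x. n \<bullet> x = c + 1}) \<subseteq> {x. c \<le> n \<bullet> x \<and> n \<bullet> x \<le> c + 1}"
      by (rule hull_minimal[where S=convex, OF _ slab_convex]) auto
    ultimately show ?thesis by blast
  qed
  have integral: "n \<bullet> v - c \<in> \<int>" if v: "g v \<in> int_points" for v
  proof (rule ccontr)
    assume "n \<bullet> v - c \<notin> \<int>"
    define k :: real where "k = of_int \<lfloor>n \<bullet> v - c\<rfloor>"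
    define s where "s = n \<bullet> v - c - k"
    have s: "0 < s" "s < 1"
      using \<open>n \<bullet> v - c \<notin> \<int>\<close> frac_gt_0_iff[of "n \<bullet> v - c"] frac_lt_1[of "n \<bullet> v - c"]
      by (simp_all add: s_def k_def frac_def)
    define H'' where "H'' = (+) (s *\<^sub>R w) ` ?H"
    have H'': "H'' = g ` {x. n \<bullet> x = c + s}"
      unfolding H''_def H u linear_scale[OF h(1), symmetric] tr by (simp add: nu)
    have "H' \<inter> int_points \<noteq> {}"
    proof
      assume "H' \<inter> int_points = {}"
      then have "H' = {}" using H'l by simp
      then show False unfolding w using \<open>T \<noteq> {}\<close> by simp
    qed
    then obtain y where y: "n \<bullet> y = c + 1" "g y \<in> int_points"
      unfolding H' by blast
    (* The lattice translation by \<open>v - y\<close> moves the level \<open>c + 1\<close> to the level of \<open>v\<close>;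
       k further steps from \<open>y\<close> to \<open>e\<close>, each lowering the level by 1, reach \<open>c + s\<close>. *)
    define d where "d = v - y - k *\<^sub>R (y - e)"
    have ne: "n \<bullet> e = c" using aT eT hull_inc[of e T affine] by blast
    have nd: "n \<bullet> d = s - 1"
      unfolding d_def s_def by (simp add: inner_diff_right inner_scaleR_right y(1) ne algebra_simps)
    have hd: "h d = g v - g y - k *\<^sub>R (g y - g e)"
      by (simp add: d_def h(3) linear_diff[OF h(1)] linear_scale[OF h(1)])
    have "h d \<in> int_points"
      unfolding hd by (intro int_points_diff int_points_scale v y ge) (simp add: k_def)
    have eqd: "(+) (h d) ` H' = H''"
      unfolding H' tr nd H'' by simp
    have "affine hull (H'' \<inter> int_points) = H''"
      unfolding eqd[symmetric] int_points_translate[OF \<open>h d \<in> int_points\<close>]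
        affine_hull_translation H'l ..
    moreover have "H'' \<subseteq> range g" unfolding H'' by blast
    ultimately have par: "parallel_lattice_hyperplane (g ` C) ?H H''"
      unfolding parallel_lattice_hyperplane_def ahP H''_def by blast
    have "H'' \<noteq> ?H"
    proof
      assume "H'' = ?H"
      moreover have "g e \<in> ?H" using eT by (simp add: hull_inc)
      ultimately have "e \<in> {x. n \<bullet> x = c + s}"
        unfolding H'' using injg by (metis inj_image_mem_iff)
      then show False using ne s by simp
    qed
    moreover have "H'' \<noteq> H'"
    proof
      assume "H'' = H'"
      then have "g y \<in> H''" using y H' by blast
      then have "y \<in> {x. n \<bullet> x = c + s}"
        unfolding H'' using injg by (metis inj_image_mem_iff)
      then show False using y s by simp
    qed
    moreover have "H'' \<subseteq> convex hull (?H \<union> H')"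
    proof -
      have "{x. n \<bullet> x = c + s} \<subseteq> convex hull ({x. n \<bullet> x = c} \<union> {x. n \<bullet> x = c + 1})" (is "_ \<subseteq> ?K")
      proof
        fix x assume x: "x \<in> {x. n \<bullet> x = c + s}"
        let ?x0 = "x - s *\<^sub>R u" and ?x1 = "x + (1 - s) *\<^sub>R u"
        have "?x0 \<in> ?K" "?x1 \<in> ?K"
          using x by (auto intro!: hull_inc simp: inner_diff_right inner_add_right nu)
        then have "(1 - s) *\<^sub>R ?x0 + s *\<^sub>R ?x1 \<in> ?K"
          using s by (intro convexD[OF convex_convex_hull]) auto
        then show "x \<in> ?K" by (simp add: algebra_simps)
      qed
      then show ?thesis unfolding H'' hull_eq by blast
    qed
    ultimately show False
      using nb par unfolding neighbouring_lattice_hyperplane_def by blast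
  qed
  show ?thesis using that[OF aT n0 bounds integral] .
qed

section \<open>Embedding a compressed polytope into the unit cube\<close>

text \<open>
  A proper face of a polyhedron is the intersection of the facets that contain it.
\<close>

lemma facet_not_containing:
  assumes "polyhedron C" "G face_of C" "G \<noteq> {}" "G \<noteq> C" "G \<subset> K" "K \<subseteq> C"
  obtains F where "F facet_of C" "G \<subseteq> F" "\<not> K \<subseteq> F"
proof -
  have "G = \<Inter> {F. F facet_of C \<and> G \<subseteq> F}"
    using face_of_polyhedron assms by blast
  then show ?thesis using assms(5) that by blast
qed

lemma face_vertex_outside:
  fixes S :: "'e::euclidean_space set"
  assumes "finite S" "T face_of convex hull S" "convex F" "\<not> T \<subseteq> F"
  obtains v where "v \<in> S" "v \<in> T" "v \<notin> F"
proof -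
  obtain S' where S': "S' \<subseteq> S" "T = convex hull S'"
    using face_of_convex_hull_subset[of S T] assms finite_imp_compact by metis
  have "\<not> S' \<subseteq> F" using S' assms(3,4) by (metis hull_minimal)
  then show ?thesis using that S' by (metis hull_inc subsetD subsetI)
qed

text \<open>
  The flag consists of a facet \<open>T1\<close>, an edge \<open>G\<close> of \<open>T1\<close> and an end point of \<open>G\<close>; the facets \<open>T2\<close> and
  \<open>T3\<close> contain the edge and the end point, respectively, but not the preceding member of the flag.
\<close>

lemma vertex_flag:
  fixes C :: "'e::euclidean_space set"
  assumes C: "C = convex hull S" "finite S" and full: "aff_dim C = 3"
  obtains T1 T2 T3 v0 v1 v2 v3 where
    "T1 facet_of C" "T2 facet_of C" "T3 facet_of C" "{v0, v1, v2, v3} \<subseteq> S"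
    "v0 \<in> T1 \<inter> T2 \<inter> T3" "v1 \<notin> T1" "v2 \<in> T1 - T2" "v3 \<in> T1 \<inter> T2 - T3"
proof -
  have pC: "polytope C" using C by (auto simp: polytope_def)
  then have phC: "polyhedron C" by (rule polytope_imp_polyhedron)
  obtain T1 where T1: "T1 facet_of C" using polytope_facet_exists[OF pC] full by auto
  then have T1f: "T1 face_of C" and d1: "aff_dim T1 = 2" using full by (auto simp: facet_of_def)
  have p1: "polytope T1" using face_of_polytope_polytope pC T1f by blast
  obtain G where G: "G facet_of T1" using polytope_facet_exists[OF p1] d1 by auto
  then have Gf: "G face_of C" and dG: "aff_dim G = 1" and Gne: "G \<noteq> {}" and GT: "G \<subseteq> T1"
    using d1 T1f face_of_trans by (auto simp: facet_of_def dest: face_of_imp_subset)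
  have pG: "polytope G" using face_of_polytope_polytope pC Gf by blast
  obtain W where W: "W facet_of G" using polytope_facet_exists[OF pG] dG by auto
  then have Wf: "W face_of C" and dW: "aff_dim W = 0" and Wne: "W \<noteq> {}" and WG: "W \<subseteq> G"
    using dG Gf face_of_trans by (auto simp: facet_of_def dest: face_of_imp_subset)
  have "T1 \<subseteq> C" using T1f by (rule face_of_imp_subset)
  have "G \<noteq> C" "W \<noteq> C" "G \<noteq> T1" "W \<noteq> G" using full dG dW d1 by auto
  obtain T2 where T2: "T2 facet_of C" "G \<subseteq> T2" "\<not> T1 \<subseteq> T2"
    using facet_not_containing[OF phC Gf Gne \<open>G \<noteq> C\<close>, of T1] GT \<open>G \<noteq> T1\<close> \<open>T1 \<subseteq> C\<close> by blast
  obtain T3 where T3: "T3 facet_of C" "W \<subseteq> T3" "\<not> G \<subseteq> T3"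
    using facet_not_containing[OF phC Wf Wne \<open>W \<noteq> C\<close>, of G] WG \<open>W \<noteq> G\<close> GT \<open>T1 \<subseteq> C\<close> by blast
  have conv: "convex T1" "convex T2" "convex T3"
    using T1 T2 T3 by (auto simp: facet_of_def dest: face_of_imp_convex)
  obtain v1 where v1: "v1 \<in> S" "v1 \<notin> T1"
    using face_vertex_outside[of S C T1] conv T1 full d1 C \<open>T1 \<subseteq> C\<close>
    by (metis face_of_refl convex_convex_hull subset_antisym numeral_eq_iff semiring_norm(88,89))
  obtain v2 where v2: "v2 \<in> S" "v2 \<in> T1" "v2 \<notin> T2"
    using face_vertex_outside[of S T1 T2] conv T1f C T2(3) by blast
  obtain v3 where v3: "v3 \<in> S" "v3 \<in> G" "v3 \<notin> T3"
    using face_vertex_outside[of S G T3] conv Gf C T3(3) by blast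
  obtain v0 where v0: "v0 \<in> S" "v0 \<in> W"
    using face_vertex_outside[of S W "{}"] Wf C Wne by auto
  show ?thesis
    using that[of T1 T2 T3 v0 v1 v2 v3] T1 T2 T3 v0 v1 v2 v3 WG GT by blast
qed

lemma int_unit_interval: "(r::real) \<in> \<int> \<Longrightarrow> 0 \<le> r \<Longrightarrow> r \<le> 1 \<Longrightarrow> r \<in> {0, 1}"
  by (elim Ints_cases) (simp, linarith)

abbreviation unit_cube_points :: "real3 set" where
  "unit_cube_points \<equiv> {0, 1} \<times> {0, 1} \<times> {0, 1}"

lemma facet_zero_set:
  fixes C :: "'e::euclidean_space set"
  assumes "convex C" "T facet_of C" "affine hull T = {v. n \<bullet> v = c}"
  shows "v \<in> C \<Longrightarrow> v \<in> T \<longleftrightarrow> n \<bullet> v = c"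
  using face_of_imp_eq_affine_Int[OF assms(1), of T] assms by (auto simp: facet_of_def)

text \<open>
  The functionals of a flag of facets have a triangular matrix with ones on the diagonal on the vertices
  \<open>v3\<close>, \<open>v2\<close>, \<open>v1\<close>, relative to \<open>v0\<close>. The entries off the diagonal are \<open>a\<close>, \<open>b\<close>, \<open>c\<close>; they are values
  of the functionals at vertices, hence \<open>0\<close> or \<open>1\<close>.
\<close>

lemma compressed_unit_cube_chart:
  fixes P :: "('i \<Rightarrow>\<^sub>0 real) set"
  assumes "lattice_polytope P" and dimP: "polytope_dim P = 3" and comp: "compressed P"
  obtains g S a b c where "lattice_chart g" "S \<subseteq> unit_cube_points" "P = g ` (convex hull S)"
    "{(0, 0, 0), (0, 0, 1), (0, 1, a), (1, b, c)} \<subseteq> S"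
proof -
  obtain S0 where S0: "finite S0" "S0 \<subseteq> int_points" "P = convex hull S0"
    using assms(1) unfolding lattice_polytope_def by blast
  obtain g0 :: "real3 \<Rightarrow> ('i \<Rightarrow>\<^sub>0 real)" where g0: "affine_embedding g0" "affine hull P = range g0"
    using obtain_affine_chart[OF dimP] by blast
  have inj0: "inj g0" by (rule affine_embedding_inj[OF g0(1)])
  define S1 where "S1 = g0 -` S0"
  have "S0 \<subseteq> range g0" unfolding g0(2)[symmetric] S0(3) by (simp add: hull_subset)
  then have gS1: "g0 ` S1 = S0" unfolding S1_def by blast
  have finS1: "finite S1" unfolding S1_def using S0(1) inj0 by (rule finite_vimageI)
  define C where "C = convex hull S1"
  have P: "P = g0 ` C"
    unfolding C_def affine_embedding_image_convex_hull[OF g0(1)] gS1 S0(3) ..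
  have full: "aff_dim C = 3" using dimP polytope_dim_image[OF g0(1)] P by simp
  have convC: "convex C" unfolding C_def by simp
  obtain T1 T2 T3 v0 v1 v2 v3 where
    T: "T1 facet_of C" "T2 facet_of C" "T3 facet_of C" and v: "{v0, v1, v2, v3} \<subseteq> S1" and
    vT: "v0 \<in> T1 \<inter> T2 \<inter> T3" "v1 \<notin> T1" "v2 \<in> T1 - T2" "v3 \<in> T1 \<inter> T2 - T3"
    using vertex_flag[OF C_def finS1 full] .
  note width = facet_width_functional[OF g0(1) comp[unfolded P] C_def finS1 _ full]
  have S1int: "g0 ` S1 \<subseteq> int_points" using gS1 S0 by simp
  obtain n1 c1 where 1: "affine hull T1 = {v. n1 \<bullet> v = c1}"
    "\<And>v. v \<in> C \<Longrightarrow> c1 \<le> n1 \<bullet> v \<and> n1 \<bullet> v \<le> c1 + 1"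
    "\<And>v. g0 v \<in> int_points \<Longrightarrow> n1 \<bullet> v - c1 \<in> \<int>"
    using width[OF S1int T(1)] by metis
  obtain n2 c2 where 2: "affine hull T2 = {v. n2 \<bullet> v = c2}"
    "\<And>v. v \<in> C \<Longrightarrow> c2 \<le> n2 \<bullet> v \<and> n2 \<bullet> v \<le> c2 + 1"
    "\<And>v. g0 v \<in> int_points \<Longrightarrow> n2 \<bullet> v - c2 \<in> \<int>"
    using width[OF S1int T(2)] by metis
  obtain n3 c3 where 3: "affine hull T3 = {v. n3 \<bullet> v = c3}"
    "\<And>v. v \<in> C \<Longrightarrow> c3 \<le> n3 \<bullet> v \<and> n3 \<bullet> v \<le> c3 + 1"
    "\<And>v. g0 v \<in> int_points \<Longrightarrow> n3 \<bullet> v - c3 \<in> \<int>"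
    using width[OF S1int T(3)] by metis
  define \<Phi> where "\<Phi> = (\<lambda>v. (n1 \<bullet> v - c1, n2 \<bullet> v - c2, n3 \<bullet> v - c3))"
  have \<Phi>int: "\<Phi> v \<in> int3" if "g0 v \<in> int_points" for v
    using 1(3) 2(3) 3(3) that by (simp add: \<Phi>_def)
  have S1C: "S1 \<subseteq> C" unfolding C_def by (rule hull_subset)
  have \<Phi>cube: "\<Phi> v \<in> unit_cube_points" if "v \<in> S1" for v
  proof -
    have gv: "g0 v \<in> int_points" and vC: "v \<in> C" using that S1int S1C by auto
    show ?thesis
      unfolding \<Phi>_def mem_Times_iff fst_conv snd_conv
      using 1(2)[OF vC] 2(2)[OF vC] 3(2)[OF vC] 1(3)[OF gv] 2(3)[OF gv] 3(3)[OF gv]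
      by (intro conjI int_unit_interval) auto
  qed
  have vC: "v0 \<in> C" "v1 \<in> C" "v2 \<in> C" "v3 \<in> C" using v S1C by auto
  note z1 = facet_zero_set[OF convC T(1) 1(1)] and z2 = facet_zero_set[OF convC T(2) 2(1)]
    and z3 = facet_zero_set[OF convC T(3) 3(1)]
  have \<Phi>0: "\<Phi> v0 = (0, 0, 0)"
    using vT(1) z1[OF vC(1)] z2[OF vC(1)] z3[OF vC(1)] by (simp add: \<Phi>_def)
  obtain a b c where \<Phi>3: "\<Phi> v3 = (0, 0, 1)" and \<Phi>2: "\<Phi> v2 = (0, 1, a)" and \<Phi>1: "\<Phi> v1 = (1, b, c)"
    using vT(2-4) z1[OF vC(2)] z1[OF vC(3)] z2[OF vC(3)] z1[OF vC(4)] z2[OF vC(4)] z3[OF vC(4)]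
      \<Phi>cube[of v1] \<Phi>cube[of v2] \<Phi>cube[of v3] v
    by (auto simp: \<Phi>_def)
  have abc: "a \<in> \<int>" "b \<in> \<int>" "c \<in> \<int>"
    using \<Phi>cube[of v1] \<Phi>cube[of v2] v unfolding \<Phi>1 \<Phi>2 by auto
  (* The inverse of \<open>\<Phi>\<close>, obtained by solving the triangular system; its coefficients
     are integers, so it maps integral vectors to lattice points. *)
  define K where "K = (\<lambda>(x, y, z). x *\<^sub>R (v1 - v0) + (y - b * x) *\<^sub>R (v2 - v0)
    + (z - c * x - a * (y - b * x)) *\<^sub>R (v3 - v0))"
  define \<Psi> where "\<Psi> = (\<lambda>w. v0 + K w)"
  have linK: "linear K"
    unfolding K_def by (rule linearI) (auto simp: algebra_simps)
  have \<Phi>\<Psi>: "\<Phi> (\<Psi> w) = w" for w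
  proof -
    obtain x y z where w: "w = (x, y, z)" by (cases w)
    have e0: "n1 \<bullet> v0 = c1" "n2 \<bullet> v0 = c2" "n3 \<bullet> v0 = c3" using \<Phi>0 by (simp_all add: \<Phi>_def)
    have e3: "n1 \<bullet> v3 = c1" "n2 \<bullet> v3 = c2" "n3 \<bullet> v3 = c3 + 1" using \<Phi>3 by (auto simp: \<Phi>_def)
    have e2: "n1 \<bullet> v2 = c1" "n2 \<bullet> v2 = c2 + 1" "n3 \<bullet> v2 = c3 + a" using \<Phi>2 by (auto simp: \<Phi>_def)
    have e1: "n1 \<bullet> v1 = c1 + 1" "n2 \<bullet> v1 = c2 + b" "n3 \<bullet> v1 = c3 + c" using \<Phi>1 by (auto simp: \<Phi>_def)
    show ?thesis
      by (simp add: w \<Phi>_def \<Psi>_def K_def inner_add_right inner_diff_right inner_scaleR_right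
          e0 e1 e2 e3)
  qed
  have "inj K"
    by (rule injI) (metis \<Phi>\<Psi> \<Psi>_def)
  then have \<Psi>: "affine_embedding \<Psi>"
    unfolding affine_embedding_def \<Psi>_def using linK by blast
  have \<Psi>\<Phi>: "\<Psi> (\<Phi> v) = v" for v
  proof -
    have "surj K" using linK \<open>inj K\<close> by (rule linear_inj_imp_surj)
    then obtain w where "v - v0 = K w" by (metis surjD)
    then have "v = \<Psi> w" unfolding \<Psi>_def by (metis diff_add_cancel add.commute)
    then show ?thesis by (simp add: \<Phi>\<Psi>)
  qed
  define g where "g = g0 \<circ> \<Psi>"
  have "lattice_chart g"
    unfolding lattice_chart_def
  proof (intro conjI allI)
    show "affine_embedding g" unfolding g_def by (rule affine_embedding_comp[OF g0(1) \<Psi>])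
    fix w :: real3
    obtain x y z where w: "w = (x, y, z)" by (cases w)
    show "g w \<in> int_points \<longleftrightarrow> w \<in> int3"
    proof
      assume "g w \<in> int_points"
      then show "w \<in> int3" using \<Phi>int[of "\<Psi> w"] by (simp add: g_def \<Phi>\<Psi>)
    next
      assume "w \<in> int3"
      then have xyz: "x \<in> \<int>" "y \<in> \<int>" "z \<in> \<int>" by (simp_all add: w)
      obtain p h where h: "linear h" "\<And>v. g0 v = p + h v"
        by (rule affine_embeddingE[OF g0(1)]) blast
      have "g w = g0 v0 + (x *\<^sub>R (g0 v1 - g0 v0) + (y - b * x) *\<^sub>R (g0 v2 - g0 v0)
        + (z - c * x - a * (y - b * x)) *\<^sub>R (g0 v3 - g0 v0))"
        by (simp add: g_def \<Psi>_def K_def w h linear_add[OF h(1)] linear_diff[OF h(1)] linear_scale[OF h(1)])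
      also have "\<dots> \<in> int_points"
        using v S1int xyz abc
        by (intro int_points_add int_points_scale int_points_diff Ints_diff Ints_mult) auto
      finally show "g w \<in> int_points" .
    qed
  qed
  moreover have "\<Phi> ` S1 \<subseteq> unit_cube_points" using \<Phi>cube by blast
  moreover have "P = g ` (convex hull (\<Phi> ` S1))"
  proof -
    have "g ` (convex hull (\<Phi> ` S1)) = g0 ` (convex hull (\<Psi> ` \<Phi> ` S1))"
      unfolding g_def image_comp[symmetric] affine_embedding_image_convex_hull[OF \<Psi>] ..
    then show ?thesis by (simp add: image_image \<Psi>\<Phi> P C_def)
  qed
  moreover have "{(0, 0, 0), (0, 0, 1), (0, 1, a), (1, b, c)} \<subseteq> \<Phi> ` S1"
    using v \<Phi>0 \<Phi>1 \<Phi>2 \<Phi>3 by (metis (no_types, lifting) image_eqI insert_subset empty_subsetI)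
  ultimately show ?thesis by (rule that)
qed

section \<open>Symmetries and truncated corners of the cube\<close>

definition cube_model :: "('i \<Rightarrow>\<^sub>0 real) set \<Rightarrow> real3 set \<Rightarrow> bool" where
  "cube_model P S \<longleftrightarrow> S \<subseteq> unit_cube_points \<and> (\<exists>g. lattice_chart g \<and> P = g ` (convex hull S))"

lemma cube_model_vimage:
  assumes "cube_model P S" "unimodular u" "u -` S \<subseteq> unit_cube_points"
  shows "cube_model P (u -` S)"
proof -
  obtain g where g: "lattice_chart g" "P = g ` (convex hull S)"
    using assms(1) unfolding cube_model_def by blast
  have "affine_embedding u" using assms(2) by (simp add: unimodular_def)
  then have "u ` (convex hull (u -` S)) = convex hull S"
    by (simp add: affine_embedding_image_convex_hull surj_image_vimage_eq unimodular_surj[OF assms(2)])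
  then have "P = (g \<circ> u) ` (convex hull (u -` S))"
    unfolding image_comp[symmetric] g(2) by simp
  then show ?thesis
    unfolding cube_model_def using assms(3) lattice_chart_comp[OF g(1) assms(2)] by blast
qed

text \<open>
  For \<open>i\<close>, \<open>j\<close>, \<open>k\<close> in \<open>{0, 1}\<close> this is the involution of the cube that exchanges the origin with the vertex
  \<open>(i, j, k)\<close>.
\<close>

definition cube_flip :: "real \<Rightarrow> real \<Rightarrow> real \<Rightarrow> real3 \<Rightarrow> real3" where
  "cube_flip i j k = (\<lambda>(x, y, z). (i + (1 - 2 * i) * x, j + (1 - 2 * j) * y, k + (1 - 2 * k) * z))"

definition swap_xy :: "real3 \<Rightarrow> real3" where "swap_xy = (\<lambda>(x, y, z). (y, x, z))"
definition swap_yz :: "real3 \<Rightarrow> real3" where "swap_yz = (\<lambda>(x, y, z). (x, z, y))"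

lemma unimodular_cube_flip:
  assumes "i \<in> {0, 1}" "j \<in> {0, 1}" "k \<in> {0, 1}"
  shows "unimodular (cube_flip i j k)"
proof (rule unimodularI[where w = "cube_flip i j k"])
  show "linear (\<lambda>v. cube_flip i j k v - cube_flip i j k 0)"
    by (rule linearI) (auto simp: cube_flip_def zero_prod_def algebra_simps)
qed (use assms in \<open>auto simp: cube_flip_def\<close>)

lemma unimodular_swap_xy: "unimodular swap_xy"
proof (rule unimodularI[where w = swap_xy])
  show "linear (\<lambda>v. swap_xy v - swap_xy 0)"
    by (rule linearI) (simp_all add: swap_xy_def case_prod_unfold)
qed (auto simp: swap_xy_def)

lemma unimodular_swap_yz: "unimodular swap_yz"
proof (rule unimodularI[where w = swap_yz])
  show "linear (\<lambda>v. swap_yz v - swap_yz 0)"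
    by (rule linearI) (simp_all add: swap_yz_def case_prod_unfold)
qed (auto simp: swap_yz_def)

lemma cube_model_flip:
  assumes "cube_model P S" "i \<in> {0, 1}" "j \<in> {0, 1}" "k \<in> {0, 1}"
  shows "cube_model P (cube_flip i j k -` S)"
proof (rule cube_model_vimage[OF assms(1) unimodular_cube_flip[OF assms(2-4)]])
  have flip: "cube_flip i j k v \<in> unit_cube_points" if "v \<in> unit_cube_points" for v
    using that assms(2-4) by (elim SigmaE insertE emptyE) (simp_all add: cube_flip_def)
  have "cube_flip i j k (cube_flip i j k v) = v" for v
    using assms(2-4) by (cases v) (elim insertE emptyE, simp_all add: cube_flip_def)
  then have "v \<in> unit_cube_points" if "cube_flip i j k v \<in> unit_cube_points" for v
    using flip[OF that] by simp
  then show "cube_flip i j k -` S \<subseteq> unit_cube_points"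
    using assms(1) unfolding cube_model_def by blast
qed

lemma cube_model_swap_xy:
  assumes "cube_model P S" shows "cube_model P (swap_xy -` S)"
proof (rule cube_model_vimage[OF assms unimodular_swap_xy])
  have "v \<in> unit_cube_points" if "swap_xy v \<in> unit_cube_points" for v
    using that by (cases v) (auto simp: swap_xy_def)
  then show "swap_xy -` S \<subseteq> unit_cube_points"
    using assms unfolding cube_model_def by blast
qed

lemma cube_model_swap_yz:
  assumes "cube_model P S" shows "cube_model P (swap_yz -` S)"
proof (rule cube_model_vimage[OF assms unimodular_swap_yz])
  have "v \<in> unit_cube_points" if "swap_yz v \<in> unit_cube_points" for v
    using that by (cases v) (auto simp: swap_yz_def)
  then show "swap_yz -` S \<subseteq> unit_cube_points"
    using assms unfolding cube_model_def by blast
qed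

lemma cube_model_aff_dim:
  assumes "cube_model P S" "polytope_dim P = 3"
  shows "aff_dim (convex hull S) = 3"
  using assms polytope_dim_image lattice_chartD(1) unfolding cube_model_def by metis

lemma affine_span_corner_plane:
  assumes "{(1, 0, 0), (0, 1, 0), (0, 0, 1)} \<subseteq> (T :: real3 set)" "T \<subseteq> {v. (1, 1, 1) \<bullet> v = 1}"
  shows "affine hull T = {v. (1, 1, 1) \<bullet> v = 1}"
proof
  show "affine hull T \<subseteq> {v. (1, 1, 1) \<bullet> v = 1}"
    using assms(2) by (simp add: hull_minimal affine_hyperplane)
  show "{v. (1, 1, 1) \<bullet> v = 1} \<subseteq> affine hull T"
  proof
    fix v :: real3 assume "v \<in> {v. (1, 1, 1) \<bullet> v = 1}"
    then obtain x y z where v: "v = (x, y, z)" "x + y + z = 1" by (cases v) (auto simp: add.assoc)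
    have "v = x *\<^sub>R (1, 0, 0) + y *\<^sub>R (0, 1, 0) + z *\<^sub>R (0, 0, 1)" by (simp add: v)
    then have "v \<in> affine hull {(1, 0, 0), (0, 1, 0), (0, 0, 1)}"
      unfolding affine_hull_3 using v(2) by blast
    then show "v \<in> affine hull T" using assms(1) hull_mono by blast
  qed
qed

text \<open>
  Cutting off the origin produces the facet \<open>x + y + z = 1\<close>. A functional that vanishes on it is a multiple
  \<open>m (x + y + z - 1)\<close>. Integrality at the origin makes \<open>m\<close> an integer, and then the value \<open>2 m\<close> at
  \<open>(1, 1, 1)\<close> lies between \<open>0\<close> and \<open>1\<close> only for \<open>m = 0\<close>.
\<close>

lemma no_truncated_corner_at_origin:
  assumes model: "cube_model P S" and comp: "compressed P" and dimP: "polytope_dim P = 3"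
    and nb: "(1, 0, 0) \<in> S" "(0, 1, 0) \<in> S" "(0, 0, 1) \<in> S" and missing: "(0, 0, 0) \<notin> S"
  shows "(1, 1, 1) \<notin> S"
proof
  assume far: "(1, 1, 1) \<in> S"
  obtain g where g: "lattice_chart g" "P = g ` (convex hull S)" and cube: "S \<subseteq> unit_cube_points"
    using model unfolding cube_model_def by blast
  define T where "T = convex hull S \<inter> {v. (1, 1, 1) \<bullet> v = 1}"
  have "S \<subseteq> {v. (1, 1, 1) \<bullet> v \<ge> 1}"
  proof
    fix v assume "v \<in> S"
    then have "v \<in> unit_cube_points" "v \<noteq> (0, 0, 0)" using cube missing by (blast, metis)
    then show "v \<in> {v. (1, 1, 1) \<bullet> v \<ge> 1}" by auto
  qed
  then have ge: "convex hull S \<subseteq> {v. (1, 1, 1) \<bullet> v \<ge> 1}"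
    by (rule hull_minimal) (rule convex_halfspace_ge)
  have T: "T face_of convex hull S"
    unfolding T_def by (rule face_of_Int_supporting_hyperplane_ge) (use ge in auto)
  have corner: "{(1, 0, 0), (0, 1, 0), (0, 0, 1)} \<subseteq> T"
    using nb by (auto simp: T_def hull_inc)
  have aT: "affine hull T = {v. (1, 1, 1) \<bullet> v = 1}"
    by (rule affine_span_corner_plane[OF corner]) (auto simp: T_def)
  moreover have "(1, 1, 1) \<noteq> (0 :: real3)" by (simp add: zero_prod_def)
  ultimately have "aff_dim T = int (DIM(real3) - 1)"
    unfolding aff_dim_eq_hyperplane by blast
  then have facet: "T facet_of convex hull S"
    using T corner cube_model_aff_dim[OF model dimP] by (auto simp: facet_of_def)
  have "finite S" using cube by (rule finite_subset) simp
  have "unit_cube_points \<subseteq> int3" by auto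
  then have gS: "g ` S \<subseteq> int_points"
    using cube lattice_chartD(3)[OF g(1)] by blast
  note width = facet_width_functional[OF lattice_chartD(1)[OF g(1)] comp[unfolded g(2)] refl
      \<open>finite S\<close> gS cube_model_aff_dim[OF model dimP] facet]
  obtain n c where n: "affine hull T = {v. n \<bullet> v = c}" "n \<noteq> 0"
    and bound: "\<And>v. v \<in> convex hull S \<Longrightarrow> c \<le> n \<bullet> v \<and> n \<bullet> v \<le> c + 1"
    and int: "\<And>v. g v \<in> int_points \<Longrightarrow> n \<bullet> v - c \<in> \<int>"
    using width by blast
  obtain n1 n2 n3 where nn: "n = (n1, n2, n3)" by (cases n)
  have "{(1, 0, 0), (0, 1, 0), (0, 0, 1)} \<subseteq> {v. n \<bullet> v = c}"
    using corner hull_subset[of T affine] unfolding n(1) by blast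
  then have ns: "n1 = c" "n2 = c" "n3 = c" by (simp_all add: nn)
  have "c \<in> \<int>"
    using int[of "(0, 0, 0)"] lattice_chartD(3)[OF g(1)] by (simp add: nn)
  moreover have "0 \<le> c" "2 * c \<le> 1"
    using bound[of "(1, 1, 1)"] far by (simp_all add: nn ns hull_inc)
  ultimately have "c = 0" using int_unit_interval[of c] by force
  then show False using n(2) by (simp add: nn ns zero_prod_def)
qed

lemma no_truncated_corner:
  assumes model: "cube_model P S" and comp: "compressed P" and dimP: "polytope_dim P = 3"
    and ijk: "i \<in> {0, 1}" "j \<in> {0, 1}" "k \<in> {0, 1}"
    and "(1 - i, j, k) \<in> S" "(i, 1 - j, k) \<in> S" "(i, j, 1 - k) \<in> S" "(i, j, k) \<notin> S"
  shows "(1 - i, 1 - j, 1 - k) \<notin> S"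
proof -
  have "cube_flip i j k (x, y, z) \<in> S \<longleftrightarrow> (x, y, z) \<in> cube_flip i j k -` S" for x y z by simp
  moreover have "cube_flip i j k (1, 0, 0) = (1 - i, j, k)" "cube_flip i j k (0, 1, 0) = (i, 1 - j, k)"
    "cube_flip i j k (0, 0, 1) = (i, j, 1 - k)" "cube_flip i j k (0, 0, 0) = (i, j, k)"
    "cube_flip i j k (1, 1, 1) = (1 - i, 1 - j, 1 - k)"
    by (simp_all add: cube_flip_def)
  ultimately show ?thesis
    using no_truncated_corner_at_origin[OF cube_model_flip[OF model ijk] comp dimP] assms(7-10)
    by metis
qed

lemma cube_model_equiv:
  assumes model: "cube_model P S" and dimP: "polytope_dim P = 3" and "unimodular u" "u ` V = S"
  shows "P \<cong>\<^sub>p pt3_chart ` (convex hull V)"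
proof -
  obtain g where g: "lattice_chart g" "P = g ` (convex hull S)"
    using model unfolding cube_model_def by blast
  have "affine_embedding u" using assms(3) by (simp add: unimodular_def)
  then have u: "u ` (convex hull V) = convex hull S"
    by (simp add: affine_embedding_image_convex_hull assms(4))
  have P: "P = (g \<circ> u) ` (convex hull V)"
    unfolding image_comp[symmetric] u g(2) ..
  have chart: "lattice_chart (g \<circ> u)" by (rule lattice_chart_comp[OF g(1) assms(3)])
  have "aff_dim (convex hull V) = 3"
    using polytope_dim_image[OF lattice_chartD(1)[OF chart], of "convex hull V"] P dimP by simp
  then have "affine hull (convex hull V) = UNIV" using aff_dim_eq_full[of "convex hull V"] by simp
  then show ?thesis unfolding P by (rule lattice_chart_equiv[OF chart lattice_chart_pt3])
qed

lemma cube_model_subset: "cube_model P S \<Longrightarrow> S \<subseteq> unit_cube_points"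
  by (simp add: cube_model_def)

lemma cube_model_cases:
  assumes "cube_model P S" "(x, y, z) \<in> S"
  shows "(x = 0 \<or> x = 1) \<and> (y = 0 \<or> y = 1) \<and> (z = 0 \<or> z = 1)"
  using assms by (auto simp: cube_model_def)

lemma unit_cube_set_eqI:
  assumes "S \<subseteq> unit_cube_points" "T \<subseteq> unit_cube_points"
    and "(0, 0, 0) \<in> S \<longleftrightarrow> (0, 0, 0) \<in> T" "(0, 0, 1) \<in> S \<longleftrightarrow> (0, 0, 1) \<in> T"
    and "(0, 1, 0) \<in> S \<longleftrightarrow> (0, 1, 0) \<in> T" "(0, 1, 1) \<in> S \<longleftrightarrow> (0, 1, 1) \<in> T"
    and "(1, 0, 0) \<in> S \<longleftrightarrow> (1, 0, 0) \<in> T" "(1, 0, 1) \<in> S \<longleftrightarrow> (1, 0, 1) \<in> T"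
    and "(1, 1, 0) \<in> S \<longleftrightarrow> (1, 1, 0) \<in> T" "(1, 1, 1) \<in> S \<longleftrightarrow> (1, 1, 1) \<in> T"
  shows "S = T"
proof -
  have "v \<in> S \<longleftrightarrow> v \<in> T" if "v \<in> unit_cube_points" for v
    using that assms(3-10) by (elim SigmaE insertE emptyE) (simp_all only: prod.inject)
  then show ?thesis using assms(1,2) by blast
qed

lemma cube_model_not_planar:
  assumes "cube_model P S" "polytope_dim P = 3" "n \<noteq> 0"
  shows "\<not> S \<subseteq> {v. n \<bullet> v = c}"
proof
  assume "S \<subseteq> {v. n \<bullet> v = c}"
  then have "aff_dim S \<le> aff_dim {v. n \<bullet> v = c}" by (rule aff_dim_subset)
  also have "\<dots> = 2" using aff_dim_hyperplane[OF assms(3), of c] by simp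
  finally have "aff_dim S \<le> 2" .
  then show False using cube_model_aff_dim[OF assms(1,2)] aff_dim_convex_hull[of S] by linarith
qed

section \<open>Classification of the vertex sets\<close>

text \<open>
  The conclusion of the classification, in terms of vertex sets; the three convex hulls turn out to be the
  polytopes given by inequalities.
\<close>

definition classified :: "('i \<Rightarrow>\<^sub>0 real) set \<Rightarrow> bool" where
  "classified P \<longleftrightarrow> P \<cong>\<^sub>p pt3_chart ` (convex hull vertices_Ia) \<or>
     P \<cong>\<^sub>p pt3_chart ` (convex hull vertices_IIc) \<or> P \<cong>\<^sub>p pt3_chart ` (convex hull vertices_Ib)"

lemma classified_simplex:
  assumes model: "cube_model P S" and dimP: "polytope_dim P = 3"
    and S: "S = {(0, 0, 0), (0, 0, 1), (0, 1, a), (1, b, c)}"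
  shows "classified P"
proof -
  define u :: "real3 \<Rightarrow> real3" where "u = (\<lambda>(x, y, z). (x, y + b * x, z + a * y + c * x))"
  have abc: "a \<in> \<int>" "b \<in> \<int>" "c \<in> \<int>"
    using cube_model_cases[OF model, of 0 1 a] cube_model_cases[OF model, of 1 b c] S by auto
  have "unimodular u"
  proof (rule unimodularI[where w = "\<lambda>(x, y, z). (x, y - b * x, z - a * (y - b * x) - c * x)"])
    show "linear (\<lambda>v. u v - u 0)"
      by (rule linearI) (auto simp: u_def zero_prod_def algebra_simps)
  qed (use abc in \<open>auto simp: u_def\<close>)
  moreover have "u ` vertices_Ia = S" by (auto simp: u_def vertices_Ia_def S)
  ultimately show ?thesis unfolding classified_def using cube_model_equiv[OF model dimP] by blast
qed

lemma classified_pyramid_over_face: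
  assumes model: "cube_model P S" and dimP: "polytope_dim P = 3"
    and S: "S = {(0, 0, 0), (0, 1, 0), (1, 0, 0), (1, 1, 0), (i, j, 1)}"
  shows "classified P"
proof -
  define u :: "real3 \<Rightarrow> real3" where "u = (\<lambda>(x, y, z). (x + i * y, z + j * y, y))"
  have ij: "i \<in> \<int>" "j \<in> \<int>"
    using cube_model_cases[OF model, of i j 1] S by auto
  have "unimodular u"
  proof (rule unimodularI[where w = "\<lambda>(x, y, z). (x - i * z, z, y - j * z)"])
    show "linear (\<lambda>v. u v - u 0)"
      by (rule linearI) (auto simp: u_def zero_prod_def algebra_simps)
  qed (use ij in \<open>auto simp: u_def\<close>)
  moreover have "u ` vertices_IIc = S" by (auto simp: u_def vertices_IIc_def S)
  ultimately show ?thesis unfolding classified_def using cube_model_equiv[OF model dimP] by blast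
qed

lemma classified_pyramid_over_diagonal:
  assumes model: "cube_model P S" and dimP: "polytope_dim P = 3"
    and S: "S = {(0, 0, 0), (0, 0, 1), (1, 1, 0), (1, 1, 1), (1, 0, k)}"
  shows "classified P"
proof -
  define u :: "real3 \<Rightarrow> real3" where "u = (\<lambda>(x, y, z). (x + y, x, z + k * y))"
  have k: "k \<in> \<int>"
    using cube_model_cases[OF model, of 1 0 k] S by auto
  have "unimodular u"
  proof (rule unimodularI[where w = "\<lambda>(x, y, z). (y, x - y, z - k * (x - y))"])
    show "linear (\<lambda>v. u v - u 0)"
      by (rule linearI) (auto simp: u_def zero_prod_def algebra_simps)
  qed (use k in \<open>auto simp: u_def\<close>)
  moreover have "u ` vertices_IIc = S" by (auto simp: u_def vertices_IIc_def S)
  ultimately show ?thesis unfolding classified_def using cube_model_equiv[OF model dimP] by blast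
qed

lemma classified_octahedron:
  assumes model: "cube_model P S" and dimP: "polytope_dim P = 3"
    and S: "S = {(0, 0, 0), (0, 0, 1), (1, 1, 0), (1, 1, 1), (1, 0, 0), (0, 1, 1)}"
  shows "classified P"
proof -
  define u :: "real3 \<Rightarrow> real3" where "u = (\<lambda>(x, y, z). (x + y - z, y, z))"
  have "unimodular u"
  proof (rule unimodularI[where w = "\<lambda>(x, y, z). (x - y + z, y, z)"])
    show "linear (\<lambda>v. u v - u 0)"
      by (rule linearI) (auto simp: u_def zero_prod_def algebra_simps)
  qed (auto simp: u_def)
  moreover have "u ` vertices_Ib = S" by (auto simp: u_def vertices_Ib_def S)
  ultimately show ?thesis unfolding classified_def using cube_model_equiv[OF model dimP] by blast
qed

lemma cube_model_Times_not_prime: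
  assumes "cube_model P (A \<times> B)" "polytope_dim P = 3"
    and "A \<subseteq> {0, 1}" "B \<subseteq> {0, 1} \<times> {0, 1}"
  shows "\<not> prime_polytope P"
proof -
  obtain g where g: "lattice_chart g" "P = g ` (convex hull (A \<times> B))"
    using assms(1) unfolding cube_model_def by blast
  have "finite A" "finite B" using assms(3,4) by (auto intro: finite_subset)
  moreover have "A \<subseteq> \<int>" "B \<subseteq> \<int> \<times> \<int>" using assms(3,4) by auto
  ultimately show ?thesis
    using convex_hull_Times_not_prime[OF g assms(2)] by blast
qed

context
  fixes P :: "('i \<Rightarrow>\<^sub>0 real) set"
  assumes dimP: "polytope_dim P = 3" and comp: "compressed P" and prime: "prime_polytope P"
begin

text \<open>
  The vertices of \<open>S\<close> outside of the face \<open>z = 0\<close> form a single point, an edge, or the opposite face.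
  Diagonal pairs and triples would leave a truncated corner.
\<close>

lemma classified_face_z0:
  assumes model: "cube_model P S"
    and base: "(0, 0, 0) \<in> S" "(0, 1, 0) \<in> S" "(1, 0, 0) \<in> S" "(1, 1, 0) \<in> S"
  shows "classified P"
proof -
  note corner = no_truncated_corner[OF model comp dimP]
  note sub = cube_model_subset[OF model]
  note cases = cube_model_cases[OF model]
  have "(0, 0, 1) \<noteq> (0::real3)" by (simp add: zero_prod_def)
  from cube_model_not_planar[OF model dimP this, of 0]
  obtain v where "v \<in> S" "(0, 0, 1) \<bullet> v \<noteq> 0" by blast
  then obtain x y z where "(x, y, z) \<in> S" "z \<noteq> 0" by (cases v) auto
  then have top: "(0, 0, 1) \<in> S \<or> (0, 1, 1) \<in> S \<or> (1, 0, 1) \<in> S \<or> (1, 1, 1) \<in> S"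
    using cases[of x y z] by auto
  have opp: "(i, j, 1) \<in> S" if "i \<in> {0, 1}" "j \<in> {0, 1}" "(1 - i, j, 1) \<in> S" "(i, 1 - j, 1) \<in> S" for i j
  proof (rule ccontr)
    assume "(i, j, 1) \<notin> S"
    then have "(1 - i, 1 - j, 0) \<notin> S" using corner[of i j 1] that base by auto
    then show False using that(1,2) base by auto
  qed
  have opps: "(0, 1, 1) \<in> S \<Longrightarrow> (1, 0, 1) \<in> S \<Longrightarrow> (0, 0, 1) \<in> S \<and> (1, 1, 1) \<in> S"
    "(0, 0, 1) \<in> S \<Longrightarrow> (1, 1, 1) \<in> S \<Longrightarrow> (0, 1, 1) \<in> S \<and> (1, 0, 1) \<in> S"
    using opp[of 0 0] opp[of 0 1] opp[of 1 0] opp[of 1 1] by auto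
  have cube: "classified P" if "(0, 0, 1) \<in> S" "(0, 1, 1) \<in> S" "(1, 0, 1) \<in> S" "(1, 1, 1) \<in> S"
  proof -
    have S: "S = {0, 1} \<times> ({0, 1} \<times> {0, 1})"
      by (rule unit_cube_set_eqI[OF sub]) (use base that in auto)
    have "\<not> prime_polytope P"
      by (rule cube_model_Times_not_prime[OF model[unfolded S] dimP]) simp_all
    then show ?thesis using prime by contradiction
  qed
  have apex: "classified P" if "i = 0 \<or> i = 1" "j = 0 \<or> j = 1" "(i, j, 1) \<in> S"
    "(1 - i, j, 1) \<notin> S" "(i, 1 - j, 1) \<notin> S" "(1 - i, 1 - j, 1) \<notin> S" for i j
  proof -
    have "S = {(0, 0, 0), (0, 1, 0), (1, 0, 0), (1, 1, 0), (i, j, 1)}"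
      using that(1,2)
      by (elim disjE; intro unit_cube_set_eqI[OF sub]) (use base that(3-6) in simp_all)
    then show ?thesis by (rule classified_pyramid_over_face[OF model dimP])
  qed
  have edge_x: "classified P" if "j = 0 \<or> j = 1" "(0, j, 1) \<in> S" "(1, j, 1) \<in> S"
    "(0, 1 - j, 1) \<notin> S" "(1, 1 - j, 1) \<notin> S" for j
  proof -
    have S: "S = {0, 1} \<times> {(0, 0), (1, 0), (j, 1)}"
      by (rule unit_cube_set_eqI[OF sub]) (use base that in auto)
    have "\<not> prime_polytope P"
      by (rule cube_model_Times_not_prime[OF model[unfolded S] dimP]) (use that(1) in auto)
    then show ?thesis using prime by contradiction
  qed
  have edge_y: "classified P" if "i = 0 \<or> i = 1" "(i, 0, 1) \<in> S" "(i, 1, 1) \<in> S"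
    "(1 - i, 0, 1) \<notin> S" "(1 - i, 1, 1) \<notin> S" for i
  proof -
    note model' = cube_model_swap_xy[OF model]
    have S: "swap_xy -` S = {0, 1} \<times> {(0, 0), (1, 0), (i, 1)}"
      by (rule unit_cube_set_eqI[OF cube_model_subset[OF model']])
        (use base that in \<open>auto simp: swap_xy_def\<close>)
    have "\<not> prime_polytope P"
      by (rule cube_model_Times_not_prime[OF model'[unfolded S] dimP]) (use that(1) in auto)
    then show ?thesis using prime by contradiction
  qed
  show ?thesis
    using top opps cube apex[of 0 0, simplified] apex[of 0 1, simplified] apex[of 1 0, simplified]
      apex[of 1 1, simplified] edge_x[of 0, simplified] edge_x[of 1, simplified]
      edge_y[of 0, simplified] edge_y[of 1, simplified]
    by argo
qed

lemma classified_face_z: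
  assumes model: "cube_model P S" and k: "k \<in> {0, 1}"
    and base: "(0, 0, k) \<in> S" "(0, 1, k) \<in> S" "(1, 0, k) \<in> S" "(1, 1, k) \<in> S"
  shows "classified P"
  by (rule classified_face_z0[OF cube_model_flip[OF model, of 0 0 k]])
    (use k base in \<open>simp_all add: cube_flip_def\<close>)

lemma classified_face_y:
  assumes model: "cube_model P S" and k: "k \<in> {0, 1}"
    and base: "(0, k, 0) \<in> S" "(0, k, 1) \<in> S" "(1, k, 0) \<in> S" "(1, k, 1) \<in> S"
  shows "classified P"
  by (rule classified_face_z[OF cube_model_swap_yz[OF model] k])
    (use base in \<open>simp_all add: swap_yz_def\<close>)

lemma classified_face_x:
  assumes model: "cube_model P S" and k: "k \<in> {0, 1}"
    and base: "(k, 0, 0) \<in> S" "(k, 0, 1) \<in> S" "(k, 1, 0) \<in> S" "(k, 1, 1) \<in> S"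
  shows "classified P"
  by (rule classified_face_y[OF cube_model_swap_xy[OF model] k])
    (use base in \<open>simp_all add: swap_xy_def\<close>)

text \<open>
  On each side of the plane \<open>x = y\<close> there are two vertices of the cube. If \<open>S\<close> contains both vertices of one
  side, or vertices of both sides at the same height \<open>z\<close>, then it contains a face of the cube.
  Otherwise it has one vertex outside of the plane, or two antipodal ones.
\<close>

lemma classified_diagonal_xy0:
  assumes model: "cube_model P S"
    and base: "(0, 0, 0) \<in> S" "(0, 0, 1) \<in> S" "(1, 1, 0) \<in> S" "(1, 1, 1) \<in> S"
  shows "classified P"
proof -
  note cases = cube_model_cases[OF model]
  note sub = cube_model_subset[OF model]
  note model' = cube_model_swap_xy[OF model]
  have "(1, -1, 0) \<noteq> (0::real3)" by (simp add: zero_prod_def)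
  from cube_model_not_planar[OF model dimP this, of 0]
  obtain v where "v \<in> S" "(1, -1, 0) \<bullet> v \<noteq> 0" by blast
  then obtain x y z where "(x, y, z) \<in> S" "x \<noteq> y" by (cases v) auto
  then have off: "(0, 1, 0) \<in> S \<or> (0, 1, 1) \<in> S \<or> (1, 0, 0) \<in> S \<or> (1, 0, 1) \<in> S"
    using cases[of x y z] by auto
  consider (face) "((1, 0, 0) \<in> S \<and> (1, 0, 1) \<in> S) \<or> ((0, 1, 0) \<in> S \<and> (0, 1, 1) \<in> S) \<or>
      ((0, 1, 0) \<in> S \<and> (1, 0, 0) \<in> S) \<or> ((0, 1, 1) \<in> S \<and> (1, 0, 1) \<in> S)"
    | (pyr1) k where "(1, 0, k) \<in> S" "(1, 0, 1 - k) \<notin> S" "(0, 1, 0) \<notin> S" "(0, 1, 1) \<notin> S" "k = 0 \<or> k = 1"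
    | (pyr2) k where "(0, 1, k) \<in> S" "(0, 1, 1 - k) \<notin> S" "(1, 0, 0) \<notin> S" "(1, 0, 1) \<notin> S" "k = 0 \<or> k = 1"
    | (oct1) "(1, 0, 0) \<in> S" "(0, 1, 1) \<in> S" "(1, 0, 1) \<notin> S" "(0, 1, 0) \<notin> S"
    | (oct2) "(1, 0, 1) \<in> S" "(0, 1, 0) \<in> S" "(1, 0, 0) \<notin> S" "(0, 1, 1) \<notin> S"
    using off that(1) that(2)[of 0] that(2)[of 1] that(3)[of 0] that(3)[of 1] that(4,5)
    by (simp, argo)
  then show ?thesis
  proof cases
    case face
    then show ?thesis
      using base classified_face_x[OF model, of 1] classified_face_y[OF model, of 1]
        classified_face_x[OF model, of 0] classified_face_y[OF model, of 0]
        classified_face_z[OF model, of 0] classified_face_z[OF model, of 1] by auto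
  next
    case (pyr1 k)
    have "S = {(0, 0, 0), (0, 0, 1), (1, 1, 0), (1, 1, 1), (1, 0, k)}"
      by (rule unit_cube_set_eqI[OF sub]) (use base pyr1 in auto)
    then show ?thesis by (rule classified_pyramid_over_diagonal[OF model dimP])
  next
    case (pyr2 k)
    have "swap_xy -` S = {(0, 0, 0), (0, 0, 1), (1, 1, 0), (1, 1, 1), (1, 0, k)}"
      by (rule unit_cube_set_eqI[OF cube_model_subset[OF model']])
        (use base pyr2 in \<open>auto simp: swap_xy_def\<close>)
    then show ?thesis by (rule classified_pyramid_over_diagonal[OF model' dimP])
  next
    case oct1
    have "S = {(0, 0, 0), (0, 0, 1), (1, 1, 0), (1, 1, 1), (1, 0, 0), (0, 1, 1)}"
      by (rule unit_cube_set_eqI[OF sub]) (use base oct1 in auto)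
    then show ?thesis by (rule classified_octahedron[OF model dimP])
  next
    case oct2
    have "swap_xy -` S = {(0, 0, 0), (0, 0, 1), (1, 1, 0), (1, 1, 1), (1, 0, 0), (0, 1, 1)}"
      by (rule unit_cube_set_eqI[OF cube_model_subset[OF model']])
        (use base oct2 in \<open>auto simp: swap_xy_def\<close>)
    then show ?thesis by (rule classified_octahedron[OF model' dimP])
  qed
qed

lemma classified_diagonal_xy:
  assumes model: "cube_model P S" and i: "i \<in> {0, 1}"
    and base: "(i, 0, 0) \<in> S" "(i, 0, 1) \<in> S" "(1 - i, 1, 0) \<in> S" "(1 - i, 1, 1) \<in> S"
  shows "classified P"
  by (rule classified_diagonal_xy0[OF cube_model_flip[OF model, of i 0 0]])
    (use i base in \<open>simp_all add: cube_flip_def\<close>)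

lemma classified_diagonal_xz:
  assumes model: "cube_model P S" and i: "i \<in> {0, 1}"
    and base: "(i, 0, 0) \<in> S" "(i, 1, 0) \<in> S" "(1 - i, 0, 1) \<in> S" "(1 - i, 1, 1) \<in> S"
  shows "classified P"
  by (rule classified_diagonal_xy[OF cube_model_swap_yz[OF model] i])
    (use base in \<open>simp_all add: swap_yz_def\<close>)

lemma classified_diagonal_yz:
  assumes model: "cube_model P S" and i: "i \<in> {0, 1}"
    and base: "(0, i, 0) \<in> S" "(1, i, 0) \<in> S" "(0, 1 - i, 1) \<in> S" "(1, 1 - i, 1) \<in> S"
  shows "classified P"
  by (rule classified_diagonal_xz[OF cube_model_swap_xy[OF model] i])
    (use base in \<open>simp_all add: swap_xy_def\<close>)

text \<open>
  Without a rectangle in \<open>S\<close>, the face \<open>x = 0\<close> contains exactly three points of \<open>S\<close> and the face \<open>x = 1\<close>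
  exactly one: any two points of the latter span a rectangle with two of the three, or leave a truncated
  corner.
\<close>

lemma prime_compressed_classified:
  assumes lat: "lattice_polytope P"
  shows "classified P"
proof (rule ccontr)
  assume nc: "\<not> classified P"
  obtain g S a b c where "lattice_chart g" "S \<subseteq> unit_cube_points" "P = g ` (convex hull S)"
    and simplex: "{(0, 0, 0), (0, 0, 1), (0, 1, a), (1, b, c)} \<subseteq> S"
    using compressed_unit_cube_chart[OF lat dimP comp] .
  then have model: "cube_model P S" unfolding cube_model_def by blast
  note sub = cube_model_subset[OF model]
  have abc: "a = 0 \<or> a = 1" "b = 0 \<or> b = 1" "c = 0 \<or> c = 1"
    using cube_model_cases[OF model, of 0 1 a] cube_model_cases[OF model, of 1 b c] simplex by auto
  have mem: "(0, 0, 0) \<in> S" "(0, 0, 1) \<in> S" "(0, 1, a) \<in> S" "(1, b, c) \<in> S"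
    using simplex by auto
  have third: "(0, 1, 0) \<in> S \<or> (0, 1, 1) \<in> S" using mem(3) abc(1) by auto
  have no_x0: "(0, 1, 0) \<notin> S \<or> (0, 1, 1) \<notin> S"
    using classified_face_x[OF model, of 0] mem(1,2) nc by auto
  have "(1, 0, 0) \<notin> S \<or> (1, 0, 1) \<notin> S"
    using classified_face_y[OF model, of 0] mem(1,2) nc by auto
  moreover have "(1, 1, 0) \<notin> S \<or> (1, 1, 1) \<notin> S"
    using classified_diagonal_xy[OF model, of 0] mem(1,2) nc by auto
  moreover have "(1, 0, 0) \<notin> S \<or> (1, 1, 0) \<notin> S"
    using classified_face_z[OF model, of 0] classified_diagonal_xz[OF model, of 1] mem(1,2) third nc
    by auto
  moreover have "(1, 0, 1) \<notin> S \<or> (1, 1, 1) \<notin> S"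
    using classified_face_z[OF model, of 1] classified_diagonal_xz[OF model, of 0] mem(1,2) third nc
    by auto
  moreover have "(1, 0, 0) \<notin> S \<or> (1, 1, 1) \<notin> S"
    using no_truncated_corner[OF model comp dimP, of 0 1 1] classified_diagonal_yz[OF model, of 0]
      mem(1,2) third no_x0 nc by auto
  moreover have "(1, 0, 1) \<notin> S \<or> (1, 1, 0) \<notin> S"
    using no_truncated_corner[OF model comp dimP, of 0 1 0] classified_diagonal_yz[OF model, of 1]
      mem(1,2) third no_x0 nc by auto
  ultimately have others: "(0, 1, 1 - a) \<notin> S" "(1, b, 1 - c) \<notin> S" "(1, 1 - b, c) \<notin> S"
    "(1, 1 - b, 1 - c) \<notin> S"
    using abc mem no_x0 by auto
  have "S = {(0, 0, 0), (0, 0, 1), (0, 1, a), (1, b, c)}"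
    using abc by (elim disjE; intro unit_cube_set_eqI[OF sub]) (use mem others in simp_all)
  then show False using classified_simplex[OF model dimP] nc by blast
qed

end

section \<open>Polytopes cut out by unimodular inequalities\<close>

definition halfspaces :: "'a set \<Rightarrow> ('a \<Rightarrow> real3) \<Rightarrow> ('a \<Rightarrow> real) \<Rightarrow> real3 set" where
  "halfspaces A n d = {v. \<forall>a\<in>A. 0 \<le> n a \<bullet> v + d a}"

lemma convex_halfspaces: "convex (halfspaces A n d)"
proof -
  have "halfspaces A n d = (\<Inter>a\<in>A. {v. n a \<bullet> v \<ge> - d a})"
    by (auto simp: halfspaces_def) (smt (verit))+
  then show ?thesis by (simp add: convex_INT convex_halfspace_ge)
qed

lemma open_strict_halfspaces:
  assumes "finite A"
  shows "open {v. \<forall>a\<in>A. 0 < n a \<bullet> v + d a}"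
proof -
  have "{v. \<forall>a\<in>A. 0 < n a \<bullet> v + d a} = (\<Inter>a\<in>A. {v. n a \<bullet> v > - d a})"
    by (auto simp: algebra_simps) (smt (verit))+
  then show ?thesis using assms by (simp add: open_INT open_halfspace_gt)
qed

text \<open>
  If no inequality were tight on the whole facet, then averaging points of the facet would produce a point
  of the facet in the interior of the polytope.
\<close>

lemma facet_of_halfspaces:
  assumes fin: "finite A" and T: "T facet_of halfspaces A n d"
    and full: "aff_dim (halfspaces A n d) = 3"
  obtains a where "a \<in> A" "T \<subseteq> {v. n a \<bullet> v = - d a}"
proof (rule ccontr)
  assume "\<not> thesis"
  then have no: "\<And>a. a \<in> A \<Longrightarrow> \<exists>v\<in>T. n a \<bullet> v \<noteq> - d a" using that by blast
  let ?C = "halfspaces A n d"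
  have Tf: "T face_of ?C" and "T \<noteq> {}" and dT: "aff_dim T = 2"
    using T full by (auto simp: facet_of_def)
  have convT: "convex T" and TC: "T \<subseteq> ?C"
    using Tf face_of_imp_convex face_of_imp_subset by blast+
  have "\<exists>v\<in>T. \<forall>a\<in>B. 0 < n a \<bullet> v + d a" if "B \<subseteq> A" for B
    using finite_subset[OF that fin] that
  proof (induction B)
    case empty
    then show ?case using \<open>T \<noteq> {}\<close> by blast
  next
    case (insert b B)
    then obtain v where v: "v \<in> T" "\<forall>a\<in>B. 0 < n a \<bullet> v + d a" by auto
    obtain w where w: "w \<in> T" "n b \<bullet> w \<noteq> - d b" using no insert.prems by blast
    define u where "u = (1/2) *\<^sub>R v + (1/2) *\<^sub>R w"
    have "u \<in> T" unfolding u_def using convexD[OF convT v(1) w(1)] by simp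
    have ge: "0 \<le> n a \<bullet> v + d a" "0 \<le> n a \<bullet> w + d a" if "a \<in> A" for a
      using TC v(1) w(1) that by (auto simp: halfspaces_def)
    have eq: "n a \<bullet> u + d a = (1/2) * (n a \<bullet> v + d a) + (1/2) * (n a \<bullet> w + d a)" for a
      by (simp add: u_def inner_add_right field_simps)
    have "0 < n a \<bullet> u + d a" if "a \<in> insert b B" for a
    proof (cases "a = b")
      case True
      have "0 < n b \<bullet> w + d b" using ge(2)[of b] w(2) insert.prems by force
      moreover have "0 \<le> n b \<bullet> v + d b" using ge(1)[of b] insert.prems by blast
      moreover have "0 < (1/2) * r + (1/2) * s" if "0 < s" "0 \<le> r" for r s :: real
        using that by simp
      ultimately show ?thesis unfolding eq True by blast
    next
      case False
      then have "a \<in> B" "a \<in> A" using that insert.prems by auto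
      then show ?thesis using v(2) ge(2)[of a] unfolding eq by (simp add: add_pos_nonneg)
    qed
    then show ?case using \<open>u \<in> T\<close> by blast
  qed
  then obtain v where v: "v \<in> T" "v \<in> {v. \<forall>a\<in>A. 0 < n a \<bullet> v + d a}" by blast
  have "{v. \<forall>a\<in>A. 0 < n a \<bullet> v + d a} \<subseteq> ?C" by (auto simp: halfspaces_def less_imp_le)
  then have "v \<in> interior ?C"
    by (rule interiorI[OF open_strict_halfspaces[OF fin] v(2)])
  moreover have "T \<noteq> ?C" using dT full by auto
  ultimately show False
    using face_of_disjoint_interior[OF Tf \<open>T \<noteq> ?C\<close>] v(1) by blast
qed

text \<open>
  The condition that makes parallel planes at integral levels lattice planes.
\<close>

definition unit_coeffs :: "real3 \<Rightarrow> bool" where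
  "unit_coeffs n \<longleftrightarrow> n \<in> {-1, 0, 1} \<times> {-1, 0, 1} \<times> {-1, 0, 1} \<and> n \<noteq> 0"

lemma affine_hull_3I:
  assumes "p \<in> S" "q \<in> S" "r \<in> S" "u + v + w = 1"
  shows "u *\<^sub>R p + v *\<^sub>R q + w *\<^sub>R r \<in> affine hull S"
proof -
  have "u *\<^sub>R p + v *\<^sub>R q + w *\<^sub>R r \<in> affine hull {p, q, r}"
    unfolding affine_hull_3 using assms(4) by blast
  then show ?thesis using assms(1-3) hull_mono[of "{p, q, r}" S affine] by blast
qed

text \<open>
  One coefficient is \<open>1\<close> or \<open>-1\<close>, so the equation can be solved for the corresponding coordinate over the
  integers; the other two coordinates are free.
\<close>

lemma affine_hull_lattice_plane:
  assumes n: "unit_coeffs n" and c: "c \<in> \<int>"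
  shows "affine hull ({v. n \<bullet> v = c} \<inter> int3) = {v. n \<bullet> v = c}"
proof
  show "affine hull ({v. n \<bullet> v = c} \<inter> int3) \<subseteq> {v. n \<bullet> v = c}"
    by (rule hull_minimal) (auto simp: affine_hyperplane)
  show "{v. n \<bullet> v = c} \<subseteq> affine hull ({v. n \<bullet> v = c} \<inter> int3)"
  proof
    fix v assume v: "v \<in> {v. n \<bullet> v = c}"
    obtain a b e where abe: "n = (a, b, e)" by (cases n)
    obtain x y z where xyz: "v = (x, y, z)" by (cases v)
    have sq: "t * t = 1" if "t \<in> {-1, 0, 1}" "t \<noteq> 0" for t :: real using that by auto
    have mem: "a \<in> {-1, 0, 1}" "b \<in> {-1, 0, 1}" "e \<in> {-1, 0, 1}" and "a \<noteq> 0 \<or> b \<noteq> 0 \<or> e \<noteq> 0"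
      using n unfolding unit_coeffs_def abe by (auto simp: zero_prod_def)
    have int: "a \<in> \<int>" "b \<in> \<int>" "e \<in> \<int>" using mem by auto
    have eq: "a * x + b * y + e * z = c" using v by (simp add: abe xyz)
    consider (a) "a * a = 1" | (b) "b * b = 1" | (e) "e * e = 1"
      using \<open>a \<noteq> 0 \<or> b \<noteq> 0 \<or> e \<noteq> 0\<close> mem sq by blast
    then show "v \<in> affine hull ({v. n \<bullet> v = c} \<inter> int3)"
    proof cases
      case a
      have x: "x = a * c - a * b * y - a * e * z"
        unfolding eq[symmetric] using a by (simp add: algebra_simps)
      have "v = (1 - y - z) *\<^sub>R (a * c, 0, 0) + y *\<^sub>R (a * c - a * b, 1, 0) + z *\<^sub>R (a * c - a * e, 0, 1)"
        unfolding xyz by (simp add: x algebra_simps)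
      also have "\<dots> \<in> affine hull ({v. n \<bullet> v = c} \<inter> int3)"
        using a int c by (intro affine_hull_3I) (auto simp: abe algebra_simps mult.assoc[symmetric])
      finally show ?thesis .
    next
      case b
      have y: "y = b * c - b * a * x - b * e * z"
        unfolding eq[symmetric] using b by (simp add: algebra_simps)
      have "v = (1 - x - z) *\<^sub>R (0, b * c, 0) + x *\<^sub>R (1, b * c - b * a, 0) + z *\<^sub>R (0, b * c - b * e, 1)"
        unfolding xyz by (simp add: y algebra_simps)
      also have "\<dots> \<in> affine hull ({v. n \<bullet> v = c} \<inter> int3)"
        using b int c by (intro affine_hull_3I) (auto simp: abe algebra_simps mult.assoc[symmetric])
      finally show ?thesis .
    next
      case e
      have z: "z = e * c - e * a * x - e * b * y"
        unfolding eq[symmetric] using e by (simp add: algebra_simps)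
      have "v = (1 - x - y) *\<^sub>R (0, 0, e * c) + x *\<^sub>R (1, 0, e * c - e * a) + y *\<^sub>R (0, 1, e * c - e * b)"
        unfolding xyz by (simp add: z algebra_simps)
      also have "\<dots> \<in> affine hull ({v. n \<bullet> v = c} \<inter> int3)"
        using e int c by (intro affine_hull_3I) (auto simp: abe algebra_simps mult.assoc[symmetric])
      finally show ?thesis .
    qed
  qed
qed

lemma inner_int3:
  assumes "unit_coeffs n" "v \<in> int3"
  shows "n \<bullet> v \<in> \<int>"
  using assms by (cases n; cases v) (auto simp: unit_coeffs_def)

lemma unit_coeffs_step:
  assumes "unit_coeffs n"
  obtains u where "n \<bullet> u = 1"
proof -
  have "n \<bullet> (n /\<^sub>R (n \<bullet> n)) = 1" using assms by (simp add: unit_coeffs_def)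
  then show ?thesis by (rule that)
qed

text \<open>
  The affine span of a facet is the zero plane of one of the functionals, and the plane of level \<open>1\<close> is a
  lattice plane. No lattice plane lies strictly between, because a functional with integral
  coefficients has an integral value at each lattice point.
\<close>

lemma compressed_halfspaces:
  assumes g: "lattice_chart g" and fin: "finite A" and n: "\<And>a. a \<in> A \<Longrightarrow> unit_coeffs (n a)"
    and d: "\<And>a. a \<in> A \<Longrightarrow> d a \<in> \<int>"
    and C: "C = halfspaces A n d" "C = convex hull S" "finite S" "S \<subseteq> int3" and full: "aff_dim C = 3"
    and width: "\<And>a v. a \<in> A \<Longrightarrow> v \<in> C \<Longrightarrow> n a \<bullet> v + d a \<le> 1"
  shows "compressed (g ` C)"
  unfolding compressed_def
proof (intro conjI allI impI)
  note gD = lattice_chartD[OF g]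
  show "lattice_polytope (g ` C)"
    unfolding C(2) by (rule lattice_polytope_chart_image[OF gD(1) C(3)]) (use C(4) gD(3) in blast)
  fix F assume F: "facet (g ` C) F"
  obtain p h where h: "linear h" "inj h" "\<And>v. g v = p + h v"
    by (rule affine_embeddingE[OF gD(1)]) blast
  have "F \<subseteq> g ` C" using F unfolding facet_def by (blast dest: face_of_imp_subset)
  then obtain T where T: "F = g ` T" by (metis subset_imageE)
  have facT: "T facet_of C" using F facet_image[OF gD(1)] unfolding T by blast
  then obtain a where a: "a \<in> A" "T \<subseteq> {v. n a \<bullet> v = - d a}"
    using facet_of_halfspaces[OF fin] full unfolding C(1) by metis
  have dT: "aff_dim T = 2" using facT full by (simp add: facet_of_def)
  have n0: "n a \<noteq> 0" using n[OF a(1)] by (simp add: unit_coeffs_def)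
  have aT: "affine hull T = {v. n a \<bullet> v = - d a}"
  proof -
    have "affine hull T \<subseteq> {v. n a \<bullet> v = - d a}"
      using a(2) by (simp add: hull_minimal affine_hyperplane)
    moreover have "aff_dim {v. n a \<bullet> v = - d a} = 2" using aff_dim_hyperplane[OF n0] by simp
    moreover have "T \<noteq> {}" using facT by (simp add: facet_of_def)
    ultimately show ?thesis
      by (intro affine_dim_equal affine_affine_hull affine_hyperplane)
        (simp_all add: dT aff_dim_affine_hull)
  qed
  have H: "affine hull F = g ` {v. n a \<bullet> v = - d a}"
    unfolding T affine_embedding_image_affine_hull[OF gD(1), symmetric] aT ..
  have range: "affine hull (g ` C) = range g"
    by (rule affine_hull_chart_image[OF gD(1)]) (use full aff_dim_eq_full[of C] in simp)
  obtain u where u: "n a \<bullet> u = 1" using unit_coeffs_step[OF n[OF a(1)]] .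
  note tr = translate_hyperplane_image[OF h(1,3)]
  let ?H = "affine hull F" and ?H' = "g ` {v. n a \<bullet> v = - d a + 1}"
  have slab_hull: "convex hull (?H \<union> ?H') = g ` {v. - d a \<le> n a \<bullet> v \<and> n a \<bullet> v \<le> - d a + 1}" (is "?L = g ` ?S")
  proof
    have "?H \<union> ?H' \<subseteq> g ` ?S" unfolding H by auto
    moreover have "convex (g ` ?S)"
    proof -
      have eq: "g ` ?S = convex hull (g ` ?S)"
        using affine_embedding_image_convex_hull[OF gD(1), of ?S]
        by (simp only: hull_same[of convex, OF slab_convex])
      show ?thesis by (subst eq) (rule convex_convex_hull)
    qed
    ultimately show "?L \<subseteq> g ` ?S" by (rule hull_minimal)
    show "g ` ?S \<subseteq> ?L"
    proof
      fix y assume "y \<in> g ` ?S"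
      then obtain v where v: "y = g v" "- d a \<le> n a \<bullet> v" "n a \<bullet> v \<le> - d a + 1" by blast
      define t where "t = n a \<bullet> v + d a"
      have "g (v - t *\<^sub>R u) \<in> ?L" "g (v + (1 - t) *\<^sub>R u) \<in> ?L"
        unfolding H by (auto intro!: hull_inc imageI simp: inner_diff_right inner_add_right u t_def)
      then have "(1 - t) *\<^sub>R g (v - t *\<^sub>R u) + t *\<^sub>R g (v + (1 - t) *\<^sub>R u) \<in> ?L"
        using v by (intro convexD[OF convex_convex_hull]) (auto simp: t_def)
      moreover have "(1 - t) *\<^sub>R g (v - t *\<^sub>R u) + t *\<^sub>R g (v + (1 - t) *\<^sub>R u)
          = g ((1 - t) *\<^sub>R (v - t *\<^sub>R u) + t *\<^sub>R (v + (1 - t) *\<^sub>R u))"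
        by (rule affine_embedding_comb[OF gD(1), symmetric]) simp
      moreover have "(1 - t) *\<^sub>R (v - t *\<^sub>R u) + t *\<^sub>R (v + (1 - t) *\<^sub>R u) = v"
        by (simp add: algebra_simps)
      ultimately show "y \<in> ?L" using v(1) by simp
    qed
  qed
  have par_iff: "\<exists>t. H'' = g ` {v. n a \<bullet> v = - d a + t} \<and> t \<in> \<int>"
    if H'': "parallel_lattice_hyperplane (g ` C) ?H H''" for H''
  proof -
    obtain w where w: "H'' = (+) w ` ?H" and sub: "H'' \<subseteq> range g" and lat: "affine hull (H'' \<inter> int_points) = H''"
      using H'' unfolding parallel_lattice_hyperplane_def range by blast
    (* A point on the hyperplane of the facet, used to read off the level of \<open>H''\<close>. *)
    let ?v0 = "(- d a) *\<^sub>R u"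
    have "g ?v0 \<in> ?H" unfolding H by (auto simp: u)
    then have ne: "w + g ?v0 \<in> H''" unfolding w by blast
    then obtain v1 where "w + g ?v0 = g v1" using sub by blast
    then have "w = h v1 - h ?v0" unfolding h(3) by (metis add.left_commute add_diff_cancel_right' add_left_cancel)
    then have "w = h (v1 - ?v0)" by (simp only: linear_diff[OF h(1)])
    then have H'': "H'' = g ` {v. n a \<bullet> v = - d a + n a \<bullet> (v1 - ?v0)}" (is "_ = g ` {v. _ = _ + ?t}")
      unfolding w H by (simp only: tr)
    have "H'' \<inter> int_points \<noteq> {}" using lat ne by auto
    then obtain v where v: "n a \<bullet> v = - d a + ?t" "g v \<in> int_points" unfolding H'' by blast
    have "n a \<bullet> v \<in> \<int>" using inner_int3[OF n[OF a(1)]] gD(3) v(2) by blast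
    then have "n a \<bullet> v + d a \<in> \<int>" using d[OF a(1)] by (rule Ints_add)
    then have "?t \<in> \<int>" unfolding v(1) by simp
    then show ?thesis using H'' by blast
  qed
  have par: "parallel_lattice_hyperplane (g ` C) ?H ?H'"
    unfolding parallel_lattice_hyperplane_def range
  proof (intro conjI exI)
    show "?H' = (+) (h u) ` ?H" unfolding H tr u ..
    show "?H' \<subseteq> range g" by blast
    have "?H' \<inter> int_points = g ` ({v. n a \<bullet> v = - d a + 1} \<inter> int3)" using gD(3) by blast
    moreover have "- d a + 1 \<in> \<int>" using d[OF a(1)] by simp
    ultimately show "affine hull (?H' \<inter> int_points) = ?H'"
      using affine_embedding_image_affine_hull[OF gD(1), of "{v. n a \<bullet> v = - d a + 1} \<inter> int3"]
        affine_hull_lattice_plane[OF n[OF a(1)]] by metis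
  qed
  have "?H' \<noteq> ?H"
  proof
    assume "?H' = ?H"
    then have "{v. n a \<bullet> v = - d a + 1} = {v. n a \<bullet> v = - d a}"
      unfolding H using gD(2) by (simp add: inj_image_eq_iff)
    moreover have "(- d a) *\<^sub>R u \<in> {v. n a \<bullet> v = - d a}" by (simp add: u)
    ultimately have "(- d a) *\<^sub>R u \<in> {v. n a \<bullet> v = - d a + 1}" by blast
    then show False by (simp add: u)
  qed
  moreover have "\<not> (\<exists>H''. parallel_lattice_hyperplane (g ` C) ?H H'' \<and> H'' \<noteq> ?H \<and> H'' \<noteq> ?H' \<and>
      H'' \<subseteq> convex hull (?H \<union> ?H'))"
  proof
    assume "\<exists>H''. parallel_lattice_hyperplane (g ` C) ?H H'' \<and> H'' \<noteq> ?H \<and> H'' \<noteq> ?H' \<and>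
      H'' \<subseteq> convex hull (?H \<union> ?H')"
    then obtain H'' where H'': "parallel_lattice_hyperplane (g ` C) ?H H''" "H'' \<noteq> ?H" "H'' \<noteq> ?H'"
      "H'' \<subseteq> g ` ?S" unfolding slab_hull by blast
    obtain t where t: "H'' = g ` {v. n a \<bullet> v = - d a + t}" "t \<in> \<int>"
      using par_iff[OF H''(1)] by blast
    have "(- d a + t) *\<^sub>R u \<in> {v. n a \<bullet> v = - d a + t}" by (simp add: u)
    then have "(- d a + t) *\<^sub>R u \<in> ?S"
      using H''(4) unfolding t(1) inj_image_subset_iff[OF gD(2)] by blast
    then have "0 \<le> t" "t \<le> 1" by (simp_all add: u)
    then have "t = 0 \<or> t = 1" using int_unit_interval[OF t(2)] by blast
    then show False using H''(2,3) unfolding t(1) H by auto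
  qed
  ultimately have nb: "neighbouring_lattice_hyperplane (g ` C) ?H ?H'"
    using par unfolding neighbouring_lattice_hyperplane_def by blast
  moreover have "g ` C \<subseteq> convex hull (?H \<union> ?H')"
    unfolding slab_hull
  proof (rule image_mono, rule subsetI)
    fix v assume v: "v \<in> C"
    then have "0 \<le> n a \<bullet> v + d a" using a(1) unfolding C(1) halfspaces_def by blast
    then show "v \<in> ?S" using width[OF a(1) v] by simp
  qed
  ultimately show "\<exists>H'. neighbouring_lattice_hyperplane (g ` C) ?H H' \<and> g ` C \<subseteq> convex hull (?H \<union> H')"
    by blast
qed

section \<open>Quivers with arrow polynomials\<close>

text \<open>
  The flow whose value at each arrow is the polynomial attached to that arrow.
\<close>

definition arrow_chart :: "('v, 'a) pre_digraph \<Rightarrow> ('a \<Rightarrow> real3) \<Rightarrow> ('a \<Rightarrow> real) \<Rightarrow> real3 \<Rightarrow> ('a \<Rightarrow>\<^sub>0 real)" where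
  "arrow_chart Q n d v = (\<Sum>a\<in>arcs Q. Poly_Mapping.single a (n a \<bullet> v + d a))"

lemma lookup_arrow_chart:
  assumes "finite (arcs Q)"
  shows "Poly_Mapping.lookup (arrow_chart Q n d v) a = (if a \<in> arcs Q then n a \<bullet> v + d a else 0)"
  using assms by (simp add: arrow_chart_def lookup_sum lookup_single when_def)

lemma arrow_chart_lattice_chart:
  assumes fin: "finite (arcs Q)"
    and int: "\<And>v. v \<in> int3 \<longleftrightarrow> (\<forall>a\<in>arcs Q. n a \<bullet> v + d a \<in> \<int>)"
    and inj: "\<And>v. (\<forall>a\<in>arcs Q. n a \<bullet> v = 0) \<Longrightarrow> v = 0"
  shows "lattice_chart (arrow_chart Q n d)"
proof -
  note l = lookup_arrow_chart[OF fin]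
  have lin: "linear (arrow_chart Q n (\<lambda>_. 0))"
    by (rule linearI; rule poly_mapping_eqI) (simp_all add: l lookup_add inner_add_right)
  have "v = 0" if "arrow_chart Q n (\<lambda>_. 0) v = 0" for v
  proof (rule inj, rule ballI)
    fix a assume "a \<in> arcs Q"
    then have "Poly_Mapping.lookup (arrow_chart Q n (\<lambda>_. 0) v) a = n a \<bullet> v" by (simp add: l)
    then show "n a \<bullet> v = 0" unfolding that by simp
  qed
  then have "inj (arrow_chart Q n (\<lambda>_. 0))" using linear_injective_0[OF lin] by blast
  then have "affine_embedding (arrow_chart Q n d)"
    by (rule affine_embeddingI[OF lin, where p = "arrow_chart Q n d 0"])
      (rule poly_mapping_eqI, simp add: l lookup_add)
  moreover have "arrow_chart Q n d v \<in> int_points \<longleftrightarrow> v \<in> int3" for v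
    unfolding int int_points_def mem_Collect_eq l by auto
  ultimately show ?thesis unfolding lattice_chart_def by blast
qed

text \<open>
  The numbering of the vertices is a topological order.
\<close>

lemma quiver_of_increasing_arrows:
  fixes Q :: "(nat, 'a) pre_digraph"
  assumes "finite (verts Q)" "finite (arcs Q)"
    and "\<And>a. a \<in> arcs Q \<Longrightarrow> tail Q a \<in> verts Q \<and> head Q a \<in> verts Q \<and> tail Q a < head Q a"
  shows "acyclic_quiver Q"
proof -
  have "fin_digraph Q" by unfold_locales (use assms in auto)
  moreover have "loopfree_digraph Q" by unfold_locales (use assms(3) in fastforce)+
  moreover have "arcs_ends Q \<subseteq> less_than"
    using assms(3) by (auto simp: arcs_ends_def arc_to_ends_def)
  then have "acyclic (arcs_ends Q)"
    using acyclic_subset wf_acyclic[OF wf_less_than] by blast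
  ultimately show ?thesis unfolding acyclic_quiver_def quiver_def by blast
qed

text \<open>
  The data common to the three polytopes. The polynomial of the arrow \<open>a\<close> is \<open>n a \<bullet> (x, y, z) + d a\<close>; the
  arrows \<open>ax\<close>, \<open>ay\<close>, \<open>az\<close> carry the coordinates themselves, so that a flow is determined by its values
  at these three arrows. At the interior point \<open>c\<close> all polynomials are positive, hence no arrow is
  removable. At the point \<open>w a\<close> only the polynomial of \<open>a\<close> is negative, hence \<open>a\<close> is not contractible.
\<close>

locale arrow_system =
  fixes Q :: "(nat, nat) pre_digraph" and \<theta> :: "nat \<Rightarrow> int"
    and n :: "nat \<Rightarrow> real3" and d :: "nat \<Rightarrow> real"
    and V :: "real3 set" and c :: real3 and w :: "nat \<Rightarrow> real3" and ax ay az :: nat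
  assumes acyc: "acyclic_quiver Q"
    and coeffs: "a \<in> arcs Q \<Longrightarrow> unit_coeffs (n a)" "a \<in> arcs Q \<Longrightarrow> d a \<in> \<int>"
    and coordinate_arrows: "{ax, ay, az} \<subseteq> arcs Q"
      "n ax = (1, 0, 0)" "n ay = (0, 1, 0)" "n az = (0, 0, 1)" "d ax = 0" "d ay = 0" "d az = 0"
    and flow_chart: "arrow_chart Q n d v \<in> flow_space Q \<theta>"
    and flow_coordinates: "x \<in> flow_space Q \<theta> \<Longrightarrow>
      x = arrow_chart Q n d (Poly_Mapping.lookup x ax, Poly_Mapping.lookup x ay, Poly_Mapping.lookup x az)"
    and hull: "halfspaces (arcs Q) n d = convex hull V" and V: "finite V" "V \<subseteq> int3"
    and center: "a \<in> arcs Q \<Longrightarrow> 0 < n a \<bullet> c + d a"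
    and width: "a \<in> arcs Q \<Longrightarrow> v \<in> halfspaces (arcs Q) n d \<Longrightarrow> n a \<bullet> v + d a \<le> 1"
    and witness: "a \<in> arcs Q \<Longrightarrow> n a \<bullet> w a + d a < 0"
      "a \<in> arcs Q \<Longrightarrow> b \<in> arcs Q \<Longrightarrow> b \<noteq> a \<Longrightarrow> 0 \<le> n b \<bullet> w a + d b"
begin

abbreviation "nabla \<equiv> pt3_chart ` halfspaces (arcs Q) n d"

lemma finite_arcs: "finite (arcs Q)"
  using acyc unfolding acyclic_quiver_def quiver_def by (simp add: fin_digraph.finite_arcs)

lemmas lookup = lookup_arrow_chart[OF finite_arcs]

lemma chart: "lattice_chart (arrow_chart Q n d)"
proof (rule arrow_chart_lattice_chart[OF finite_arcs])
  fix v :: real3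
  obtain x y z where v: "v = (x, y, z)" by (cases v)
  have xyz: "n ax \<bullet> v = x" "n ay \<bullet> v = y" "n az \<bullet> v = z"
    by (simp_all add: v coordinate_arrows)
  show "v \<in> int3 \<longleftrightarrow> (\<forall>a\<in>arcs Q. n a \<bullet> v + d a \<in> \<int>)"
  proof
    assume "v \<in> int3"
    then show "\<forall>a\<in>arcs Q. n a \<bullet> v + d a \<in> \<int>"
      using coeffs inner_int3 Ints_add by blast
  next
    assume "\<forall>a\<in>arcs Q. n a \<bullet> v + d a \<in> \<int>"
    then have "n ax \<bullet> v + d ax \<in> \<int>" "n ay \<bullet> v + d ay \<in> \<int>" "n az \<bullet> v + d az \<in> \<int>"
      using coordinate_arrows(1) by blast+
    then show "v \<in> int3" unfolding xyz coordinate_arrows by (simp add: v)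
  qed
  show "v = 0" if "\<forall>a\<in>arcs Q. n a \<bullet> v = 0"
  proof -
    have "n ax \<bullet> v = 0" "n ay \<bullet> v = 0" "n az \<bullet> v = 0"
      using coordinate_arrows(1) that by blast+
    then show ?thesis unfolding xyz by (simp add: v zero_prod_def)
  qed
qed

lemma flow: "flow_space Q \<theta> = range (arrow_chart Q n d)"
  using flow_chart flow_coordinates by blast

lemma quiver_polytope_eq: "quiver_polytope Q \<theta> = arrow_chart Q n d ` halfspaces (arcs Q) n d"
proof -
  have "arrow_chart Q n d v \<in> quiver_polytope Q \<theta> \<longleftrightarrow> v \<in> halfspaces (arcs Q) n d" for v
    using flow_chart[of v] by (simp add: quiver_polytope_def halfspaces_def lookup)
  moreover have "quiver_polytope Q \<theta> \<subseteq> range (arrow_chart Q n d)"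
    unfolding flow[symmetric] quiver_polytope_def by blast
  ultimately show ?thesis by blast
qed

lemma aff_dim_halfspaces: "aff_dim (halfspaces (arcs Q) n d) = 3"
proof -
  have "c \<in> interior (halfspaces (arcs Q) n d)"
    by (rule interiorI[OF open_strict_halfspaces[OF finite_arcs]])
      (use center in \<open>auto simp: halfspaces_def less_imp_le\<close>)
  then have "interior (halfspaces (arcs Q) n d) \<noteq> {}" by blast
  then show ?thesis by (simp add: aff_dim_nonempty_interior)
qed

lemma equiv_quiver_polytope: "nabla \<cong>\<^sub>p quiver_polytope Q \<theta>"
  unfolding quiver_polytope_eq
  by (rule lattice_chart_equiv[OF lattice_chart_pt3 chart])
    (use aff_dim_halfspaces aff_dim_eq_full[of "halfspaces (arcs Q) n d"] in simp)

lemma bounded_quiver_polytope_eq: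
  "bounded_quiver_polytope Q \<theta> (\<lambda>_. 0) (\<lambda>_. 1) = quiver_polytope Q \<theta>"
proof
  show "bounded_quiver_polytope Q \<theta> (\<lambda>_. 0) (\<lambda>_. 1) \<subseteq> quiver_polytope Q \<theta>"
    unfolding bounded_quiver_polytope_def quiver_polytope_def by auto
  show "quiver_polytope Q \<theta> \<subseteq> bounded_quiver_polytope Q \<theta> (\<lambda>_. 0) (\<lambda>_. 1)"
  proof
    fix x assume x: "x \<in> quiver_polytope Q \<theta>"
    then obtain v where v: "v \<in> halfspaces (arcs Q) n d" "x = arrow_chart Q n d v"
      unfolding quiver_polytope_eq by blast
    then have "Poly_Mapping.lookup x a \<le> 1" if "a \<in> arcs Q" for a
      using width[OF that v(1)] that by (simp add: lookup)
    then show "x \<in> bounded_quiver_polytope Q \<theta> (\<lambda>_. 0) (\<lambda>_. 1)"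
      using x unfolding bounded_quiver_polytope_def quiver_polytope_def by simp
  qed
qed

lemma compressed_nabla: "compressed nabla"
  by (rule compressed_halfspaces[OF lattice_chart_pt3 finite_arcs coeffs refl hull V aff_dim_halfspaces width])

lemma flow_polytope_nabla: "flow_polytope nabla"
proof -
  have "quiver Q" using acyc by (simp add: acyclic_quiver_def)
  then show ?thesis
    using compressed_nabla equiv_quiver_polytope bounded_quiver_polytope_eq
    unfolding flow_polytope_def compressed_def by metis
qed

lemma dim_nabla: "polytope_dim nabla = 3"
  using polytope_dim_image[OF lattice_chartD(1)[OF lattice_chart_pt3]] aff_dim_halfspaces by simp

lemma tight: "tight Q \<theta>"
  unfolding tight_def
proof (intro conjI ballI acyc)
  fix a assume a: "a \<in> arcs Q"
  have "c \<in> halfspaces (arcs Q) n d" using center by (auto simp: halfspaces_def less_imp_le)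
  then have "arrow_chart Q n d c \<in> quiver_polytope Q \<theta>" unfolding quiver_polytope_eq by blast
  moreover have "Poly_Mapping.lookup (arrow_chart Q n d c) a \<noteq> 0"
    using center[OF a] a by (simp add: lookup)
  ultimately show "\<not> removable Q \<theta> a" unfolding removable_def by blast
  have "arrow_chart Q n d (w a) \<in> {x \<in> flow_space Q \<theta>. \<forall>b\<in>arcs Q - {a}. 0 \<le> Poly_Mapping.lookup x b}"
    using flow_chart[of "w a"] witness(2)[OF a] by (simp add: lookup)
  moreover have "arrow_chart Q n d (w a) \<notin> {x \<in> flow_space Q \<theta>. 0 \<le> Poly_Mapping.lookup x a}"
    using witness(1)[OF a] a by (simp add: lookup)
  ultimately show "\<not> contractible Q \<theta> a" unfolding contractible_def by blast
qed

lemma polytope_of_arrow_polys_eq: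
  assumes "\<And>a x y z. a \<in> arcs Q \<Longrightarrow> L a x y z = n a \<bullet> (x, y, z) + d a"
  shows "polytope_of_arrow_polys Q L = nabla"
proof -
  have mem: "(\<forall>a\<in>arcs Q. 0 \<le> L a x y z) \<longleftrightarrow> (x, y, z) \<in> halfspaces (arcs Q) n d" for x y z
    using assms by (simp add: halfspaces_def)
  show ?thesis
    unfolding polytope_of_arrow_polys_def mem
  proof (intro subset_antisym subsetI)
    fix p assume "p \<in> nabla"
    then obtain v where v: "p = pt3_chart v" "v \<in> halfspaces (arcs Q) n d" by blast
    then show "p \<in> {pt3 x y z |x y z. (x, y, z) \<in> halfspaces (arcs Q) n d}"
      by (cases v) (auto simp: pt3_chart_def)
  next
    fix p assume "p \<in> {pt3 x y z |x y z. (x, y, z) \<in> halfspaces (arcs Q) n d}"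
    then obtain x y z where "p = pt3_chart (x, y, z)" "(x, y, z) \<in> halfspaces (arcs Q) n d"
      by (auto simp: pt3_chart_def)
    then show "p \<in> nabla" by (simp only: imageI)
  qed
qed

lemma nabla_int_points: "nabla \<inter> int_points = pt3_chart ` (halfspaces (arcs Q) n d \<inter> int3)"
  using lattice_chartD(3)[OF lattice_chart_pt3] by blast

end

lemma ball_lessThan_4: "(\<forall>a\<in>{..<4::nat}. P a) \<longleftrightarrow> P 0 \<and> P 1 \<and> P 2 \<and> P 3"
  by (simp add: eval_nat_numeral lessThan_Suc) blast

lemma ball_lessThan_5: "(\<forall>a\<in>{..<5::nat}. P a) \<longleftrightarrow> P 0 \<and> P 1 \<and> P 2 \<and> P 3 \<and> P 4"
  by (simp add: eval_nat_numeral lessThan_Suc) blast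

lemma ball_lessThan_8:
  "(\<forall>a\<in>{..<8::nat}. P a) \<longleftrightarrow> P 0 \<and> P 1 \<and> P 2 \<and> P 3 \<and> P 4 \<and> P 5 \<and> P 6 \<and> P 7"
  by (simp add: eval_nat_numeral lessThan_Suc) blast

lemma sum_lessThan_4: "sum f {..<4::nat} = f 0 + f 1 + f 2 + f 3"
  by (simp add: eval_nat_numeral)

lemma sum_lessThan_5: "sum f {..<5::nat} = f 0 + f 1 + f 2 + f 3 + f 4"
  by (simp add: eval_nat_numeral)

lemma sum_lessThan_8: "sum f {..<8::nat} = f 0 + f 1 + f 2 + f 3 + f 4 + f 5 + f 6 + f 7"
  by (simp add: eval_nat_numeral)

text \<open>
  Sums over all arrows can be evaluated for a concrete quiver without computing the incident arrows of each vertex.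
\<close>

lemma flow_space_iff:
  assumes "finite (arcs Q)"
  shows "x \<in> flow_space Q \<theta> \<longleftrightarrow> (\<forall>a. a \<notin> arcs Q \<longrightarrow> Poly_Mapping.lookup x a = 0) \<and>
    (\<forall>v\<in>verts Q. (\<Sum>a\<in>arcs Q. if head Q a = v then Poly_Mapping.lookup x a else 0)
      - (\<Sum>a\<in>arcs Q. if tail Q a = v then Poly_Mapping.lookup x a else 0) = of_int (\<theta> v))"
proof -
  have "(\<Sum>a\<in>in_arcs Q v. Poly_Mapping.lookup x a) = (\<Sum>a\<in>arcs Q. if head Q a = v then Poly_Mapping.lookup x a else 0)" for v
    unfolding in_arcs_def using assms by (simp add: sum.inter_filter)
  moreover have "(\<Sum>a\<in>out_arcs Q v. Poly_Mapping.lookup x a) = (\<Sum>a\<in>arcs Q. if tail Q a = v then Poly_Mapping.lookup x a else 0)" for v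
    unfolding out_arcs_def using assms by (simp add: sum.inter_filter)
  moreover have "Poly_Mapping.keys x \<subseteq> arcs Q \<longleftrightarrow> (\<forall>a. a \<notin> arcs Q \<longrightarrow> Poly_Mapping.lookup x a = 0)"
    by (auto simp: in_keys_iff)
  ultimately show ?thesis unfolding flow_space_def by simp
qed

lemma convex_combination_4:
  assumes "convex K" "p \<in> K" "q \<in> K" "r \<in> K" "s \<in> K"
    and "0 \<le> t" "0 \<le> u" "0 \<le> v" "0 \<le> w" "t + u + v + w = 1"
  shows "t *\<^sub>R p + u *\<^sub>R q + v *\<^sub>R r + w *\<^sub>R s \<in> K"
proof -
  have "(\<Sum>i<4::nat. ([t, u, v, w] ! i) *\<^sub>R ([p, q, r, s] ! i)) \<in> K"
  proof (rule convex_sum[OF _ assms(1)])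
    show "(\<Sum>i<4. [t, u, v, w] ! i) = 1" using assms(10) by (simp add: sum_lessThan_4)
    show "0 \<le> [t, u, v, w] ! i" "[p, q, r, s] ! i \<in> K" if "i \<in> {..<4}" for i
      using that assms(2-9) by (auto simp: eval_nat_numeral less_Suc_eq)
  qed simp
  then show ?thesis by (simp add: sum_lessThan_4)
qed

lemma halfspaces_eq_convex_hullI:
  assumes "\<And>v. v \<in> V \<Longrightarrow> v \<in> halfspaces A n d" "\<And>v. v \<in> halfspaces A n d \<Longrightarrow> v \<in> convex hull V"
  shows "halfspaces A n d = convex hull V"
  using assms hull_minimal[of V "halfspaces A n d" convex, OF _ convex_halfspaces] by blast

lemma unit_cube_pointsI:
  assumes "x \<in> \<int>" "y \<in> \<int>" "z \<in> \<int>" "0 \<le> x" "x \<le> 1" "0 \<le> y" "y \<le> 1" "0 \<le> z" "z \<le> 1"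
  shows "(x, y, z) \<in> unit_cube_points"
  unfolding mem_Times_iff fst_conv snd_conv using assms by (intro conjI int_unit_interval)

section \<open>The unimodular simplex\<close>

definition n_Ia :: "nat \<Rightarrow> real3" where
  "n_Ia a = [(1, 0, 0), (0, 1, 0), (0, 0, 1), (-1, -1, -1)] ! a"
definition d_Ia :: "nat \<Rightarrow> real" where "d_Ia a = [0, 0, 0, 1] ! a"

lemma halfspaces_Ia:
  "(x, y, z) \<in> halfspaces (arcs Q_Ia) n_Ia d_Ia \<longleftrightarrow> 0 \<le> x \<and> 0 \<le> y \<and> 0 \<le> z \<and> x + y + z \<le> 1"
  by (simp add: halfspaces_def Q_Ia_def ball_lessThan_4 n_Ia_def d_Ia_def) linarith

lemma arcs_Ia: "a \<in> arcs Q_Ia \<longleftrightarrow> a = 0 \<or> a = 1 \<or> a = 2 \<or> a = 3"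
  by (auto simp: Q_Ia_def)

lemma chart_Ia:
  "Poly_Mapping.lookup (arrow_chart Q_Ia n d v) a = (if a < 4 then n a \<bullet> v + d a else 0)"
  by (simp add: lookup_arrow_chart Q_Ia_def)

lemma flow_space_Ia:
  "x \<in> flow_space Q_Ia \<theta>_Ia \<longleftrightarrow> (\<forall>a\<ge>4. Poly_Mapping.lookup x a = 0) \<and>
    Poly_Mapping.lookup x 0 + Poly_Mapping.lookup x 1 + Poly_Mapping.lookup x 2 + Poly_Mapping.lookup x 3 = 1"
  by (subst flow_space_iff) (auto simp: Q_Ia_def \<theta>_Ia_def sum_lessThan_4 not_less)

interpretation Ia: arrow_system Q_Ia \<theta>_Ia n_Ia d_Ia vertices_Ia "(1/4, 1/4, 1/4)"
  "\<lambda>a. [(-1, 0, 0), (0, -1, 0), (0, 0, -1), (1, 1, 1)] ! a" 0 1 2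
proof
  show "acyclic_quiver Q_Ia"
  proof (rule quiver_of_increasing_arrows)
    show "tail Q_Ia a \<in> verts Q_Ia \<and> head Q_Ia a \<in> verts Q_Ia \<and> tail Q_Ia a < head Q_Ia a"
      if "a \<in> arcs Q_Ia" for a
      using that unfolding arcs_Ia by (elim disjE) (simp_all add: Q_Ia_def)
  qed (simp_all add: Q_Ia_def)
  show "arrow_chart Q_Ia n_Ia d_Ia v \<in> flow_space Q_Ia \<theta>_Ia" for v
    by (cases v) (simp add: flow_space_Ia chart_Ia n_Ia_def d_Ia_def)
  show "x = arrow_chart Q_Ia n_Ia d_Ia
      (Poly_Mapping.lookup x 0, Poly_Mapping.lookup x 1, Poly_Mapping.lookup x 2)"
    if "x \<in> flow_space Q_Ia \<theta>_Ia" for x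
  proof (rule poly_mapping_eqI)
    fix a :: nat
    consider "a = 0" | "a = 1" | "a = 2" | "a = 3" | "a \<ge> 4" by linarith
    then show "Poly_Mapping.lookup x a = Poly_Mapping.lookup (arrow_chart Q_Ia n_Ia d_Ia
      (Poly_Mapping.lookup x 0, Poly_Mapping.lookup x 1, Poly_Mapping.lookup x 2)) a"
      using that unfolding flow_space_Ia by cases (simp_all add: chart_Ia n_Ia_def d_Ia_def)
  qed
  show "halfspaces (arcs Q_Ia) n_Ia d_Ia = convex hull vertices_Ia"
  proof (rule halfspaces_eq_convex_hullI)
    show "v \<in> halfspaces (arcs Q_Ia) n_Ia d_Ia" if "v \<in> vertices_Ia" for v
      using that by (auto simp: vertices_Ia_def halfspaces_Ia)
    fix v assume v: "v \<in> halfspaces (arcs Q_Ia) n_Ia d_Ia"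
    obtain x y z where xyz: "v = (x, y, z)" by (cases v)
    have "(1 - x - y - z) *\<^sub>R (0, 0, 0) + x *\<^sub>R (1, 0, 0) + y *\<^sub>R (0, 1, 0) + z *\<^sub>R (0, 0, 1)
        \<in> convex hull vertices_Ia"
      using v unfolding xyz halfspaces_Ia
      by (intro convex_combination_4 convex_convex_hull hull_inc) (auto simp: vertices_Ia_def)
    then show "v \<in> convex hull vertices_Ia" by (simp add: xyz)
  qed
  show "n_Ia a \<bullet> v + d_Ia a \<le> 1"
    if "a \<in> arcs Q_Ia" "v \<in> halfspaces (arcs Q_Ia) n_Ia d_Ia" for a v
    using that by (cases v) (auto simp: halfspaces_Ia arcs_Ia n_Ia_def d_Ia_def)
qed (auto simp: arcs_Ia n_Ia_def d_Ia_def unit_coeffs_def zero_prod_def vertices_Ia_def)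

lemma nabla_Ia_eq: "nabla_Ia = Ia.nabla"
  unfolding nabla_Ia_def
  by (rule Ia.polytope_of_arrow_polys_eq) (auto simp: arcs_Ia poly_Ia_def n_Ia_def d_Ia_def)

lemma nabla_Ia_int_points: "nabla_Ia \<inter> int_points = pt3_chart ` vertices_Ia"
proof -
  have "halfspaces (arcs Q_Ia) n_Ia d_Ia \<inter> int3 = vertices_Ia"
  proof (rule unit_cube_set_eqI)
    show "halfspaces (arcs Q_Ia) n_Ia d_Ia \<inter> int3 \<subseteq> unit_cube_points"
    proof
      fix v assume v: "v \<in> halfspaces (arcs Q_Ia) n_Ia d_Ia \<inter> int3"
      obtain x y z where xyz: "v = (x, y, z)" by (cases v)
      show "v \<in> unit_cube_points"
        unfolding xyz by (rule unit_cube_pointsI) (use v in \<open>simp_all add: xyz halfspaces_Ia\<close>)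
    qed
  qed (auto simp: halfspaces_Ia vertices_Ia_def)
  then show ?thesis by (simp add: nabla_Ia_eq Ia.nabla_int_points)
qed

section \<open>The square pyramid\<close>

definition n_IIc :: "nat \<Rightarrow> real3" where
  "n_IIc a = [(0, 1, 0), (0, 0, 1), (0, -1, -1), (1, 0, 0), (-1, -1, 0)] ! a"
definition d_IIc :: "nat \<Rightarrow> real" where "d_IIc a = [0, 0, 1, 0, 1] ! a"

lemma halfspaces_IIc:
  "(x, y, z) \<in> halfspaces (arcs Q_IIc) n_IIc d_IIc \<longleftrightarrow> 0 \<le> x \<and> 0 \<le> y \<and> 0 \<le> z \<and> y + z \<le> 1 \<and> x + y \<le> 1"
  by (simp add: halfspaces_def Q_IIc_def ball_lessThan_5 n_IIc_def d_IIc_def) linarith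

lemma arcs_IIc: "a \<in> arcs Q_IIc \<longleftrightarrow> a = 0 \<or> a = 1 \<or> a = 2 \<or> a = 3 \<or> a = 4"
  by (auto simp: Q_IIc_def)

lemma chart_IIc:
  "Poly_Mapping.lookup (arrow_chart Q_IIc n d v) a = (if a < 5 then n a \<bullet> v + d a else 0)"
  by (simp add: lookup_arrow_chart Q_IIc_def)

lemma flow_space_IIc:
  "x \<in> flow_space Q_IIc \<theta>_IIc \<longleftrightarrow> (\<forall>a\<ge>5. Poly_Mapping.lookup x a = 0) \<and>
    Poly_Mapping.lookup x 0 + Poly_Mapping.lookup x 1 + Poly_Mapping.lookup x 2 = 1 \<and>
    Poly_Mapping.lookup x 1 + Poly_Mapping.lookup x 2 = Poly_Mapping.lookup x 3 + Poly_Mapping.lookup x 4"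
  by (subst flow_space_iff) (auto simp: Q_IIc_def \<theta>_IIc_def sum_lessThan_5 not_less)

interpretation IIc: arrow_system Q_IIc \<theta>_IIc n_IIc d_IIc vertices_IIc "(1/3, 1/3, 1/3)"
  "\<lambda>a. [(1, -1, 1), (0, 0, -1), (0, 0, 2), (-1, 0, 0), (2, 0, 0)] ! a" 3 0 1
proof
  show "acyclic_quiver Q_IIc"
  proof (rule quiver_of_increasing_arrows)
    show "tail Q_IIc a \<in> verts Q_IIc \<and> head Q_IIc a \<in> verts Q_IIc \<and> tail Q_IIc a < head Q_IIc a"
      if "a \<in> arcs Q_IIc" for a
      using that unfolding arcs_IIc by (elim disjE) (simp_all add: Q_IIc_def)
  qed (simp_all add: Q_IIc_def)
  show "arrow_chart Q_IIc n_IIc d_IIc v \<in> flow_space Q_IIc \<theta>_IIc" for v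
    by (cases v) (simp add: flow_space_IIc chart_IIc n_IIc_def d_IIc_def)
  show "x = arrow_chart Q_IIc n_IIc d_IIc
      (Poly_Mapping.lookup x 3, Poly_Mapping.lookup x 0, Poly_Mapping.lookup x 1)"
    if "x \<in> flow_space Q_IIc \<theta>_IIc" for x
  proof (rule poly_mapping_eqI)
    fix a :: nat
    consider "a = 0" | "a = 1" | "a = 2" | "a = 3" | "a = 4" | "a \<ge> 5" by linarith
    then show "Poly_Mapping.lookup x a = Poly_Mapping.lookup (arrow_chart Q_IIc n_IIc d_IIc
      (Poly_Mapping.lookup x 3, Poly_Mapping.lookup x 0, Poly_Mapping.lookup x 1)) a"
      using that unfolding flow_space_IIc by cases (simp_all add: chart_IIc n_IIc_def d_IIc_def)
  qed
  show "halfspaces (arcs Q_IIc) n_IIc d_IIc = convex hull vertices_IIc"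
  proof (rule halfspaces_eq_convex_hullI)
    show "v \<in> halfspaces (arcs Q_IIc) n_IIc d_IIc" if "v \<in> vertices_IIc" for v
      using that by (auto simp: vertices_IIc_def halfspaces_IIc)
    fix v assume v: "v \<in> halfspaces (arcs Q_IIc) n_IIc d_IIc"
    obtain x y z where xyz: "v = (x, y, z)" by (cases v)
    show "v \<in> convex hull vertices_IIc"
    (* The diagonal from the origin to (1, 0, 1) divides the pyramid into two simplices. *)
    proof (cases "x \<le> z")
      case True
      have "(1 - y - z) *\<^sub>R (0, 0, 0) + x *\<^sub>R (1, 0, 1) + y *\<^sub>R (0, 1, 0) + (z - x) *\<^sub>R (0, 0, 1)
          \<in> convex hull vertices_IIc"
        using v True unfolding xyz halfspaces_IIc
        by (intro convex_combination_4 convex_convex_hull hull_inc) (auto simp: vertices_IIc_def)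
      then show ?thesis by (simp add: xyz)
    next
      case False
      have "(1 - x - y) *\<^sub>R (0, 0, 0) + z *\<^sub>R (1, 0, 1) + y *\<^sub>R (0, 1, 0) + (x - z) *\<^sub>R (1, 0, 0)
          \<in> convex hull vertices_IIc"
        using v False unfolding xyz halfspaces_IIc
        by (intro convex_combination_4 convex_convex_hull hull_inc) (auto simp: vertices_IIc_def)
      then show ?thesis by (simp add: xyz)
    qed
  qed
  show "n_IIc a \<bullet> v + d_IIc a \<le> 1"
    if "a \<in> arcs Q_IIc" "v \<in> halfspaces (arcs Q_IIc) n_IIc d_IIc" for a v
    using that by (cases v) (auto simp: halfspaces_IIc arcs_IIc n_IIc_def d_IIc_def)
qed (auto simp: arcs_IIc n_IIc_def d_IIc_def unit_coeffs_def zero_prod_def vertices_IIc_def)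

lemma nabla_IIc_eq: "nabla_IIc = IIc.nabla"
  unfolding nabla_IIc_def
  by (rule IIc.polytope_of_arrow_polys_eq) (auto simp: arcs_IIc poly_IIc_def n_IIc_def d_IIc_def)

lemma nabla_IIc_int_points: "nabla_IIc \<inter> int_points = pt3_chart ` vertices_IIc"
proof -
  have "halfspaces (arcs Q_IIc) n_IIc d_IIc \<inter> int3 = vertices_IIc"
  proof (rule unit_cube_set_eqI)
    show "halfspaces (arcs Q_IIc) n_IIc d_IIc \<inter> int3 \<subseteq> unit_cube_points"
    proof
      fix v assume v: "v \<in> halfspaces (arcs Q_IIc) n_IIc d_IIc \<inter> int3"
      obtain x y z where xyz: "v = (x, y, z)" by (cases v)
      show "v \<in> unit_cube_points"
        unfolding xyz by (rule unit_cube_pointsI) (use v in \<open>simp_all add: xyz halfspaces_IIc\<close>)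
    qed
  qed (auto simp: halfspaces_IIc vertices_IIc_def)
  then show ?thesis by (simp add: nabla_IIc_eq IIc.nabla_int_points)
qed

section \<open>The octahedron\<close>

definition n_Ib :: "nat \<Rightarrow> real3" where
  "n_Ib a = [(1, 0, 0), (0, 1, 0), (0, 0, -1), (-1, -1, 1), (-1, 0, 0), (0, -1, 0), (0, 0, 1), (1, 1, -1)] ! a"
definition d_Ib :: "nat \<Rightarrow> real" where "d_Ib a = [0, 0, 1, 1, 1, 1, 0, 0] ! a"

lemma halfspaces_Ib:
  "(x, y, z) \<in> halfspaces (arcs Q_Ib) n_Ib d_Ib \<longleftrightarrow> 0 \<le> x \<and> x \<le> 1 \<and> 0 \<le> y \<and> y \<le> 1 \<and> 0 \<le> z \<and> z \<le> 1 \<and>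
    z \<le> x + y \<and> x + y \<le> z + 1"
  by (simp add: halfspaces_def Q_Ib_def ball_lessThan_8 n_Ib_def d_Ib_def) linarith

lemma arcs_Ib: "a \<in> arcs Q_Ib \<longleftrightarrow> a = 0 \<or> a = 1 \<or> a = 2 \<or> a = 3 \<or> a = 4 \<or> a = 5 \<or> a = 6 \<or> a = 7"
  by (auto simp: Q_Ib_def)

lemma chart_Ib:
  "Poly_Mapping.lookup (arrow_chart Q_Ib n d v) a = (if a < 8 then n a \<bullet> v + d a else 0)"
  by (simp add: lookup_arrow_chart Q_Ib_def)

lemma flow_space_Ib:
  "x \<in> flow_space Q_Ib \<theta>_Ib \<longleftrightarrow> (\<forall>a\<ge>8. Poly_Mapping.lookup x a = 0) \<and>
    Poly_Mapping.lookup x 0 + Poly_Mapping.lookup x 1 + Poly_Mapping.lookup x 2 + Poly_Mapping.lookup x 3 = 2 \<and>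
    Poly_Mapping.lookup x 4 + Poly_Mapping.lookup x 5 + Poly_Mapping.lookup x 6 + Poly_Mapping.lookup x 7 = 2 \<and>
    Poly_Mapping.lookup x 0 + Poly_Mapping.lookup x 4 = 1 \<and> Poly_Mapping.lookup x 1 + Poly_Mapping.lookup x 5 = 1 \<and>
    Poly_Mapping.lookup x 2 + Poly_Mapping.lookup x 6 = 1 \<and> Poly_Mapping.lookup x 3 + Poly_Mapping.lookup x 7 = 1"
  by (subst flow_space_iff) (auto simp: Q_Ib_def \<theta>_Ib_def sum_lessThan_8 not_less)

interpretation Ib: arrow_system Q_Ib \<theta>_Ib n_Ib d_Ib vertices_Ib "(1/2, 1/2, 1/2)"
  "\<lambda>a. [(-1/3, 2/3, 1/3), (2/3, -1/3, 1/3), (2/3, 2/3, 4/3), (2/3, 2/3, 0), (4/3, 1/3, 2/3), (1/3, 4/3, 2/3), (1/3, 1/3, -1/3), (1/3, 1/3, 1)] ! a" 0 1 6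
proof
  show "acyclic_quiver Q_Ib"
  proof (rule quiver_of_increasing_arrows)
    show "tail Q_Ib a \<in> verts Q_Ib \<and> head Q_Ib a \<in> verts Q_Ib \<and> tail Q_Ib a < head Q_Ib a"
      if "a \<in> arcs Q_Ib" for a
      using that unfolding arcs_Ib by (elim disjE) (simp_all add: Q_Ib_def)
  qed (simp_all add: Q_Ib_def)
  show "arrow_chart Q_Ib n_Ib d_Ib v \<in> flow_space Q_Ib \<theta>_Ib" for v
    by (cases v) (simp add: flow_space_Ib chart_Ib n_Ib_def d_Ib_def)
  show "x = arrow_chart Q_Ib n_Ib d_Ib
      (Poly_Mapping.lookup x 0, Poly_Mapping.lookup x 1, Poly_Mapping.lookup x 6)"
    if "x \<in> flow_space Q_Ib \<theta>_Ib" for x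
  proof (rule poly_mapping_eqI)
    fix a :: nat
    consider "a = 0" | "a = 1" | "a = 2" | "a = 3" | "a = 4" | "a = 5" | "a = 6" | "a = 7" | "a \<ge> 8" by linarith
    then show "Poly_Mapping.lookup x a = Poly_Mapping.lookup (arrow_chart Q_Ib n_Ib d_Ib
      (Poly_Mapping.lookup x 0, Poly_Mapping.lookup x 1, Poly_Mapping.lookup x 6)) a"
      using that unfolding flow_space_Ib by cases (simp_all add: chart_Ib n_Ib_def d_Ib_def)
  qed
  show "halfspaces (arcs Q_Ib) n_Ib d_Ib = convex hull vertices_Ib"
  proof (rule halfspaces_eq_convex_hullI)
    show "v \<in> halfspaces (arcs Q_Ib) n_Ib d_Ib" if "v \<in> vertices_Ib" for v
      using that by (auto simp: vertices_Ib_def halfspaces_Ib)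
    fix v assume v: "v \<in> halfspaces (arcs Q_Ib) n_Ib d_Ib"
    obtain x y z where xyz: "v = (x, y, z)" by (cases v)
    (* The octahedron is the union of four simplices around its diagonal from the
       origin to (1, 1, 1). *)
    note combination = convex_combination_4[OF convex_convex_hull, of _ vertices_Ib]
    consider "y \<le> z" "z \<le> x" | "x \<le> z" "y \<le> z" | "x \<le> z" "z \<le> y" | "z \<le> x" "z \<le> y" by linarith
    then show "v \<in> convex hull vertices_Ib"
    proof cases
      case 1
      have "(1 - x) *\<^sub>R (0, 0, 0) + y *\<^sub>R (1, 1, 1) + (z - y) *\<^sub>R (1, 0, 1) + (x - z) *\<^sub>R (1, 0, 0)
          \<in> convex hull vertices_Ib"
        using v 1 unfolding xyz halfspaces_Ib by (intro combination hull_inc) (auto simp: vertices_Ib_def)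
      then show ?thesis by (simp add: xyz)
    next
      case 2
      have "(1 - z) *\<^sub>R (0, 0, 0) + (x + y - z) *\<^sub>R (1, 1, 1) + (z - y) *\<^sub>R (1, 0, 1) + (z - x) *\<^sub>R (0, 1, 1)
          \<in> convex hull vertices_Ib"
        using v 2 unfolding xyz halfspaces_Ib by (intro combination hull_inc) (auto simp: vertices_Ib_def)
      then show ?thesis by (simp add: xyz)
    next
      case 3
      have "(1 - y) *\<^sub>R (0, 0, 0) + x *\<^sub>R (1, 1, 1) + (y - z) *\<^sub>R (0, 1, 0) + (z - x) *\<^sub>R (0, 1, 1)
          \<in> convex hull vertices_Ib"
        using v 3 unfolding xyz halfspaces_Ib by (intro combination hull_inc) (auto simp: vertices_Ib_def)
      then show ?thesis by (simp add: xyz)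
    next
      case 4
      have "(1 - x - y + z) *\<^sub>R (0, 0, 0) + z *\<^sub>R (1, 1, 1) + (y - z) *\<^sub>R (0, 1, 0) + (x - z) *\<^sub>R (1, 0, 0)
          \<in> convex hull vertices_Ib"
        using v 4 unfolding xyz halfspaces_Ib by (intro combination hull_inc) (auto simp: vertices_Ib_def)
      then show ?thesis by (simp add: xyz)
    qed
  qed
  show "n_Ib a \<bullet> v + d_Ib a \<le> 1"
    if "a \<in> arcs Q_Ib" "v \<in> halfspaces (arcs Q_Ib) n_Ib d_Ib" for a v
    using that by (cases v) (auto simp: halfspaces_Ib arcs_Ib n_Ib_def d_Ib_def)
qed (auto simp: arcs_Ib n_Ib_def d_Ib_def unit_coeffs_def zero_prod_def vertices_Ib_def)

lemma nabla_Ib_eq: "nabla_Ib = Ib.nabla"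
  unfolding nabla_Ib_def
  by (rule Ib.polytope_of_arrow_polys_eq) (auto simp: arcs_Ib poly_Ib_def n_Ib_def d_Ib_def)

lemma nabla_Ib_int_points: "nabla_Ib \<inter> int_points = pt3_chart ` vertices_Ib"
proof -
  have "halfspaces (arcs Q_Ib) n_Ib d_Ib \<inter> int3 = vertices_Ib"
  proof (rule unit_cube_set_eqI)
    show "halfspaces (arcs Q_Ib) n_Ib d_Ib \<inter> int3 \<subseteq> unit_cube_points"
    proof
      fix v assume v: "v \<in> halfspaces (arcs Q_Ib) n_Ib d_Ib \<inter> int3"
      obtain x y z where xyz: "v = (x, y, z)" by (cases v)
      show "v \<in> unit_cube_points"
        unfolding xyz by (rule unit_cube_pointsI) (use v in \<open>simp_all add: xyz halfspaces_Ib\<close>)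
    qed
  qed (auto simp: halfspaces_Ib vertices_Ib_def)
  then show ?thesis by (simp add: nabla_Ib_eq Ib.nabla_int_points)
qed

section \<open>The classification theorem\<close>

lemma card_pt3_chart: "card (pt3_chart ` V) = card V"
  using lattice_chartD(2)[OF lattice_chart_pt3] by (meson card_image inj_on_subset subset_UNIV)

lemma card_nabla_int_points:
  "card (nabla_Ia \<inter> int_points) = 4" "card (nabla_IIc \<inter> int_points) = 5"
  "card (nabla_Ib \<inter> int_points) = 6"
  unfolding nabla_Ia_int_points nabla_IIc_int_points nabla_Ib_int_points card_pt3_chart
  by (simp_all add: vertices_Ia_def vertices_IIc_def vertices_Ib_def)

lemma prime_nabla_Ia: "prime_polytope nabla_Ia"
proof (rule prime_if_at_most_5_int_points)
  show "lattice_polytope nabla_Ia" using Ia.compressed_nabla by (simp add: nabla_Ia_eq compressed_def)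
  show "polytope_dim nabla_Ia = 3" unfolding nabla_Ia_eq by (rule Ia.dim_nabla)
  show "card (nabla_Ia \<inter> int_points) \<le> 5" using card_nabla_int_points by simp
  show "finite (nabla_Ia \<inter> int_points)" unfolding nabla_Ia_int_points by (simp add: Ia.V)
qed

lemma prime_nabla_IIc: "prime_polytope nabla_IIc"
proof (rule prime_if_at_most_5_int_points)
  show "lattice_polytope nabla_IIc" using IIc.compressed_nabla by (simp add: nabla_IIc_eq compressed_def)
  show "polytope_dim nabla_IIc = 3" unfolding nabla_IIc_eq by (rule IIc.dim_nabla)
  show "card (nabla_IIc \<inter> int_points) \<le> 5" using card_nabla_int_points by simp
  show "finite (nabla_IIc \<inter> int_points)" unfolding nabla_IIc_int_points by (simp add: IIc.V)
qed

lemma pt3_chart_diff: "pt3_chart v - pt3_chart w = pt3_chart (v - w)"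
  by (cases v; cases w; rule poly_mapping_eqI) (simp add: pt3_chart_def lookup_pt3 lookup_minus)

lemma prime_nabla_Ib: "prime_polytope nabla_Ib"
proof (rule prime_if_6_symmetric_int_points)
  show "lattice_polytope nabla_Ib" using Ib.compressed_nabla by (simp add: nabla_Ib_eq compressed_def)
  show "polytope_dim nabla_Ib = 3" unfolding nabla_Ib_eq by (rule Ib.dim_nabla)
  show "card (nabla_Ib \<inter> int_points) = 6" by (rule card_nabla_int_points)
  have "(1, 1, 1) - v \<in> vertices_Ib" if "v \<in> vertices_Ib" for v
    using that unfolding vertices_Ib_def by (elim insertE emptyE) (simp_all add: zero_prod_def)
  then show "pt3_chart (1, 1, 1) - x \<in> nabla_Ib \<inter> int_points" if "x \<in> nabla_Ib \<inter> int_points" for x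
    using that unfolding nabla_Ib_int_points by (auto simp only: pt3_chart_diff)
qed

lemma prime_compressed_flow_nabla:
  "prime_compressed_flow_3polytope nabla_Ia" "prime_compressed_flow_3polytope nabla_IIc"
  "prime_compressed_flow_3polytope nabla_Ib"
  unfolding prime_compressed_flow_3polytope_def
  using prime_nabla_Ia prime_nabla_IIc prime_nabla_Ib
  by (simp_all add: nabla_Ia_eq nabla_IIc_eq nabla_Ib_eq Ia.flow_polytope_nabla IIc.flow_polytope_nabla
      Ib.flow_polytope_nabla Ia.compressed_nabla IIc.compressed_nabla Ib.compressed_nabla
      Ia.dim_nabla IIc.dim_nabla Ib.dim_nabla)

lemma classification:
  assumes "prime_compressed_flow_3polytope P"
  shows "P \<cong>\<^sub>p nabla_Ia \<or> P \<cong>\<^sub>p nabla_IIc \<or> P \<cong>\<^sub>p nabla_Ib"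
proof -
  have "classified P"
    using assms prime_compressed_classified[of P]
    unfolding prime_compressed_flow_3polytope_def compressed_def by blast
  then show ?thesis
    unfolding classified_def nabla_Ia_eq nabla_IIc_eq nabla_Ib_eq Ia.hull IIc.hull Ib.hull .
qed

lemma nabla_not_equiv:
  "\<not> nabla_Ia \<cong>\<^sub>p nabla_IIc" "\<not> nabla_Ia \<cong>\<^sub>p nabla_Ib" "\<not> nabla_IIc \<cong>\<^sub>p nabla_Ib"
  using polytope_equiv_card_int_points card_nabla_int_points by fastforce+

theorem proposition4p2:
  shows "prime_compressed_flow_3polytope nabla_Ia \<and>
     prime_compressed_flow_3polytope nabla_IIc \<and>
     prime_compressed_flow_3polytope nabla_Ib \<and>
     \<not> nabla_Ia \<cong>\<^sub>p nabla_IIc \<and> \<not> nabla_Ia \<cong>\<^sub>p nabla_Ib \<and> \<not> nabla_IIc \<cong>\<^sub>p nabla_Ib \<and>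
     (\<forall>P :: (nat \<Rightarrow>\<^sub>0 real) set. prime_compressed_flow_3polytope P \<longrightarrow>
        P \<cong>\<^sub>p nabla_Ia \<or> P \<cong>\<^sub>p nabla_IIc \<or> P \<cong>\<^sub>p nabla_Ib) \<and>
     tight Q_Ia \<theta>_Ia \<and> nabla_Ia \<cong>\<^sub>p quiver_polytope Q_Ia \<theta>_Ia \<and>
     nabla_Ia \<inter> int_points = {pt3 0 0 0, pt3 1 0 0, pt3 0 1 0, pt3 0 0 1} \<and>
     tight Q_IIc \<theta>_IIc \<and> nabla_IIc \<cong>\<^sub>p quiver_polytope Q_IIc \<theta>_IIc \<and>
     nabla_IIc \<inter> int_points = {pt3 0 0 0, pt3 0 0 1, pt3 1 0 0, pt3 1 0 1, pt3 0 1 0} \<and>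
     tight Q_Ib \<theta>_Ib \<and> nabla_Ib \<cong>\<^sub>p quiver_polytope Q_Ib \<theta>_Ib \<and>
     nabla_Ib \<inter> int_points =
       {pt3 0 0 0, pt3 1 0 0, pt3 1 0 1, pt3 0 1 0, pt3 0 1 1, pt3 1 1 1}"
proof (intro conjI allI impI)
  show "nabla_Ia \<cong>\<^sub>p quiver_polytope Q_Ia \<theta>_Ia" "nabla_IIc \<cong>\<^sub>p quiver_polytope Q_IIc \<theta>_IIc"
    "nabla_Ib \<cong>\<^sub>p quiver_polytope Q_Ib \<theta>_Ib"
    unfolding nabla_Ia_eq nabla_IIc_eq nabla_Ib_eq
    by (rule Ia.equiv_quiver_polytope IIc.equiv_quiver_polytope Ib.equiv_quiver_polytope)+
qed (simp_all add: prime_compressed_flow_nabla nabla_not_equiv classification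
    Ia.tight IIc.tight Ib.tight nabla_Ia_int_points nabla_IIc_int_points nabla_Ib_int_points
    vertices_Ia_def vertices_IIc_def vertices_Ib_def pt3_chart_def)

end
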